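(* Let $k\ge 2$ be a fixed integer. For each $n$, let $p_1=p_1(n),\dots,p_k=p_k(n)$ be positive integers with $p=p_1+\cdots+p_k$, and let $\mathbf{x}(1),\dots,\mathbf{x}(n)$ be i.i.d. observations of a $p$-dimensional normal vector $\mathbf{x}=(\mathbf{x}_1',\dots,\mathbf{x}_k')'$, where $\mathbf{x}_i$ has dimension $p_i$, with arbitrary mean vector and a covariance matrix $\Sigma=(\Sigma_{ij})_{i,j=1}^k$ satisfying the null hypothesis $\Sigma_{ij}=0$ for all $i\neq j$ (i.e. the $k$ sub-vectors are independent). Let $\mathbf{B}$ be the block correlation matrix and $\boldsymbol{s}(\mathbf{B})=\frac12\operatorname{tr}\mathbf{B}^2-\frac p2$ the Schott type statistic (defined in the context). Assume $p_i/n\to y_i\in(0,1)$ for all $i\in\{1,\dots,k\}$ as $n\to\infty$. Then $$\frac{\boldsymbol{s}(\mathbf{B})-a_n}{\sqrt{b_n}}\Longrightarrow N(0,1),\qquad n\to\infty,$$ where $$a_n=\frac12\sum_{i\neq j}\frac{p_ip_j}{n-1},\qquad b_n=\sum_{i\neq j}\frac{p_ip_j(n-1-p_i)(n-1-p_j)}{(n-1)^4},$$ the sums being over ordered pairs $(i,j)$ with $i,j\in\{1,\dots,k\}$, $i\ne j$.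
   Context: Write $\mathbf{x}_i(j)$ for the $i$-th sub-vector of $\mathbf{x}(j)$, $\bar{\mathbf{x}}=n^{-1}\sum_{j=1}^n\mathbf{x}(j)$, $\bar{\mathbf{x}}_i=n^{-1}\sum_{j=1}^n\mathbf{x}_i(j)$. Define the $p\times n$ matrix $\mathbf{X}=[\mathbf{x}(1)-\bar{\mathbf{x}},\dots,\mathbf{x}(n)-\bar{\mathbf{x}}]$ and the $p_i\times n$ matrices $\mathbf{X}_i=[\mathbf{x}_i(1)-\bar{\mathbf{x}}_i,\dots,\mathbf{x}_i(n)-\bar{\mathbf{x}}_i]$. The block correlation matrix is the $p\times p$ matrix $$\mathbf{B}=\mathrm{diag}\big((\mathbf{X}_i\mathbf{X}_i')^{-1/2}\big)_{i=1}^k\,\mathbf{X}\mathbf{X}'\,\mathrm{diag}\big((\mathbf{X}_i\mathbf{X}_i')^{-1/2}\big)_{i=1}^k,$$ i.e. its $(i,j)$ block is $(\mathbf{X}_i\mathbf{X}_i')^{-1/2}\mathbf{X}_i\mathbf{X}_j'(\mathbf{X}_j\mathbf{X}_j')^{-1/2}$, where $\mathrm{diag}(\mathbf{A}_i)_{i=1}^k$ denotes the block-diagonal matrix with diagonal blocks $\mathbf{A}_1,\dots,\mathbf{A}_k$. The Schott type statistic is $\boldsymbol{s}(\mathbf{B})=\frac12\operatorname{tr}\mathbf{B}^2-\frac p2$. *)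

theory Defs
  imports "HOL-Probability.Probability" "Jordan_Normal_Form.Matrix"
begin

definition mat_trace :: "real mat \<Rightarrow> real" where
  "mat_trace A = (\<Sum>i<dim_row A. A $$ (i, i))"

definition pos_def_mat :: "nat \<Rightarrow> real mat \<Rightarrow> bool" where
  "pos_def_mat d R \<longleftrightarrow> R \<in> carrier_mat d d \<and> transpose_mat R = R \<and>
     (\<forall>v \<in> carrier_vec d. v \<noteq> 0\<^sub>v d \<longrightarrow> v \<bullet> (R *\<^sub>v v) > 0)"

text \<open>A^(-1/2) for a symmetric positive definite A: the unique symmetric positive definite R
  with R R A = I (i.e. R^2 = A^(-1)). Set to the zero matrix when no such unique R exists
  (this happens only on a null event in the theorem).\<close>
definition inv_sqrt_mat :: "real mat \<Rightarrow> real mat" where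
  "inv_sqrt_mat A =
     (let d = dim_row A; P = (\<lambda>R. pos_def_mat d R \<and> R * R * A = 1\<^sub>m d)
      in if \<exists>!R. P R then (THE R. P R) else 0\<^sub>m d d)"

definition blk_off :: "(nat \<Rightarrow> nat) \<Rightarrow> nat \<Rightarrow> nat" where
  "blk_off pp i = (\<Sum>l<i. pp l)"

text \<open>Index of the block containing coordinate r (for r < blk_off pp k, all pp l > 0).\<close>
definition blk_of :: "(nat \<Rightarrow> nat) \<Rightarrow> nat \<Rightarrow> nat" where
  "blk_of pp r = (LEAST i. r < blk_off pp (Suc i))"

definition data_mat :: "nat \<Rightarrow> nat \<Rightarrow> (nat \<Rightarrow> nat \<Rightarrow> real) \<Rightarrow> real mat" where
  "data_mat p n x = mat p n (\<lambda>(r, j). x j r - (\<Sum>l<n. x l r) / real n)"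

definition sub_data_mat :: "(nat \<Rightarrow> nat) \<Rightarrow> nat \<Rightarrow> nat \<Rightarrow> real mat \<Rightarrow> real mat" where
  "sub_data_mat pp n i X = mat (pp i) n (\<lambda>(r, j). X $$ (blk_off pp i + r, j))"

definition block_corr :: "nat \<Rightarrow> (nat \<Rightarrow> nat) \<Rightarrow> nat \<Rightarrow> (nat \<Rightarrow> nat \<Rightarrow> real) \<Rightarrow> real mat" where
  "block_corr k pp n x =
     (let p = blk_off pp k; X = data_mat p n x;
          S = (\<lambda>i. let Xi = sub_data_mat pp n i X in inv_sqrt_mat (Xi * transpose_mat Xi));
          D = mat p p (\<lambda>(r, c). if blk_of pp r = blk_of pp c
                 then S (blk_of pp r) $$ (r - blk_off pp (blk_of pp r), c - blk_off pp (blk_of pp r))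
                 else 0)
      in D * (X * transpose_mat X) * D)"

definition schott_stat :: "nat \<Rightarrow> (nat \<Rightarrow> nat) \<Rightarrow> nat \<Rightarrow> (nat \<Rightarrow> nat \<Rightarrow> real) \<Rightarrow> real" where
  "schott_stat k pp n x =
     (let B = block_corr k pp n x in mat_trace (B * B) / 2 - real (blk_off pp k) / 2)"

text \<open>X (a random vector with coordinates X w 0, ..., X w (p-1)) is p-variate normal with
  mean mu and covariance Sigma: every linear combination c'X is univariate normal with
  mean c'mu and variance c' Sigma c (degenerate = a.s. constant when the variance is 0).\<close>
definition mvn :: "'a measure \<Rightarrow> nat \<Rightarrow> ('a \<Rightarrow> nat \<Rightarrow> real) \<Rightarrow> (nat \<Rightarrow> real)
    \<Rightarrow> (nat \<Rightarrow> nat \<Rightarrow> real) \<Rightarrow> bool" where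
  "mvn M p X \<mu> \<Sigma> \<longleftrightarrow>
    (\<forall>c :: nat \<Rightarrow> real.
       let m = (\<Sum>r<p. c r * \<mu> r); v = (\<Sum>r<p. \<Sum>s<p. c r * \<Sigma> r s * c s);
           L = (\<lambda>w. \<Sum>r<p. c r * X w r)
       in if v = 0 then L \<in> borel_measurable M \<and> (AE w in M. L w = m)
          else distributed M lborel L (normal_density m (sqrt v)))"

end

(*
Let P_i be the orthogonal projection of R^n onto the row space of the centred data matrix X_i.
Then s(B) = (1/2) tr (P_1 + ... + P_k)^2 - p/2, so the statistic is the sum of tr(P_i P_j) over
i < j. Under the null hypothesis the joint law of (P_1, ..., P_k) is invariant under conjugating a
single P_j by a rotation that fixes the vector (1, ..., 1).  Infinitesimally this says E[D_A F] = 0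
for every skew-symmetric generator A and every smooth F; summed over an orthonormal family of
generators it is an integration by parts formula on the Grassmannian.

With N = n - 1, the linear function tr(P_j Q) - p_j tr(Q)/N is an eigenfunction of the Laplacian
in P_j, with an eigenvalue proportional to N, so the centred statistic T satisfies the exact Stein
identity E[T h(T)] = E[V h'(T)] with V = (1/2N) sum_j |[P_j, Q_j]|^2 and Q_j the sum of the other
projections.  The same formula applied to tr(P Q) and tr(P Q P Q) bounds their variances by
constants, hence V = b_n + O(1/N) in L^1.  Taking h = sin(t .), cos(t .) gives a differential
equation for the characteristic function of T up to O(1/N), and Levy's continuity theorem finishes
the proof.
*)

theory Submission
  imports Defs "Jordan_Normal_Form.Determinant"
begin

section \<open>Matrices of finite support\<close>

text \<open>The dimensions grow with n, so all estimates must be uniform in them. The squared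
  Frobenius norm of a projection is at most n, and multiplying by a projection does not increase
  this norm; set against an eigenvalue of order n, this leaves mean squares of order 1 with
  constants depending on k alone. Because the Stein kernel is divided by N, such O(1) bounds
  suffice, and the variance of T is never computed exactly: \<open>v_of\<close> is assembled from
  approximate means of the traces and meets b_n only in the limit. Every function involved is a
  bounded function of the projections, so no moments of the sample occur. Normality enters in two
  places: characteristic functions of linear combinations determine the joint law of the array,
  which gives the rotation invariance, and a nontrivial linear combination has no atoms, which gives
  the almost sure full rank behind tr P_i = p_i. A singular Gram matrix is covered by the default
  value 0 of the inverse square root, which makes P_i = 0, so that the trace formula for the
  statistic holds for every data array.\<close>

text \<open>Matrices of all sizes live in one type, so that ring and normed algebra reasoning applies without
  dimension side conditions. The norm is the entrywise $l^1$ norm, which dominates the trace.\<close>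

typedef fmat = "{f :: nat \<Rightarrow> nat \<Rightarrow> real. \<exists>n. \<forall>a b. n \<le> a \<or> n \<le> b \<longrightarrow> f a b = 0}"
  morphisms ent Fmat
  by (rule exI[of _ "\<lambda>a b. 0"]) simp

setup_lifting type_definition_fmat

definition fits :: "nat \<Rightarrow> fmat \<Rightarrow> bool" where
  "fits n A \<longleftrightarrow> (\<forall>a b. n \<le> a \<or> n \<le> b \<longrightarrow> ent A a b = 0)"

definition fdim :: "fmat \<Rightarrow> nat" where
  "fdim A = (LEAST n. fits n A)"

lemma fits_fdim: "fits (fdim A) A"
proof -
  have "\<exists>n. fits n A"
    using ent[of A] unfolding fits_def by simp
  then show ?thesis
    unfolding fdim_def by (rule LeastI_ex)
qed

lemma fits_mono: "fits n A \<Longrightarrow> n \<le> m \<Longrightarrow> fits m A"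
  unfolding fits_def by auto

lemma fits_common: obtains n where "fits n A" "fits n B" "fits n C"
  by (rule that[of "max (fdim A) (max (fdim B) (fdim C))"])
    (auto intro: fits_mono[OF fits_fdim])

lemma fmat_eqI: "(\<And>a b. ent A a b = ent B a b) \<Longrightarrow> A = B"
  by (simp add: ent_inject[symmetric] fun_eq_iff)

lift_definition fcut :: "nat \<Rightarrow> nat \<Rightarrow> (nat \<Rightarrow> nat \<Rightarrow> real) \<Rightarrow> fmat"
  is "\<lambda>m n f a b. if a < m \<and> b < n then f a b else 0"
  by (rule_tac x = "max nat1 nat2" in exI) auto

lemma ent_fcut: "ent (fcut m n f) a b = (if a < m \<and> b < n then f a b else 0)"
  by transfer simp

lemma fits_fcut [simp]: "m \<le> k \<Longrightarrow> n \<le> k \<Longrightarrow> fits k (fcut m n f)"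
  by (auto simp: fits_def ent_fcut)

text \<open>Lets a sum over the minimal size \<open>fdim\<close> be taken over any size that fits;
  the formulas for products, norms and traces all go through it.\<close>

lemma sum_restrict_dim:
  fixes f :: "nat \<Rightarrow> real"
  assumes "\<And>c. m \<le> c \<Longrightarrow> f c = 0" "\<And>c. n \<le> c \<Longrightarrow> f c = 0"
  shows "sum f {..<m} = sum f {..<n}"
  by (rule sum.mono_neutral_cong) (use assms in auto)

instantiation fmat :: ring
begin

lift_definition zero_fmat :: fmat is "\<lambda>a b. 0" by simp

lift_definition plus_fmat :: "fmat \<Rightarrow> fmat \<Rightarrow> fmat" is "\<lambda>f g a b. f a b + g a b"
  by (elim exE, rule_tac x = "max n na" in exI) auto

lift_definition minus_fmat :: "fmat \<Rightarrow> fmat \<Rightarrow> fmat" is "\<lambda>f g a b. f a b - g a b"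
  by (elim exE, rule_tac x = "max n na" in exI) auto

lift_definition uminus_fmat :: "fmat \<Rightarrow> fmat" is "\<lambda>f a b. - f a b"
  by (elim exE, rule_tac x = n in exI) auto

definition times_fmat :: "fmat \<Rightarrow> fmat \<Rightarrow> fmat" where
  "A * B = fcut (max (fdim A) (fdim B)) (max (fdim A) (fdim B))
     (\<lambda>a b. \<Sum>c<fdim A. ent A a c * ent B c b)"

lemma ent_mult_left:
  assumes "fits n A"
  shows "ent (A * B) a b = (\<Sum>c<n. ent A a c * ent B c b)"
proof -
  have "(\<Sum>c<n. ent A a c * ent B c b) = (\<Sum>c<fdim A. ent A a c * ent B c b)"
    by (rule sum_restrict_dim) (use assms fits_fdim[of A] in \<open>auto simp: fits_def\<close>)
  then show ?thesis
    using fits_fdim[of A] fits_fdim[of B]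
    by (auto simp: times_fmat_def ent_fcut fits_def)
qed

lemma ent_mult_right:
  assumes "fits n B"
  shows "ent (A * B) a b = (\<Sum>c<n. ent A a c * ent B c b)"
proof -
  have "(\<Sum>c<n. ent A a c * ent B c b) = (\<Sum>c<fdim A. ent A a c * ent B c b)"
    by (rule sum_restrict_dim) (use assms fits_fdim[of A] in \<open>auto simp: fits_def\<close>)
  then show ?thesis
    using ent_mult_left[OF fits_fdim, of A B a b] by simp
qed

lemma ent_ring:
  "ent 0 a b = 0" "ent (A + B) a b = ent A a b + ent B a b"
  "ent (A - B) a b = ent A a b - ent B a b" "ent (- A) a b = - ent A a b"
  by (transfer, simp)+

instance
proof
  fix A B C :: fmat
  show "A * B * C = A * (B * C)"
  proof (rule fmat_eqI)
    fix a b
    obtain n where n: "fits n A" "fits n B" "fits n C"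
      by (rule fits_common)
    have "ent (A * B * C) a b = (\<Sum>c<n. (\<Sum>d<n. ent A a d * ent B d c) * ent C c b)"
      by (simp add: ent_mult_right[OF n(3)] ent_mult_left[OF n(1)])
    also have "\<dots> = (\<Sum>c<n. \<Sum>d<n. ent A a d * ent B d c * ent C c b)"
      by (simp add: sum_distrib_right)
    also have "\<dots> = (\<Sum>d<n. \<Sum>c<n. ent A a d * ent B d c * ent C c b)"
      by (rule sum.swap)
    also have "\<dots> = ent (A * (B * C)) a b"
      by (simp add: ent_mult_right[OF n(3)] ent_mult_left[OF n(1)] sum_distrib_left mult.assoc)
    finally show "ent (A * B * C) a b = ent (A * (B * C)) a b" .
  qed
  show "(A + B) * C = A * C + B * C"
    by (rule fmat_eqI)
      (simp add: ent_mult_right[OF fits_fdim] ent_ring algebra_simps sum.distrib)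
  show "A * (B + C) = A * B + A * C"
    by (rule fmat_eqI)
      (simp add: ent_mult_left[OF fits_fdim] ent_ring algebra_simps sum.distrib)
qed (auto intro!: fmat_eqI simp: ent_ring)

end

definition fnorm :: "fmat \<Rightarrow> real" where
  "fnorm A = (\<Sum>a<fdim A. \<Sum>b<fdim A. \<bar>ent A a b\<bar>)"

lemma fnorm_eq:
  assumes "fits n A"
  shows "fnorm A = (\<Sum>a<n. \<Sum>b<n. \<bar>ent A a b\<bar>)"
proof -
  have eq: "(\<Sum>b<fdim A. \<bar>ent A a b\<bar>) = (\<Sum>b<n. \<bar>ent A a b\<bar>)" for a
    by (rule sum_restrict_dim) (use assms fits_fdim[of A] in \<open>auto simp: fits_def\<close>)
  show ?thesis
    unfolding fnorm_def eq
    by (rule sum_restrict_dim) (use assms fits_fdim[of A] in \<open>auto simp: fits_def\<close>)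
qed

text \<open>The normed algebra structure makes the product rule available for derivatives of curves
  of matrices.\<close>

instantiation fmat :: real_normed_algebra
begin

lift_definition scaleR_fmat :: "real \<Rightarrow> fmat \<Rightarrow> fmat" is "\<lambda>r f a b. r * f a b"
  by (elim exE, rule_tac x = n in exI) auto

lemma ent_scaleR: "ent (r *\<^sub>R A) a b = r * ent A a b"
  by transfer simp

definition norm_fmat :: "fmat \<Rightarrow> real" where "norm_fmat = fnorm"

definition dist_fmat :: "fmat \<Rightarrow> fmat \<Rightarrow> real" where "dist_fmat A B = norm (A - B)"

definition sgn_fmat :: "fmat \<Rightarrow> fmat" where "sgn_fmat A = inverse (norm A) *\<^sub>R A"

definition uniformity_fmat :: "(fmat \<times> fmat) filter" where
  "uniformity_fmat = (INF e\<in>{0 <..}. principal {(x, y). dist x y < e})"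

definition open_fmat :: "fmat set \<Rightarrow> bool" where
  "open_fmat U \<longleftrightarrow> (\<forall>x\<in>U. eventually (\<lambda>(x', y). x' = x \<longrightarrow> y \<in> U) uniformity)"

instance
proof
  fix A B C :: fmat and r s :: real
  show "r *\<^sub>R (A + B) = r *\<^sub>R A + r *\<^sub>R B" "(r + s) *\<^sub>R A = r *\<^sub>R A + s *\<^sub>R A"
    "r *\<^sub>R s *\<^sub>R A = (r * s) *\<^sub>R A" "1 *\<^sub>R A = A"
    by (auto intro!: fmat_eqI simp: ent_ring ent_scaleR algebra_simps)
  show "r *\<^sub>R A * B = r *\<^sub>R (A * B)"
    by (rule fmat_eqI)
      (simp add: ent_mult_right[OF fits_fdim] ent_scaleR sum_distrib_left mult.assoc)
  show "A * r *\<^sub>R B = r *\<^sub>R (A * B)"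
    by (rule fmat_eqI)
      (simp add: ent_mult_left[OF fits_fdim] ent_scaleR sum_distrib_left mult.left_commute)
  obtain n where n: "fits n A" "fits n B" "fits n (A * B)"
    by (rule fits_common)
  have nA: "norm A = (\<Sum>a<n. \<Sum>b<n. \<bar>ent A a b\<bar>)" and nB: "norm B = (\<Sum>a<n. \<Sum>b<n. \<bar>ent B a b\<bar>)"
    and nM: "norm (A * B) = (\<Sum>a<n. \<Sum>b<n. \<bar>ent (A * B) a b\<bar>)"
    using n by (simp_all add: norm_fmat_def fnorm_eq)
  have "fits n (A + B)" "fits n (r *\<^sub>R A)"
    using n by (auto simp: fits_def ent_ring ent_scaleR)
  then have nP: "norm (A + B) = (\<Sum>a<n. \<Sum>b<n. \<bar>ent A a b + ent B a b\<bar>)"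
    and nS: "norm (r *\<^sub>R A) = (\<Sum>a<n. \<Sum>b<n. \<bar>r * ent A a b\<bar>)"
    by (simp_all add: norm_fmat_def fnorm_eq ent_ring ent_scaleR)
  have "norm A = 0 \<longleftrightarrow> (\<forall>a\<in>{..<n}. \<forall>b\<in>{..<n}. ent A a b = 0)"
    unfolding nA by (subst sum_nonneg_eq_0_iff | simp add: sum_nonneg sum_nonneg_eq_0_iff)+
  also have "\<dots> \<longleftrightarrow> (\<forall>a b. ent A a b = 0)"
    using n(1) unfolding fits_def by (metis lessThan_iff not_less)
  also have "\<dots> \<longleftrightarrow> A = 0"
    by (auto intro: fmat_eqI simp: ent_ring)
  finally show "norm A = 0 \<longleftrightarrow> A = 0" .
  show "norm (A + B) \<le> norm A + norm B"
    unfolding nA nB nP by (simp add: sum.distrib[symmetric] sum_mono abs_triangle_ineq)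
  show "norm (r *\<^sub>R A) = \<bar>r\<bar> * norm A"
    unfolding nA nS by (simp add: abs_mult sum_distrib_left)
  have "norm (A * B) \<le> (\<Sum>a<n. \<Sum>b<n. \<Sum>c<n. \<bar>ent A a c\<bar> * \<bar>ent B c b\<bar>)"
    unfolding nM ent_mult_left[OF n(1)]
    by (intro sum_mono order_trans[OF sum_abs]) (simp add: abs_mult)
  also have "\<dots> = (\<Sum>a<n. \<Sum>c<n. \<bar>ent A a c\<bar> * (\<Sum>b<n. \<bar>ent B c b\<bar>))"
    unfolding sum_distrib_left by (intro sum.cong refl sum.swap)
  also have "\<dots> \<le> (\<Sum>a<n. \<Sum>c<n. \<bar>ent A a c\<bar> * norm B)"
    unfolding nB
    by (intro sum_mono mult_left_mono member_le_sum[where f = "\<lambda>c. \<Sum>b<n. \<bar>ent B c b\<bar>"])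
      (auto intro: sum_nonneg)
  also have "\<dots> = norm A * norm B"
    unfolding nA by (simp add: sum_distrib_right)
  finally show "norm (A * B) \<le> norm A * norm B" .
qed (auto simp: dist_fmat_def sgn_fmat_def uniformity_fmat_def open_fmat_def)

end

lemma norm_fmat_eq: "fits n A \<Longrightarrow> norm A = (\<Sum>a<n. \<Sum>b<n. \<bar>ent A a b\<bar>)"
  by (simp add: norm_fmat_def fnorm_eq)

lemma ent_sum: "ent (sum f I) a b = (\<Sum>i\<in>I. ent (f i) a b)"
  by (induction I rule: infinite_finite_induct) (auto simp: ent_ring)

lemma fits_arith:
  "fits n 0" "fits n A \<Longrightarrow> fits n B \<Longrightarrow> fits n (A + B)"
  "fits n A \<Longrightarrow> fits n B \<Longrightarrow> fits n (A - B)"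
  "fits n A \<Longrightarrow> fits n (- A)" "fits n A \<Longrightarrow> fits n (r *\<^sub>R A)"
  by (auto simp: fits_def ent_ring ent_scaleR)

lemma fits_mult: "fits n A \<Longrightarrow> fits n B \<Longrightarrow> fits n (A * B)"
  unfolding fits_def[of n "A * B"] by (auto simp: ent_mult_left fits_def)

section \<open>Trace and transpose\<close>

definition tr :: "fmat \<Rightarrow> real" where
  "tr A = (\<Sum>a<fdim A. ent A a a)"

lemma tr_eq:
  assumes "fits n A"
  shows "tr A = (\<Sum>a<n. ent A a a)"
  unfolding tr_def
  by (rule sum_restrict_dim) (use assms fits_fdim[of A] in \<open>auto simp: fits_def\<close>)

lemma abs_tr_le_norm: "\<bar>tr A\<bar> \<le> norm A"
  unfolding tr_def norm_fmat_eq[OF fits_fdim]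
  by (rule order_trans[OF sum_abs], intro sum_mono, rule member_le_sum) auto

lemma tr_add [simp]: "tr (A + B) = tr A + tr B"
proof -
  obtain n where "fits n A" "fits n B" "fits n (A + B)" by (rule fits_common)
  then show ?thesis by (simp add: tr_eq ent_ring sum.distrib)
qed

lemma tr_scaleR [simp]: "tr (r *\<^sub>R A) = r * tr A"
proof -
  obtain n where "fits n A" "fits n (r *\<^sub>R A)" by (rule fits_common)
  then show ?thesis by (simp add: tr_eq ent_scaleR sum_distrib_left)
qed

lemma bounded_linear_tr: "bounded_linear tr"
  by (rule bounded_linear_intro[where K = 1]) (auto simp: abs_tr_le_norm)

lemma tr_minus [simp]: "tr (A - B) = tr A - tr B" "tr (- A) = - tr A" "tr 0 = 0"
  using linear_diff[OF bounded_linear.linear[OF bounded_linear_tr]]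
    linear_neg[OF bounded_linear.linear[OF bounded_linear_tr]]
    linear_0[OF bounded_linear.linear[OF bounded_linear_tr]] by simp_all

lemma tr_sum: "tr (sum f I) = (\<Sum>i\<in>I. tr (f i))"
  using linear_sum[OF bounded_linear.linear[OF bounded_linear_tr]] by simp

lemma tr_commute: "tr (A * B) = tr (B * A)"
proof -
  obtain n where n: "fits n A" "fits n B" by (rule fits_common[of A B A])
  have "tr (A * B) = (\<Sum>a<n. \<Sum>c<n. ent A a c * ent B c a)"
    using n by (simp add: tr_eq[OF fits_mult[OF n]] ent_mult_left)
  also have "\<dots> = (\<Sum>c<n. \<Sum>a<n. ent A a c * ent B c a)"
    by (rule sum.swap)
  also have "\<dots> = tr (B * A)"
    using n by (simp add: tr_eq[OF fits_mult[OF n(2,1)]] ent_mult_left mult.commute)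
  finally show ?thesis .
qed

lift_definition tp :: "fmat \<Rightarrow> fmat" is "\<lambda>f a b. f b a"
  by blast

lemma ent_tp: "ent (tp A) a b = ent A b a"
  by transfer simp

lemma fits_tp [simp]: "fits n (tp A) \<longleftrightarrow> fits n A"
  by (auto simp: fits_def ent_tp)

lemma tp_simps [simp]:
  "tp (tp A) = A" "tp 0 = 0" "tp (A + B) = tp A + tp B" "tp (A - B) = tp A - tp B"
  "tp (- A) = - tp A" "tp (r *\<^sub>R A) = r *\<^sub>R tp A"
  by (auto intro!: fmat_eqI simp: ent_tp ent_ring ent_scaleR)

lemma tr_tp [simp]: "tr (tp A) = tr A"
  using tr_eq[of "fdim A" "tp A"] tr_eq[of "fdim A" A] by (simp add: fits_fdim ent_tp)

lemma tp_mult [simp]: "tp (A * B) = tp B * tp A"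
proof (rule fmat_eqI)
  fix a b
  obtain n where n: "fits n A" "fits n B" by (rule fits_common[of A B A])
  then show "ent (tp (A * B)) a b = ent (tp B * tp A) a b"
    by (simp add: ent_tp ent_mult_left[of n] mult.commute)
qed

lemma tp_sum: "tp (sum f I) = (\<Sum>i\<in>I. tp (f i))"
  by (induction I rule: infinite_finite_induct) auto

section \<open>The Frobenius norm\<close>

definition fro2 :: "fmat \<Rightarrow> real" where
  "fro2 A = tr (tp A * A)"

lemma fro2_eq:
  assumes "fits n A"
  shows "fro2 A = (\<Sum>a<n. \<Sum>b<n. (ent A a b)\<^sup>2)"
proof -
  have "fro2 A = (\<Sum>b<n. \<Sum>a<n. (ent A a b)\<^sup>2)"
    using assms
    by (simp add: fro2_def tr_eq[OF fits_mult] ent_mult_left[of n] ent_tp power2_eq_square)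
  also have "\<dots> = (\<Sum>a<n. \<Sum>b<n. (ent A a b)\<^sup>2)"
    by (rule sum.swap)
  finally show ?thesis .
qed

lemma fro2_nonneg [simp]: "0 \<le> fro2 A"
  unfolding fro2_eq[OF fits_fdim] by (intro sum_nonneg) auto

lemma fro2_tp: "fro2 (tp A) = fro2 A"
  unfolding fro2_def using tr_commute by auto

lemma fro2_add: "fro2 (A + B) = fro2 A + 2 * tr (tp A * B) + fro2 B"
proof -
  have "tr (tp B * A) = tr (tp A * B)"
    using tr_tp[of "tp B * A"] by simp
  then show ?thesis
    unfolding fro2_def by (simp add: algebra_simps)
qed

lemma fro2_scaleR: "fro2 (r *\<^sub>R A) = r\<^sup>2 * fro2 A"
  unfolding fro2_def by (simp add: power2_eq_square)

lemma fro2_minus: "fro2 (- A) = fro2 A"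
  unfolding fro2_def by simp

lemma tr_le_fro2: "2 * \<bar>tr (tp A * B)\<bar> \<le> fro2 A + fro2 B"
  using fro2_nonneg[of "A + B"] fro2_nonneg[of "A + - B"]
  unfolding fro2_add fro2_minus by auto

lemma abs_tr_mult_le: "2 * \<bar>tr (A * B)\<bar> \<le> fro2 A + fro2 B"
  using tr_le_fro2[of "tp A" B] by (simp add: fro2_tp)

lemma fro2_add_le: "fro2 (A + B) \<le> 2 * fro2 A + 2 * fro2 B"
  using tr_le_fro2[of A B] unfolding fro2_add by linarith

lemma fro2_diff_le: "fro2 (A - B) \<le> 2 * fro2 A + 2 * fro2 B"
  using fro2_add_le[of A "- B"] by (simp add: fro2_minus)

text \<open>Each of the cross terms in the expanded square is at most c; the loss is a power of the
  number of summands, which is later bounded by the fixed k.\<close>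

lemma fro2_sum_le:
  assumes "finite I" "\<And>i. i \<in> I \<Longrightarrow> fro2 (f i) \<le> c"
  shows "fro2 (sum f I) \<le> (real (card I))\<^sup>2 * c"
proof -
  have "fro2 (sum f I) = (\<Sum>i\<in>I. \<Sum>j\<in>I. tr (tp (f i) * f j))"
    by (simp add: fro2_def tp_sum sum_product tr_sum)
  also have "\<dots> \<le> (\<Sum>i\<in>I. \<Sum>j\<in>I. c)"
  proof (intro sum_mono)
    fix i j assume "i \<in> I" "j \<in> I"
    then show "tr (tp (f i) * f j) \<le> c"
      using tr_le_fro2[of "f i" "f j"] assms(2)[of i] assms(2)[of j] by linarith
  qed
  finally show ?thesis by (simp add: power2_eq_square mult.assoc)
qed

section \<open>Orthogonal projections, rank one matrices and the centring matrix\<close>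

definition proj :: "fmat \<Rightarrow> bool" where
  "proj P \<longleftrightarrow> tp P = P \<and> P * P = P"

text \<open>Pythagoras: \<open>B\<close> splits into the orthogonal parts \<open>P * B\<close> and
  \<open>B - P * B\<close>.\<close>

lemma fro2_proj_mult_le:
  assumes "proj P"
  shows "fro2 (P * B) \<le> fro2 B"
proof -
  have P: "tp P = P" "P * (P * C) = P * C" for C
    using assms unfolding proj_def mult.assoc[symmetric] by auto
  have "fro2 B - fro2 (P * B) = fro2 (B - P * B)"
    unfolding fro2_def by (simp add: algebra_simps P)
  then show ?thesis
    using fro2_nonneg[of "B - P * B"] by linarith
qed

definition dotn :: "nat \<Rightarrow> (nat \<Rightarrow> real) \<Rightarrow> (nat \<Rightarrow> real) \<Rightarrow> real" where
  "dotn n u v = (\<Sum>r<n. u r * v r)"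

definition outer :: "nat \<Rightarrow> (nat \<Rightarrow> real) \<Rightarrow> (nat \<Rightarrow> real) \<Rightarrow> fmat" where
  "outer n u v = fcut n n (\<lambda>r s. u r * v s)"

text \<open>An infinite identity matrix does not have finite support, so the ring has no unit;
  \<open>idm n\<close> is the unit of the n by n corner.\<close>

definition idm :: "nat \<Rightarrow> fmat" where
  "idm n = fcut n n (\<lambda>r s. if r = s then 1 else 0)"

definition centre :: "nat \<Rightarrow> fmat" where
  "centre n = fcut n n (\<lambda>r s. (if r = s then 1 else 0) - 1 / real n)"

lemma fits_basic [simp]: "fits n (outer n u v)" "fits n (idm n)" "fits n (centre n)"
  by (simp_all add: outer_def idm_def centre_def)

lemma sum_delta_mult:
  fixes f :: "nat \<Rightarrow> real"
  assumes "r < n"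
  shows "(\<Sum>c<n. (if r = c then 1 else 0) * f c) = f r"
    "(\<Sum>c<n. f c * (if c = r then 1 else 0)) = f r"
proof -
  have "(if r = c then 1 else 0) * f c = (if r = c then f c else 0)"
    "f c * (if c = r then 1 else 0) = (if r = c then f c else 0)" for c
    by auto
  with assms show "(\<Sum>c<n. (if r = c then 1 else 0) * f c) = f r"
    "(\<Sum>c<n. f c * (if c = r then 1 else 0)) = f r" by simp_all
qed

lemma idm_mult [simp]: "fits n A \<Longrightarrow> idm n * A = A" "fits n A \<Longrightarrow> A * idm n = A"
proof -
  assume A: "fits n A"
  have "ent (idm n * A) r s = ent A r s" for r s
  proof (cases "r < n")
    case True
    then show ?thesis
      by (simp add: ent_mult_left[of n] idm_def ent_fcut sum_delta_mult)
  qed (use A in \<open>auto simp: ent_mult_left[of n] idm_def ent_fcut fits_def\<close>)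
  then show "idm n * A = A" by (rule fmat_eqI)
  have "ent (A * idm n) r s = ent A r s" for r s
  proof (cases "s < n")
    case True
    then show ?thesis
      by (simp add: ent_mult_right[of n] idm_def ent_fcut sum_delta_mult)
  qed (use A in \<open>auto simp: ent_mult_right[of n] idm_def ent_fcut fits_def\<close>)
  then show "A * idm n = A" by (rule fmat_eqI)
qed

lemma tp_basic [simp]:
  "tp (outer n u v) = outer n v u" "tp (idm n) = idm n" "tp (centre n) = centre n"
  by (auto intro!: fmat_eqI simp: ent_tp outer_def idm_def centre_def ent_fcut)

lemma tr_idm [simp]: "tr (idm n) = real n"
  by (simp add: tr_eq[of n] idm_def ent_fcut)

lemma tr_centre: "1 \<le> n \<Longrightarrow> tr (centre n) = real n - 1"
  by (simp add: tr_eq[of n] centre_def ent_fcut field_simps)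

definition bil :: "nat \<Rightarrow> fmat \<Rightarrow> (nat \<Rightarrow> real) \<Rightarrow> (nat \<Rightarrow> real) \<Rightarrow> real" where
  "bil n X u v = (\<Sum>r<n. \<Sum>s<n. u r * ent X r s * v s)"

lemma outer_mult_mult:
  assumes "fits n X"
  shows "outer n u v * X * outer n w z = bil n X v w *\<^sub>R outer n u z"
proof (rule fmat_eqI)
  fix r s
  show "ent (outer n u v * X * outer n w z) r s = ent (bil n X v w *\<^sub>R outer n u z) r s"
  proof (cases "r < n \<and> s < n")
    case True
    then have "ent (outer n u v * X * outer n w z) r s
        = (\<Sum>c<n. (\<Sum>d<n. u r * v d * ent X d c) * (w c * z s))"
      by (simp add: ent_mult_right[of n] ent_mult_left[of n] outer_def ent_fcut)
    also have "\<dots> = (\<Sum>c<n. \<Sum>d<n. (v d * ent X d c * w c) * (u r * z s))"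
      by (simp add: sum_distrib_left sum_distrib_right mult_ac)
    also have "\<dots> = (\<Sum>c<n. \<Sum>d<n. v d * ent X d c * w c) * (u r * z s)"
      by (simp only: sum_distrib_right)
    also have "(\<Sum>c<n. \<Sum>d<n. v d * ent X d c * w c) = bil n X v w"
      unfolding bil_def by (rule sum.swap)
    finally show ?thesis using True by (simp add: ent_scaleR outer_def ent_fcut)
  next
    case False
    have "fits n (outer n u v * X * outer n w z)" "fits n (bil n X v w *\<^sub>R outer n u z)"
      using assms by (simp_all add: fits_mult fits_arith)
    then show ?thesis using False by (auto simp: fits_def not_less)
  qed
qed

lemma tr_outer_mult:
  assumes "fits n X"
  shows "tr (outer n u v * X) = bil n X v u"
proof -
  have "tr (outer n u v * X) = (\<Sum>r<n. \<Sum>c<n. v c * ent X c r * u r)"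
    using assms by (simp add: tr_eq[of n] fits_mult ent_mult_left[of n] outer_def ent_fcut mult_ac)
  also have "\<dots> = bil n X v u"
    unfolding bil_def by (rule sum.swap)
  finally show ?thesis .
qed

lemma bil_idm: "bil n (idm n) u v = dotn n u v"
proof -
  have "bil n (idm n) u v = (\<Sum>r<n. \<Sum>s<n. if r = s then u r * v s else 0)"
    unfolding bil_def idm_def ent_fcut by (intro sum.cong refl) auto
  then show ?thesis by (simp add: dotn_def)
qed

lemma outer_mult_outer: "outer n u v * outer n w z = dotn n v w *\<^sub>R outer n u z"
  using outer_mult_mult[of n "idm n" u v w z] by (simp add: bil_idm)

section \<open>The Helmert basis\<close>

text \<open>For a < n - 1 these form an orthonormal basis of the vectors of R^n with coordinate sum
  0, the space on which rotations fixing (1, ..., 1) act. The vectors do not depend on n, which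
  permits induction on the dimension.\<close>

definition helmert :: "nat \<Rightarrow> nat \<Rightarrow> real" where
  "helmert a r = (if r \<le> a then 1 else if r = Suc a then - (real a + 1) else 0)
     / sqrt ((real a + 1) * (real a + 2))"

lemma sum_helmert:
  assumes "Suc a < n"
  shows "(\<Sum>r<n. helmert a r) = 0"
proof -
  have "(\<Sum>r<n. helmert a r) = (\<Sum>r<Suc (Suc a). helmert a r)"
    using assms by (intro sum.mono_neutral_right) (auto simp: helmert_def)
  also have "\<dots> = (\<Sum>r<Suc a. 1 / sqrt ((real a + 1) * (real a + 2)))
      - (real a + 1) / sqrt ((real a + 1) * (real a + 2))"
    unfolding sum.lessThan_Suc[of _ "Suc a"]
    by (simp add: helmert_def minus_divide_left del: sum.lessThan_Suc sum_constant)
  also have "\<dots> = 0"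
    by simp
  finally show ?thesis .
qed

text \<open>For a < b the vector \<open>helmert b\<close> is constant on the support of
  \<open>helmert a\<close>, whose coordinates sum to 0.\<close>

lemma dotn_helmert:
  assumes "Suc a < n" "Suc b < n"
  shows "dotn n (helmert a) (helmert b) = (if a = b then 1 else 0)"
proof -
  have 1: "dotn n (helmert a) (helmert b) = 0" if "a < b" "Suc b < n" for a b
  proof -
    have "helmert a r * helmert b r = helmert a r * (1 / sqrt ((real b + 1) * (real b + 2)))" for r
      using that by (auto simp: helmert_def)
    then have "dotn n (helmert a) (helmert b)
        = (\<Sum>r<n. helmert a r) * (1 / sqrt ((real b + 1) * (real b + 2)))"
      unfolding dotn_def by (simp only: sum_distrib_right)
    then show ?thesis using sum_helmert[of a n] that by simp
  qed
  have 2: "dotn n (helmert a) (helmert a) = 1"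
  proof -
    have "dotn n (helmert a) (helmert a) = (\<Sum>r<Suc (Suc a). helmert a r * helmert a r)"
      unfolding dotn_def using assms by (intro sum.mono_neutral_right) (auto simp: helmert_def)
    also have "\<dots> = 1"
    proof -
      have "helmert a r * helmert a r = 1 / ((real a + 1) * (real a + 2))" if "r < Suc a" for r
        using that by (auto simp: helmert_def)
      moreover have "(- real a - 1) * (- real a - 1) = (real a + 1)\<^sup>2"
        by (simp add: power2_eq_square algebra_simps)
      then have "helmert a (Suc a) * helmert a (Suc a) = (real a + 1)\<^sup>2 / ((real a + 1) * (real a + 2))"
        by (simp add: helmert_def)
      ultimately have "(\<Sum>r<Suc (Suc a). helmert a r * helmert a r)
          = (\<Sum>r<Suc a. 1 / ((real a + 1) * (real a + 2)))
            + (real a + 1)\<^sup>2 / ((real a + 1) * (real a + 2))"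
        unfolding sum.lessThan_Suc[of _ "Suc a"] by (metis (no_types, lifting) lessThan_iff sum.cong)
      also have "\<dots> = (real a + 1) / ((real a + 1) * (real a + 2))
            + (real a + 1)\<^sup>2 / ((real a + 1) * (real a + 2))"
        by (simp only: sum_constant card_lessThan of_nat_Suc times_divide_eq_right mult_1_right add.commute)
      also have "\<dots> = ((real a + 1) * (real a + 2)) / ((real a + 1) * (real a + 2))"
        unfolding add_divide_distrib[symmetric] by (simp add: power2_eq_square algebra_simps)
      finally show ?thesis by simp
    qed
    finally show ?thesis .
  qed
  show ?thesis
    using 1[of a b] 1[of b a] 2 assms
    by (cases a b rule: linorder_cases) (auto simp: dotn_def mult.commute)
qed

text \<open>In dimension n + 1 the constant unit vector completes the n vectors to an orthonormal
  basis; it accounts for the subtracted 1 / (n + 1). In the induction step the coordinate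
  \<open>Suc n\<close> lies outside the support of all earlier vectors, so only the new one
  contributes there.\<close>

lemma sum_helmert_outer:
  assumes "r < Suc n" "s < Suc n"
  shows "(\<Sum>a<n. helmert a r * helmert a s) = (if r = s then 1 else 0) - 1 / (real n + 1)"
  using assms
proof (induction n)
  case (Suc n)
  have last: "helmert n r * helmert n s
      = (if r \<le> n then 1 else - (real n + 1)) * (if s \<le> n then 1 else - (real n + 1))
        / ((real n + 1) * (real n + 2))"
    using Suc.prems by (auto simp: helmert_def)
  have zero: "(\<Sum>a<n. helmert a r * helmert a s) = 0" if "r = Suc n \<or> s = Suc n"
    using that by (intro sum.neutral) (auto simp: helmert_def)
  have nz: "real n + 1 \<noteq> 0" by simp
  have edge: "- (real n + 1) / ((real n + 1) * (real n + 2)) = - (1 / (real n + 2))"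
    "(- (real n + 1)) * (- (real n + 1)) / ((real n + 1) * (real n + 2)) = 1 - 1 / (real n + 2)"
  proof -
    show "- (real n + 1) / ((real n + 1) * (real n + 2)) = - (1 / (real n + 2))"
      using nonzero_mult_divide_mult_cancel_left[OF nz, of "- 1" "real n + 2"] by simp
    have "(- (real n + 1)) * (- (real n + 1)) = (real n + 1) * (real n + 1)"
      by (rule minus_mult_minus)
    then have "(- (real n + 1)) * (- (real n + 1)) / ((real n + 1) * (real n + 2))
        = (real n + 1) / (real n + 2)"
      by (simp only: nonzero_mult_divide_mult_cancel_left[OF nz])
    also have "\<dots> = 1 - 1 / (real n + 2)"
      by (simp add: field_simps)
    finally show "(- (real n + 1)) * (- (real n + 1)) / ((real n + 1) * (real n + 2))
        = 1 - 1 / (real n + 2)" .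
  qed
  consider "r < Suc n" "s < Suc n" | "r = Suc n" | "s = Suc n" using Suc.prems by linarith
  then show ?case
  proof cases
    case 1
    have "(\<Sum>a<Suc n. helmert a r * helmert a s)
        = (if r = s then 1 else 0) - 1 / (real n + 1) + 1 / ((real n + 1) * (real n + 2))"
      using Suc.IH[OF 1] last 1 by simp
    moreover have "1 / (x + 1) - 1 / ((x + 1) * (x + 2)) = 1 / (x + 2)" if "0 \<le> x" for x :: real
    proof -
      have nz: "x + 1 \<noteq> 0" "x + 2 \<noteq> 0" using that by auto
      then have "1 / (x + 1) - 1 / ((x + 1) * (x + 2)) = (x + 2 - 1) / ((x + 1) * (x + 2))"
        unfolding diff_divide_distrib by simp
      also have "x + 2 - 1 = (x + 1) * 1"
        by simp
      also have "(x + 1) * 1 / ((x + 1) * (x + 2)) = 1 / (x + 2)"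
        using nz(1) by (rule nonzero_mult_divide_mult_cancel_left)
      finally show ?thesis .
    qed
    from this[of "real n"] have "1 / (real n + 1) - 1 / ((real n + 1) * (real n + 2)) = 1 / (real n + 2)"
      by simp
    ultimately show ?thesis by (simp add: algebra_simps)
  next
    case 2
    have "helmert n r * helmert n s = (if r = s then 1 else 0) - 1 / (real n + 2)"
      unfolding last using 2 edge Suc.prems by (auto simp: add.commute)
    then show ?thesis using 2 zero by (simp add: add.commute)
  next
    case 3
    have "helmert n r * helmert n s = (if r = s then 1 else 0) - 1 / (real n + 2)"
      unfolding last using 3 edge Suc.prems by (auto simp: add.commute)
    then show ?thesis using 3 zero by (simp add: add.commute)
  qed
qed simp

lemma sum_helmert_centre:
  assumes "r < n" "s < n"
  shows "(\<Sum>a<n - 1. helmert a r * helmert a s) = ent (centre n) r s"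
  using sum_helmert_outer[of r "n - 1" s] assms by (simp add: centre_def ent_fcut of_nat_diff)

lemma centre_eq: "centre n = (\<Sum>a<n - 1. outer n (helmert a) (helmert a))"
proof (rule fmat_eqI)
  fix r s
  show "ent (centre n) r s = ent (\<Sum>a<n - 1. outer n (helmert a) (helmert a)) r s"
  proof (cases "r < n \<and> s < n")
    case True
    then show ?thesis
      by (simp add: ent_sum outer_def ent_fcut sum_helmert_centre[symmetric])
  next
    case False
    then have "ent (outer n (helmert a) (helmert a)) r s = 0" for a
      by (auto simp: outer_def ent_fcut)
    moreover have "ent (centre n) r s = 0"
      using False by (auto simp: centre_def ent_fcut)
    ultimately show ?thesis by (simp add: ent_sum)
  qed
qed

lemma centre_mult_outer:
  assumes "a < n - 1"
  shows "centre n * outer n (helmert a) v = outer n (helmert a) v"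
proof -
  have "centre n * outer n (helmert a) v
      = (\<Sum>b<n - 1. if b = a then outer n (helmert a) v else 0)"
    unfolding centre_eq sum_distrib_right
    by (intro sum.cong refl) (use assms in \<open>auto simp: outer_mult_outer dotn_helmert\<close>)
  then show ?thesis using assms by simp
qed

lemma outer_mult_centre:
  assumes "a < n - 1"
  shows "outer n v (helmert a) * centre n = outer n v (helmert a)"
  using arg_cong[OF centre_mult_outer[OF assms, of v], of tp] by simp

lemma centre_idem: "centre n * centre n = centre n"
  by (subst (2) centre_eq, subst (2) centre_eq)
    (simp add: sum_distrib_left centre_mult_outer)

text \<open>The skew-symmetric generator of rotations in the plane of two basis vectors. The sums
  below run over all ordered pairs: each plane is counted twice and a = b contributes 0.\<close>

definition gen :: "nat \<Rightarrow> nat \<Rightarrow> nat \<Rightarrow> fmat" where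
  "gen n a b = outer n (helmert a) (helmert b) - outer n (helmert b) (helmert a)"

lemma fits_gen [simp]: "fits n (gen n a b)"
  by (simp add: gen_def fits_arith)

text \<open>Parseval's identity in the Helmert basis; each summation over the basis inserts one copy
  of \<open>centre n\<close>.\<close>

lemma bil_sum_right:
  assumes "fits n X" "fits n Y"
  shows "(\<Sum>a<n - 1. \<Sum>b<n - 1. bil n X (helmert a) (helmert b) * bil n Y (helmert a) (helmert b))
    = tr (tp X * centre n * Y * centre n)"
proof -
  let ?h = helmert and ?I = "{..<n - 1}"
  have "bil n X (?h a) (?h b) * bil n Y (?h a) (?h b)
      = tr (outer n (?h b) (?h b) * (tp X * outer n (?h a) (?h a) * Y))" for a b
  proof -
    have "outer n (?h b) (?h a) * Y * outer n (?h b) (?h b)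
        = bil n Y (?h a) (?h b) *\<^sub>R outer n (?h b) (?h b)"
      by (rule outer_mult_mult[OF assms(2)])
    have eq: "outer n (?h b) (?h b) * tp X * outer n (?h a) (?h a)
        = bil n X (?h a) (?h b) *\<^sub>R outer n (?h b) (?h a)"
    proof -
      have "bil n (tp X) (?h b) (?h a) = bil n X (?h a) (?h b)"
        unfolding bil_def ent_tp by (subst sum.swap) (simp add: mult_ac)
      then show ?thesis using outer_mult_mult[of n "tp X"] assms by simp
    qed
    have "tr (outer n (?h b) (?h b) * (tp X * outer n (?h a) (?h a) * Y))
        = tr (outer n (?h b) (?h b) * tp X * outer n (?h a) (?h a) * Y)"
      by (simp add: mult.assoc)
    also have "\<dots> = bil n X (?h a) (?h b) * bil n Y (?h a) (?h b)"
      unfolding eq by (simp add: tr_outer_mult[OF assms(2)])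
    finally show ?thesis by simp
  qed
  then have "(\<Sum>a\<in>?I. \<Sum>b\<in>?I. bil n X (?h a) (?h b) * bil n Y (?h a) (?h b))
      = (\<Sum>a\<in>?I. tr (centre n * (tp X * outer n (?h a) (?h a) * Y)))"
    unfolding centre_eq sum_distrib_right tr_sum by simp
  also have "\<dots> = tr (centre n * (tp X * centre n * Y))"
    by (subst (3) centre_eq) (simp add: sum_distrib_left sum_distrib_right tr_sum)
  also have "\<dots> = tr (tp X * centre n * Y * centre n)"
    by (subst tr_commute) simp
  finally show ?thesis .
qed

lemma bil_sum_diag:
  assumes "fits n X"
  shows "(\<Sum>a<n - 1. bil n X (helmert a) (helmert a)) = tr (centre n * X)"
  by (subst centre_eq) (simp add: sum_distrib_right tr_sum tr_outer_mult assms)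

lemma bil_tp: "bil n (tp X) u v = bil n X v u"
  unfolding bil_def ent_tp by (subst sum.swap) (simp add: mult_ac)

lemma tr_gen_mult:
  assumes "fits n X"
  shows "tr (gen n a b * X) = bil n X (helmert b) (helmert a) - bil n X (helmert a) (helmert b)"
  by (simp add: gen_def left_diff_distrib tr_outer_mult assms)

text \<open>This and the next identity turn sums over all generators into traces; they replace the
  computation of the Laplacian and of the squared gradient.\<close>

lemma sum_gen_gen:
  assumes X: "fits n X" and Y: "fits n Y"
  shows "(\<Sum>a<n - 1. \<Sum>b<n - 1. tr (gen n a b * X * gen n a b * Y))
    = 2 * tr (tp X * centre n * Y * centre n) - 2 * tr (centre n * X) * tr (centre n * Y)"
proof -
  let ?h = helmert and ?I = "{..<n - 1}"
  let ?x = "\<lambda>a b. bil n X (?h a) (?h b)" and ?y = "\<lambda>a b. bil n Y (?h a) (?h b)"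
  have "tr (gen n a b * X * gen n a b * Y)
      = ?x b a * ?y b a - ?x b b * ?y a a - ?x a a * ?y b b + ?x a b * ?y a b" for a b
  proof -
    have "outer n u v * (X * (outer n w z * Y)) = bil n X v w *\<^sub>R (outer n u z * Y)" for u v w z
      using outer_mult_mult[OF X, of u v w z] by (metis mult.assoc mult_scaleR_left)
    then show ?thesis
      by (simp add: gen_def left_diff_distrib right_diff_distrib mult.assoc tr_outer_mult[OF Y])
  qed
  then have "(\<Sum>a\<in>?I. \<Sum>b\<in>?I. tr (gen n a b * X * gen n a b * Y))
    = (\<Sum>a\<in>?I. \<Sum>b\<in>?I. ?x b a * ?y b a) - (\<Sum>a\<in>?I. \<Sum>b\<in>?I. ?x b b * ?y a a)
      - (\<Sum>a\<in>?I. \<Sum>b\<in>?I. ?x a a * ?y b b) + (\<Sum>a\<in>?I. \<Sum>b\<in>?I. ?x a b * ?y a b)"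
    by (simp add: sum.distrib sum_subtractf)
  also have "(\<Sum>a\<in>?I. \<Sum>b\<in>?I. ?x b a * ?y b a) = (\<Sum>a\<in>?I. \<Sum>b\<in>?I. ?x a b * ?y a b)"
    by (rule sum.swap)
  also have "(\<Sum>a\<in>?I. \<Sum>b\<in>?I. ?x b b * ?y a a) = (\<Sum>a\<in>?I. \<Sum>b\<in>?I. ?x a a * ?y b b)"
    by (rule sum.swap)
  also have "(\<Sum>a\<in>?I. \<Sum>b\<in>?I. ?x a a * ?y b b) = tr (centre n * X) * tr (centre n * Y)"
    unfolding bil_sum_diag[OF X, symmetric] bil_sum_diag[OF Y, symmetric] by (simp add: sum_product)
  finally show ?thesis
    unfolding bil_sum_right[OF X Y] by simp
qed

lemma sum_gen_prod:
  assumes X: "fits n X" and Y: "fits n Y"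
  shows "(\<Sum>a<n - 1. \<Sum>b<n - 1. tr (gen n a b * X) * tr (gen n a b * Y))
    = 2 * tr (tp X * centre n * Y * centre n) - 2 * tr (X * centre n * Y * centre n)"
proof -
  let ?h = helmert and ?I = "{..<n - 1}"
  let ?x = "\<lambda>a b. bil n X (?h a) (?h b)" and ?y = "\<lambda>a b. bil n Y (?h a) (?h b)"
  have "(\<Sum>a\<in>?I. \<Sum>b\<in>?I. tr (gen n a b * X) * tr (gen n a b * Y))
    = (\<Sum>a\<in>?I. \<Sum>b\<in>?I. ?x b a * ?y b a) - (\<Sum>a\<in>?I. \<Sum>b\<in>?I. ?x b a * ?y a b)
      - (\<Sum>a\<in>?I. \<Sum>b\<in>?I. ?x a b * ?y b a) + (\<Sum>a\<in>?I. \<Sum>b\<in>?I. ?x a b * ?y a b)"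
    by (simp add: tr_gen_mult X Y algebra_simps sum.distrib sum_subtractf)
  also have "(\<Sum>a\<in>?I. \<Sum>b\<in>?I. ?x b a * ?y b a) = (\<Sum>a\<in>?I. \<Sum>b\<in>?I. ?x a b * ?y a b)"
    by (rule sum.swap)
  also have "(\<Sum>a\<in>?I. \<Sum>b\<in>?I. ?x a b * ?y b a) = (\<Sum>a\<in>?I. \<Sum>b\<in>?I. ?x b a * ?y a b)"
    by (rule sum.swap)
  also have "(\<Sum>a\<in>?I. \<Sum>b\<in>?I. ?x b a * ?y a b) = tr (X * centre n * Y * centre n)"
    using bil_sum_right[of n "tp X" Y] X Y by (simp add: bil_tp)
  finally show ?thesis
    unfolding bil_sum_right[OF X Y] by simp
qed

section \<open>Rotations\<close>

text \<open>For distinct a, b < n - 1 this is the exponential of t times \<open>gen n a b\<close>,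
  written out: the square of the generator is minus the projection onto its plane.\<close>

definition rot :: "nat \<Rightarrow> nat \<Rightarrow> nat \<Rightarrow> real \<Rightarrow> fmat" where
  "rot n a b t = idm n
     + (cos t - 1) *\<^sub>R (outer n (helmert a) (helmert a) + outer n (helmert b) (helmert b))
     + sin t *\<^sub>R gen n a b"

text \<open>Column sums equal to 1 keep the common mean of the observations when they are mixed by
  \<open>R\<close>; commuting with \<open>centre n\<close> lets \<open>R\<close> pass through the
  centring of the data.\<close>

definition rotation :: "nat \<Rightarrow> fmat \<Rightarrow> bool" where
  "rotation n R \<longleftrightarrow> fits n R \<and> R * tp R = idm n \<and> tp R * R = idm n \<and> R * centre n = centre n * R
     \<and> (\<forall>c<n. (\<Sum>r<n. ent R r c) = 1)"

lemma fits_rot [simp]: "fits n (rot n a b t)"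
  by (simp add: rot_def fits_arith)

lemma tp_rot: "tp (rot n a b t) = rot n a b (- t)"
  by (simp add: rot_def gen_def algebra_simps)

lemma rot_zero [simp]: "rot n a b 0 = idm n"
  by (simp add: rot_def)

text \<open>The one-parameter group law. As transposition reverses t, it yields orthogonality, and
  it carries a derivative at t = 0 to every other t.\<close>

lemma rot_add:
  assumes ab: "a < n - 1" "b < n - 1" "a \<noteq> b"
  shows "rot n a b s * rot n a b t = rot n a b (s + t)"
proof -
  define E where "E = outer n (helmert a) (helmert a) + outer n (helmert b) (helmert b)"
  define G where "G = gen n a b"
  have d: "dotn n (helmert a) (helmert a) = 1" "dotn n (helmert b) (helmert b) = 1"
    "dotn n (helmert a) (helmert b) = 0" "dotn n (helmert b) (helmert a) = 0"
    using ab by (auto simp: dotn_helmert)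
  have EE: "E * E = E" "E * G = G" "G * E = G" "G * G = - E"
    unfolding E_def G_def gen_def by (simp_all add: algebra_simps outer_mult_outer d)
  have f: "fits n E" "fits n G"
    by (simp_all add: E_def G_def fits_arith)
  have "rot n a b s * rot n a b t = idm n + (((cos s - 1) * (cos t - 1) + (cos s - 1) + (cos t - 1)
      - sin s * sin t) *\<^sub>R E) + ((cos s - 1) * sin t + sin s * (cos t - 1) + sin s + sin t) *\<^sub>R G"
    unfolding rot_def E_def[symmetric] G_def[symmetric]
    by (simp add: distrib_left distrib_right EE f scaleR_left.add scaleR_left.diff
        scaleR_right.add algebra_simps)
  also have "\<dots> = rot n a b (s + t)"
    unfolding rot_def E_def[symmetric] G_def[symmetric] cos_add sin_add
    by (simp add: algebra_simps)
  finally show ?thesis .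
qed

lemma rotation_rot:
  assumes ab: "a < n - 1" "b < n - 1" "a \<noteq> b"
  shows "rotation n (rot n a b t)"
proof -
  have "rot n a b t * centre n = centre n * rot n a b t"
    using ab by (simp add: rot_def gen_def algebra_simps centre_mult_outer outer_mult_centre)
  moreover have "(\<Sum>r<n. ent (rot n a b t) r c) = 1" if "c < n" for c
  proof -
    have o: "(\<Sum>r<n. ent (outer n (helmert d) v) r c) = 0" if "d < n - 1" for d v
      using that \<open>c < n\<close> sum_helmert[of d n]
      by (simp add: outer_def ent_fcut sum_distrib_right[symmetric])
    have "(\<Sum>r<n. ent (idm n) r c) = 1"
      using \<open>c < n\<close> by (simp add: idm_def ent_fcut)
    then show ?thesis
      using o ab by (simp add: rot_def gen_def ent_ring ent_scaleR sum.distrib sum_subtractf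
          sum_distrib_left[symmetric])
  qed
  ultimately show ?thesis
    unfolding rotation_def by (simp add: tp_rot rot_add[OF ab])
qed

lemma rot_has_derivative:
  "(rot n a b has_vector_derivative gen n a b) (at 0)"
proof -
  have "((\<lambda>t. idm n
     + (cos t - 1) *\<^sub>R (outer n (helmert a) (helmert a) + outer n (helmert b) (helmert b))
     + sin t *\<^sub>R gen n a b) has_vector_derivative gen n a b) (at 0)"
    by (auto intro!: derivative_eq_intros)
  then show ?thesis unfolding rot_def[abs_def] .
qed

section \<open>Integration by parts on products of Grassmannians\<close>

text \<open>A point of the product of Grassmannians of the space of sum-zero vectors, with the ranks
  left free. The condition covers all indices, also those beyond k, so that no index range burdens
  the algebra.\<close>

definition valid :: "nat \<Rightarrow> (nat \<Rightarrow> fmat) \<Rightarrow> bool" where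
  "valid n p \<longleftrightarrow> (\<forall>i. proj (p i) \<and> fits n (p i) \<and> centre n * p i = p i)"

lemma validD:
  assumes "valid n p"
  shows "proj (p i)" "fits n (p i)" "tp (p i) = p i" "p i * p i = p i" "p i * (p i * X) = p i * X"
    "centre n * p i = p i" "p i * centre n = p i"
proof -
  show "proj (p i)" "fits n (p i)" and t: "tp (p i) = p i" and pp: "p i * p i = p i"
    and c: "centre n * p i = p i"
    using assms by (auto simp: valid_def proj_def)
  show "p i * (p i * X) = p i * X"
    using pp by (metis mult.assoc)
  show "p i * centre n = p i"
    using arg_cong[OF c, of tp] t by simp
qed

lemma fro2_valid_le:
  assumes "valid n p"
  shows "fro2 (p i) \<le> real n"
proof -
  have "fro2 (idm n) = real n"
    by (simp add: fro2_def)
  then show ?thesis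
    using fro2_proj_mult_le[OF validD(1)[OF assms], of i "idm n"] validD(2)[OF assms] by simp
qed

text \<open>Crude in n, but it serves only to make everything bounded, hence integrable, for fixed
  n.\<close>

lemma norm_valid_le:
  assumes "valid n p"
  shows "norm (p i) \<le> real n * real n + real n"
proof -
  have "\<bar>x\<bar> \<le> 1 + x\<^sup>2" for x :: real
    using zero_le_power2[of "\<bar>x\<bar> - 1"] abs_ge_zero[of x]
    unfolding power2_diff power2_abs one_power2 mult_1_right by linarith
  then have "norm (p i) \<le> (\<Sum>a<n. \<Sum>b<n. 1 + (ent (p i) a b)\<^sup>2)"
    unfolding norm_fmat_eq[OF validD(2)[OF assms]] by (intro sum_mono)
  also have "\<dots> = real n * real n + fro2 (p i)"
    by (simp add: sum.distrib fro2_eq[OF validD(2)[OF assms]])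
  finally show ?thesis
    using fro2_valid_le[OF assms, of i] by linarith
qed

text \<open>If the data \<open>Y\<close> of one block become \<open>Y * R\<close>, the projection
  \<open>P\<close> onto their row space becomes \<open>tp R * P * R\<close>; this is that action on
  block j alone.\<close>

definition act :: "nat \<Rightarrow> fmat \<Rightarrow> (nat \<Rightarrow> fmat) \<Rightarrow> nat \<Rightarrow> fmat" where
  "act j R p = p(j := tp R * p j * R)"

lemma valid_act:
  assumes "rotation n R" "valid n p"
  shows "valid n (act j R p)"
proof -
  have R: "fits n R" "R * tp R = idm n" "R * centre n = centre n * R"
    using assms by (auto simp: rotation_def)
  have tR: "centre n * tp R = tp R * centre n"
    using arg_cong[OF R(3), of tp] by simp
  have 1: "tp R * p j * R * (tp R * p j * R) = tp R * p j * R"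
  proof -
    have "tp R * p j * R * (tp R * p j * R) = tp R * (p j * (R * tp R) * p j) * R"
      by (simp add: mult.assoc)
    then show ?thesis
      using validD[OF assms(2)] by (simp add: R(2) mult.assoc)
  qed
  have 2: "centre n * (tp R * p j * R) = tp R * p j * R"
    using validD[OF assms(2)] tR by (metis mult.assoc)
  show ?thesis
    using 1 2 assms(2) R(1) unfolding valid_def act_def proj_def
    by (auto simp: fits_mult mult.assoc)
qed

lemma act_rot_add:
  assumes "a < n - 1" "b < n - 1" "a \<noteq> b"
  shows "act j (rot n a b t) (act j (rot n a b s) p) = act j (rot n a b (s + t)) p"
  using rot_add[OF assms, of s t, symmetric]
  by (simp add: act_def mult.assoc)

text \<open>\<open>D A p\<close> plays the role of the derivative at p, in block j, along the
  direction of the skew generator \<open>A\<close>.\<close>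

definition mgrad :: "nat \<Rightarrow> nat \<Rightarrow> ((nat \<Rightarrow> fmat) \<Rightarrow> fmat) \<Rightarrow> (fmat \<Rightarrow> (nat \<Rightarrow> fmat) \<Rightarrow> fmat) \<Rightarrow> bool" where
  "mgrad n j X D \<longleftrightarrow> (\<forall>p a b. valid n p \<longrightarrow> a < n - 1 \<longrightarrow> b < n - 1 \<longrightarrow> a \<noteq> b \<longrightarrow>
     ((\<lambda>t. X (act j (rot n a b t) p)) has_vector_derivative D (gen n a b) p) (at 0))"

text \<open>\<open>K\<close> plays the role of a gradient. The trace pairing with skew generators
  sees only the skew part of \<open>K\<close>; the gradients used below are chosen skew.\<close>

definition grad :: "nat \<Rightarrow> nat \<Rightarrow> ((nat \<Rightarrow> fmat) \<Rightarrow> real) \<Rightarrow> ((nat \<Rightarrow> fmat) \<Rightarrow> fmat) \<Rightarrow> bool" where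
  "grad n j g K \<longleftrightarrow> (\<forall>p a b. valid n p \<longrightarrow> a < n - 1 \<longrightarrow> b < n - 1 \<longrightarrow> a \<noteq> b \<longrightarrow>
     ((\<lambda>t. g (act j (rot n a b t) p)) has_real_derivative tr (gen n a b * K p)) (at 0))"

lemma act_rot_zero:
  assumes "valid n p"
  shows "act j (rot n a b 0) p = p"
  using validD(2)[OF assms] by (auto simp: act_def)

lemma mgrad_proj: "mgrad n j (\<lambda>p. p j) (\<lambda>A p. p j * A - A * p j)"
  unfolding mgrad_def
proof (intro allI impI)
  fix p a b assume p: "valid n p"
  have "((\<lambda>t. idm n
     + (cos (- t) - 1) *\<^sub>R (outer n (helmert a) (helmert a) + outer n (helmert b) (helmert b))
     + sin (- t) *\<^sub>R gen n a b) has_vector_derivative - gen n a b) (at 0)"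
    by (auto intro!: derivative_eq_intros)
  then have "((\<lambda>t. tp (rot n a b t)) has_vector_derivative - gen n a b) (at 0)"
    unfolding tp_rot by (simp add: rot_def)
  from has_vector_derivative_mult[OF has_vector_derivative_mult_left[OF this, of "p j"]
      rot_has_derivative[of n a b]]
  show "((\<lambda>t. act j (rot n a b t) p j) has_vector_derivative p j * gen n a b - gen n a b * p j) (at 0)"
    using validD(2)[OF p, of j] by (simp add: act_def fits_mult fits_arith)
qed

lemma mgrad_const: "(\<And>p Y. X (p(j := Y)) = X p) \<Longrightarrow> mgrad n j X (\<lambda>A p. 0)"
  unfolding mgrad_def act_def by simp

lemma mgrad_mult:
  assumes "mgrad n j X D" "mgrad n j Y E"
  shows "mgrad n j (\<lambda>p. X p * Y p) (\<lambda>A p. X p * E A p + D A p * Y p)"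
  unfolding mgrad_def
proof (intro allI impI)
  fix p a b assume p: "valid n p" and *: "a < n - 1" "b < n - 1" "a \<noteq> b"
  from has_vector_derivative_mult assms p *
  have "((\<lambda>t. X (act j (rot n a b t) p) * Y (act j (rot n a b t) p)) has_vector_derivative
      X (act j (rot n a b 0) p) * E (gen n a b) p + D (gen n a b) p * Y (act j (rot n a b 0) p)) (at 0)"
    unfolding mgrad_def by blast
  then show "((\<lambda>t. X (act j (rot n a b t) p) * Y (act j (rot n a b t) p)) has_vector_derivative
      X p * E (gen n a b) p + D (gen n a b) p * Y p) (at 0)"
    unfolding act_rot_zero[OF p] .
qed

lemma grad_tr:
  assumes "mgrad n j X D" "\<And>A p. valid n p \<Longrightarrow> fits n A \<Longrightarrow> tr (D A p) = tr (A * K p)"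
  shows "grad n j (\<lambda>p. tr (X p)) K"
  unfolding grad_def has_real_derivative_iff_has_vector_derivative
  using assms bounded_linear.has_vector_derivative[OF bounded_linear_tr]
  unfolding mgrad_def by (metis fits_gen)

lemma grad_compose:
  assumes "grad n j g K" "\<And>x. (h has_real_derivative h' x) (at x)"
  shows "grad n j (\<lambda>p. h (g p)) (\<lambda>p. h' (g p) *\<^sub>R K p)"
  unfolding grad_def
proof (intro allI impI)
  fix p a b assume p: "valid n p" and *: "a < n - 1" "b < n - 1" "a \<noteq> b"
  have "((\<lambda>t. h (g (act j (rot n a b t) p))) has_real_derivative
      h' (g (act j (rot n a b 0) p)) * tr (gen n a b * K p)) (at 0)"
    using assms p * unfolding grad_def by (intro DERIV_chain2[where g = "\<lambda>t. g (act j (rot n a b t) p)"]) auto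
  then show "((\<lambda>t. h (g (act j (rot n a b t) p))) has_real_derivative
      tr (gen n a b * h' (g p) *\<^sub>R K p)) (at 0)"
    unfolding act_rot_zero[OF p] by simp
qed

lemma grad_diff_const: "grad n j g K \<Longrightarrow> grad n j (\<lambda>p. g p - c) K"
  unfolding grad_def by (auto intro!: derivative_eq_intros)

text \<open>Rotation invariance of the joint law is expressed by measure preserving maps of the sample
  space.\<close>

locale rot_model = prob_space M for M :: "'a measure" +
  fixes n k :: nat and P :: "'a \<Rightarrow> nat \<Rightarrow> fmat"
  assumes n_pos: "1 \<le> n"
    and P_measurable: "\<And>i a b. (\<lambda>w. ent (P w i) a b) \<in> borel_measurable M"
    and P_valid: "\<And>w. w \<in> space M \<Longrightarrow> valid n (P w)"
    and P_rotate: "\<And>j R. j < k \<Longrightarrow> rotation n R \<Longrightarrow>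
      \<exists>\<rho> \<in> measurable M M. distr M M \<rho> = M \<and> (\<forall>w\<in>space M. P (\<rho> w) = act j R (P w))"
begin

text \<open>The bound is required on all valid points, not only on the range of \<open>P\<close>, so
  that it also holds along rotated points. Closure under algebraic operations then settles
  integrability once and for all.\<close>

definition tame_fun :: "((nat \<Rightarrow> fmat) \<Rightarrow> real) \<Rightarrow> bool" where
  "tame_fun f \<longleftrightarrow> (\<lambda>w. f (P w)) \<in> borel_measurable M \<and> (\<exists>C. \<forall>p. valid n p \<longrightarrow> \<bar>f p\<bar> \<le> C)"

definition tame_mat :: "((nat \<Rightarrow> fmat) \<Rightarrow> fmat) \<Rightarrow> bool" where
  "tame_mat X \<longleftrightarrow> (\<forall>a b. (\<lambda>w. ent (X (P w)) a b) \<in> borel_measurable M)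
     \<and> (\<forall>p. valid n p \<longrightarrow> fits n (X p)) \<and> (\<exists>C. \<forall>p. valid n p \<longrightarrow> norm (X p) \<le> C)"

section \<open>Closure properties of bounded measurable functions of the projections\<close>

lemma tame_funE: assumes "tame_fun f" obtains C where "(\<lambda>w. f (P w)) \<in> borel_measurable M"
  "\<And>p. valid n p \<Longrightarrow> \<bar>f p\<bar> \<le> C" "0 \<le> C"
proof -
  from assms obtain C where C: "(\<lambda>w. f (P w)) \<in> borel_measurable M"
    "\<And>p. valid n p \<Longrightarrow> \<bar>f p\<bar> \<le> C" unfolding tame_fun_def by auto
  have "\<bar>f p\<bar> \<le> \<bar>C\<bar>" if "valid n p" for p
    using C(2)[OF that] by linarith
  then show ?thesis using that[of "\<bar>C\<bar>"] C(1) by simp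
qed

lemma tame_matE: assumes "tame_mat X" obtains C where "\<And>a b. (\<lambda>w. ent (X (P w)) a b) \<in> borel_measurable M"
  "\<And>p. valid n p \<Longrightarrow> fits n (X p)" "\<And>p. valid n p \<Longrightarrow> norm (X p) \<le> C" "0 \<le> C"
proof -
  from assms obtain C where C: "\<And>a b. (\<lambda>w. ent (X (P w)) a b) \<in> borel_measurable M"
    "\<And>p. valid n p \<Longrightarrow> fits n (X p)" "\<And>p. valid n p \<Longrightarrow> norm (X p) \<le> C" unfolding tame_mat_def by auto
  have "norm (X p) \<le> \<bar>C\<bar>" if "valid n p" for p
    using C(3)[OF that] by linarith
  then show ?thesis using that[of "\<bar>C\<bar>"] C(1,2) by simp
qed

lemma tame_fun_measurable [measurable]: "tame_fun f \<Longrightarrow> (\<lambda>w. f (P w)) \<in> borel_measurable M"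
  by (simp add: tame_fun_def)

lemma tame_fun_integrable: "tame_fun f \<Longrightarrow> integrable M (\<lambda>w. f (P w))"
  by (erule tame_funE) (rule integrable_const_bound, auto intro: P_valid)

lemma tame_fun_const [simp]: "tame_fun (\<lambda>p. c)"
  unfolding tame_fun_def by auto

lemma tame_fun_add [simp]: assumes "tame_fun f" "tame_fun g" shows "tame_fun (\<lambda>p. f p + g p)"
proof -
  obtain C D where "(\<lambda>w. f (P w)) \<in> borel_measurable M" "(\<lambda>w. g (P w)) \<in> borel_measurable M"
    "\<And>p. valid n p \<Longrightarrow> \<bar>f p\<bar> \<le> C" "\<And>p. valid n p \<Longrightarrow> \<bar>g p\<bar> \<le> D"
    using assms by (metis tame_funE)
  then show ?thesis unfolding tame_fun_def
    by (intro conjI borel_measurable_add exI[of _ "C + D"] allI impI)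
      (auto intro!: order_trans[OF abs_triangle_ineq] add_mono)
qed

lemma tame_fun_mult [simp]: assumes "tame_fun f" "tame_fun g" shows "tame_fun (\<lambda>p. f p * g p)"
proof -
  obtain C D where "(\<lambda>w. f (P w)) \<in> borel_measurable M" "(\<lambda>w. g (P w)) \<in> borel_measurable M"
    "\<And>p. valid n p \<Longrightarrow> \<bar>f p\<bar> \<le> C" "\<And>p. valid n p \<Longrightarrow> \<bar>g p\<bar> \<le> D" "0 \<le> C"
    using assms by (metis tame_funE)
  then show ?thesis unfolding tame_fun_def
    by (intro conjI borel_measurable_times exI[of _ "C * D"] allI impI)
      (auto simp: abs_mult intro!: mult_mono)
qed

lemma tame_fun_uminus [simp]: "tame_fun f \<Longrightarrow> tame_fun (\<lambda>p. - f p)"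
  using tame_fun_mult[of "\<lambda>p. - 1" f] by simp

lemma tame_fun_diff [simp]: "tame_fun f \<Longrightarrow> tame_fun g \<Longrightarrow> tame_fun (\<lambda>p. f p - g p)"
  using tame_fun_add[of f "\<lambda>p. - g p"] by simp

lemma tame_fun_power [simp]: "tame_fun f \<Longrightarrow> tame_fun (\<lambda>p. f p ^ m)"
  by (induction m) auto

lemma tame_fun_sum [simp]: "(\<And>i. i \<in> I \<Longrightarrow> tame_fun (f i)) \<Longrightarrow> tame_fun (\<lambda>p. \<Sum>i\<in>I. f i p)"
  by (induction I rule: infinite_finite_induct) auto

lemma tame_fun_divide [simp]: "tame_fun f \<Longrightarrow> tame_fun (\<lambda>p. f p / c)"
  using tame_fun_mult[of f "\<lambda>p. 1 / c"] by simp

lemma tame_fun_compose: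
  assumes "tame_fun f" "continuous_on UNIV h"
  shows "tame_fun (\<lambda>p. h (f p))"
proof -
  obtain C where C: "(\<lambda>w. f (P w)) \<in> borel_measurable M" "\<And>p. valid n p \<Longrightarrow> \<bar>f p\<bar> \<le> C"
    using assms(1) by (metis tame_funE)
  have "compact (h ` {- C..C})"
    using assms(2) by (intro compact_continuous_image) (auto intro: continuous_on_subset)
  then obtain D where D: "\<And>x. x \<in> {- C..C} \<Longrightarrow> \<bar>h x\<bar> \<le> D"
    using compact_imp_bounded[of "h ` {- C..C}"] unfolding bounded_iff by (metis imageI real_norm_def)
  have "(\<lambda>w. h (f (P w))) \<in> borel_measurable M"
    using borel_measurable_continuous_onI[OF assms(2)] C(1) by (rule measurable_compose_rev)
  moreover have "\<bar>h (f p)\<bar> \<le> D" if "valid n p" for p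
    using C(2)[OF that] by (intro D) auto
  ultimately show ?thesis unfolding tame_fun_def by blast
qed

lemma tame_mat_proj [simp]: "tame_mat (\<lambda>p. p i)"
  unfolding tame_mat_def using P_measurable validD(2) norm_valid_le by blast

lemma tame_mat_const [simp]: "fits n A \<Longrightarrow> tame_mat (\<lambda>p. A)"
  unfolding tame_mat_def by auto

lemma tame_mat_zero [simp]: "tame_mat (\<lambda>p. 0)"
  by (rule tame_mat_const) (simp add: fits_arith)

lemma tame_mat_add [simp]: assumes "tame_mat X" "tame_mat Y" shows "tame_mat (\<lambda>p. X p + Y p)"
proof -
  obtain C D where *: "\<And>a b. (\<lambda>w. ent (X (P w)) a b) \<in> borel_measurable M"
    "\<And>a b. (\<lambda>w. ent (Y (P w)) a b) \<in> borel_measurable M"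
    "\<And>p. valid n p \<Longrightarrow> fits n (X p)" "\<And>p. valid n p \<Longrightarrow> fits n (Y p)"
    "\<And>p. valid n p \<Longrightarrow> norm (X p) \<le> C" "\<And>p. valid n p \<Longrightarrow> norm (Y p) \<le> D"
    using tame_matE[OF assms(1)] tame_matE[OF assms(2)] by metis
  have "norm (X p + Y p) \<le> C + D" if "valid n p" for p
    using *(5,6)[OF that] norm_triangle_ineq[of "X p" "Y p"] by linarith
  then show ?thesis unfolding tame_mat_def ent_ring using * by (auto simp: fits_arith)
qed

lemma tame_mat_scaleR [simp]: assumes "tame_fun f" "tame_mat X" shows "tame_mat (\<lambda>p. f p *\<^sub>R X p)"
proof -
  obtain C D where *: "\<And>a b. (\<lambda>w. ent (X (P w)) a b) \<in> borel_measurable M"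
    "(\<lambda>w. f (P w)) \<in> borel_measurable M"
    "\<And>p. valid n p \<Longrightarrow> fits n (X p)"
    "\<And>p. valid n p \<Longrightarrow> norm (X p) \<le> C" "\<And>p. valid n p \<Longrightarrow> \<bar>f p\<bar> \<le> D" "0 \<le> D"
    using tame_funE[OF assms(1)] tame_matE[OF assms(2)] by metis
  have "norm (f p *\<^sub>R X p) \<le> D * C" if "valid n p" for p
    using *(4,5)[OF that] *(6) by (auto intro!: mult_mono)
  then show ?thesis unfolding tame_mat_def ent_scaleR using * by (auto simp: fits_arith)
qed

lemma tame_mat_uminus [simp]: "tame_mat X \<Longrightarrow> tame_mat (\<lambda>p. - X p)"
  using tame_mat_scaleR[of "\<lambda>p. - 1" X] by simp

lemma tame_mat_diff [simp]: "tame_mat X \<Longrightarrow> tame_mat Y \<Longrightarrow> tame_mat (\<lambda>p. X p - Y p)"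
  using tame_mat_add[of X "\<lambda>p. - Y p"] by simp

lemma tame_mat_sum [simp]: "(\<And>i. i \<in> I \<Longrightarrow> tame_mat (f i)) \<Longrightarrow> tame_mat (\<lambda>p. \<Sum>i\<in>I. f i p)"
  by (induction I rule: infinite_finite_induct) auto

lemma tame_mat_mult [simp]: assumes "tame_mat X" "tame_mat Y" shows "tame_mat (\<lambda>p. X p * Y p)"
proof -
  obtain C D where *: "\<And>a b. (\<lambda>w. ent (X (P w)) a b) \<in> borel_measurable M"
    "\<And>a b. (\<lambda>w. ent (Y (P w)) a b) \<in> borel_measurable M"
    "\<And>p. valid n p \<Longrightarrow> fits n (X p)" "\<And>p. valid n p \<Longrightarrow> fits n (Y p)"
    "\<And>p. valid n p \<Longrightarrow> norm (X p) \<le> C" "\<And>p. valid n p \<Longrightarrow> norm (Y p) \<le> D" "0 \<le> C"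
    using tame_matE[OF assms(1)] tame_matE[OF assms(2)] by metis
  have "norm (X p * Y p) \<le> C * D" if "valid n p" for p
    using *(5,6)[OF that] *(7) norm_mult_ineq[of "X p" "Y p"]
    by (meson mult_mono norm_ge_zero order_trans)
  moreover have "(\<lambda>w. ent (X (P w) * Y (P w)) a b) \<in> borel_measurable M" for a b
  proof -
    have "(\<lambda>w. \<Sum>c<n. ent (X (P w)) a c * ent (Y (P w)) c b) \<in> borel_measurable M"
      using * by (intro borel_measurable_sum borel_measurable_times)
    then show ?thesis
      by (rule measurable_cong[THEN iffD1, rotated]) (simp add: ent_mult_left[OF *(3)[OF P_valid]])
  qed
  ultimately show ?thesis unfolding tame_mat_def using * by (auto simp: fits_mult)
qed

lemma tame_fun_tr [simp]: assumes "tame_mat X" shows "tame_fun (\<lambda>p. tr (X p))"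
proof -
  obtain C where *: "\<And>a b. (\<lambda>w. ent (X (P w)) a b) \<in> borel_measurable M"
    "\<And>p. valid n p \<Longrightarrow> fits n (X p)" "\<And>p. valid n p \<Longrightarrow> norm (X p) \<le> C"
    using tame_matE[OF assms] by metis
  have "(\<lambda>w. \<Sum>c<n. ent (X (P w)) c c) \<in> borel_measurable M"
    using * by (intro borel_measurable_sum)
  then have "(\<lambda>w. tr (X (P w))) \<in> borel_measurable M"
    by (rule measurable_cong[THEN iffD1, rotated]) (simp add: tr_eq[OF *(2)[OF P_valid]])
  then show ?thesis
    unfolding tame_fun_def using *(3) order_trans[OF abs_tr_le_norm] by blast
qed

text \<open>By invariance the integral of \<open>F\<close> along the rotation curve does not depend
  on t. The difference quotients are bounded by the mean value theorem, so dominated convergence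
  moves the derivative inside.\<close>

lemma integral_by_parts:
  assumes j: "j < k" and ab: "a < n - 1" "b < n - 1" "a \<noteq> b"
    and F: "tame_fun F" and F': "tame_fun F'"
    and deriv: "\<And>p. valid n p \<Longrightarrow>
      ((\<lambda>t. F (act j (rot n a b t) p)) has_real_derivative F' p) (at 0)"
  shows "(\<integral>w. F' (P w) \<partial>M) = 0"
proof -
  obtain C where C: "\<And>p. valid n p \<Longrightarrow> \<bar>F' p\<bar> \<le> C" "0 \<le> C"
    using F' by (metis tame_funE)
  let ?f = "\<lambda>p t. F (act j (rot n a b t) p)"
  have deriv_t: "(?f p has_real_derivative F' (act j (rot n a b t) p)) (at t)" if "valid n p" for p t
  proof -
    have "((\<lambda>s. F (act j (rot n a b s) (act j (rot n a b t) p)))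
        has_real_derivative F' (act j (rot n a b t) p)) (at (t + - t))"
      using deriv[OF valid_act[OF rotation_rot[OF ab] that]] by simp
    then have "((\<lambda>s. F (act j (rot n a b (s + - t)) (act j (rot n a b t) p)))
        has_real_derivative F' (act j (rot n a b t) p)) (at t)"
      unfolding DERIV_shift[of _ _ t "- t"] .
    then show ?thesis by (simp add: act_rot_add[OF ab])
  qed
  have lip: "\<bar>?f p t - F p\<bar> \<le> C * \<bar>t\<bar>" if p: "valid n p" for p t
  proof -
    have "norm (?f p t - ?f p 0) \<le> C * norm (t - 0)"
      by (rule field_differentiable_bound[of UNIV "?f p" "\<lambda>t. F' (act j (rot n a b t) p)"])
        (auto intro: deriv_t[OF p] C valid_act[OF rotation_rot[OF ab] p])
    then show ?thesis using act_rot_zero[OF p] by simp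
  qed
  have meas: "(\<lambda>w. ?f (P w) t) \<in> borel_measurable M"
    and int: "(\<integral>w. ?f (P w) t \<partial>M) = (\<integral>w. F (P w) \<partial>M)" for t
  proof -
    obtain \<rho> where \<rho>: "\<rho> \<in> measurable M M" "distr M M \<rho> = M"
      "\<And>w. w \<in> space M \<Longrightarrow> P (\<rho> w) = act j (rot n a b t) (P w)"
      using P_rotate[OF j rotation_rot[OF ab]] by metis
    have "(\<lambda>w. F (P (\<rho> w))) \<in> borel_measurable M"
      using \<rho>(1) tame_fun_measurable[OF F] by (rule measurable_compose)
    then show "(\<lambda>w. ?f (P w) t) \<in> borel_measurable M"
      by (rule measurable_cong[THEN iffD1, rotated]) (simp add: \<rho>(3))
    have "(\<integral>w. F (P w) \<partial>M) = (\<integral>w. F (P (\<rho> w)) \<partial>M)"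
      using integral_distr[OF \<rho>(1) tame_fun_measurable[OF F]] \<rho>(2) by simp
    also have "\<dots> = (\<integral>w. ?f (P w) t \<partial>M)"
      by (rule Bochner_Integration.integral_cong) (simp_all add: \<rho>(3))
    finally show "(\<integral>w. ?f (P w) t \<partial>M) = (\<integral>w. F (P w) \<partial>M)" by simp
  qed
  have intf: "integrable M (\<lambda>w. ?f (P w) t)" for t
  proof -
    obtain B where B: "\<And>p. valid n p \<Longrightarrow> \<bar>F p\<bar> \<le> B" using F by (metis tame_funE)
    show ?thesis
      by (rule integrable_const_bound[of _ B])
        (auto intro!: AE_I2 B valid_act[OF rotation_rot[OF ab]] P_valid meas)
  qed
  define h :: "nat \<Rightarrow> real" where "h = (\<lambda>m. 1 / real (Suc m))"
  have h: "h m > 0" "h \<longlonglongrightarrow> 0" for m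
    unfolding h_def using LIMSEQ_inverse_real_of_nat by (auto simp: inverse_eq_divide)
  have "(\<lambda>m. \<integral>w. (?f (P w) (h m) - F (P w)) / h m \<partial>M) \<longlonglongrightarrow> (\<integral>w. F' (P w) \<partial>M)"
  proof (rule integral_dominated_convergence)
    show "AE w in M. (\<lambda>m. (?f (P w) (h m) - F (P w)) / h m) \<longlonglongrightarrow> F' (P w)"
    proof (rule AE_I2)
      fix w assume w: "w \<in> space M"
      have "((\<lambda>t. (?f (P w) (0 + t) - ?f (P w) 0) / t) \<longlongrightarrow> F' (P w)) (at 0)"
        using deriv[OF P_valid[OF w]] unfolding DERIV_def .
      moreover have "filterlim h (at 0) sequentially"
        using h by (simp add: filterlim_at less_imp_neq[symmetric])
      ultimately show "(\<lambda>m. (?f (P w) (h m) - F (P w)) / h m) \<longlonglongrightarrow> F' (P w)"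
        unfolding act_rot_zero[OF P_valid[OF w]] by (auto dest: filterlim_compose)
    qed
    show "AE w in M. norm ((?f (P w) (h m) - F (P w)) / h m) \<le> C" for m
      using lip[OF P_valid, of _ "h m"] h(1)[of m] by (intro AE_I2) (simp add: divide_le_eq)
  qed (use meas tame_fun_measurable[OF F] tame_fun_measurable[OF F'] in auto)
  moreover have "(\<integral>w. (?f (P w) (h m) - F (P w)) / h m \<partial>M) = 0" for m
    using intf tame_fun_integrable[OF F] int by (simp add: Bochner_Integration.integral_diff)
  ultimately have "(\<lambda>m. 0) \<longlonglongrightarrow> (\<integral>w. F' (P w) \<partial>M)"
    by (simp only:)
  then show ?thesis
    by (simp add: LIMSEQ_const_iff)
qed

text \<open>Integration by parts for g times the field with components tr(A X), summed over all
  generators A; \<open>S\<close> is the divergence of the field. In the gradient term the two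
  orderings of a and b give a factor 2, and skewness of \<open>K\<close> doubles it to -4 tr(K
  X).\<close>

lemma master:
  assumes j: "j < k" and g: "tame_fun g" and K: "tame_mat K" and gK: "grad n j g K"
    and X: "tame_mat X" and XD: "mgrad n j X D" and D: "\<And>A. fits n A \<Longrightarrow> tame_mat (D A)"
    and skew: "\<And>p. valid n p \<Longrightarrow> tp (K p) = - K p"
      "\<And>p. valid n p \<Longrightarrow> centre n * K p = K p"
    and S: "\<And>p. valid n p \<Longrightarrow> (\<Sum>a<n - 1. \<Sum>b<n - 1. tr (gen n a b * D (gen n a b) p)) = S p"
  shows "(\<integral>w. g (P w) * S (P w) \<partial>M) = 4 * (\<integral>w. tr (K (P w) * X (P w)) \<partial>M)"
proof -
  define F' where "F' a b p = tr (gen n a b * K p) * tr (gen n a b * X p)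
      + g p * tr (gen n a b * D (gen n a b) p)" for a b p
  have nF': "tame_fun (F' a b)" for a b
    unfolding F'_def[abs_def] by (simp add: K X D g)
  have zero: "(\<integral>w. F' a b (P w) \<partial>M) = 0" if ab: "a < n - 1" "b < n - 1" for a b
  proof (cases "a = b")
    case True
    then have "F' a b p = 0" for p by (simp add: F'_def gen_def)
    then show ?thesis by simp
  next
    case False
    have "((\<lambda>t. g (act j (rot n a b t) p) * tr (gen n a b * X (act j (rot n a b t) p)))
        has_real_derivative F' a b p) (at 0)" if p: "valid n p" for p
    proof -
      have "((\<lambda>t. tr (gen n a b * X (act j (rot n a b t) p)))
          has_real_derivative tr (gen n a b * D (gen n a b) p)) (at 0)"
        unfolding has_real_derivative_iff_has_vector_derivative
        using XD p ab False unfolding mgrad_def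
        by (intro bounded_linear.has_vector_derivative[OF bounded_linear_tr]
            has_vector_derivative_mult_right) blast
      moreover have "((\<lambda>t. g (act j (rot n a b t) p)) has_real_derivative tr (gen n a b * K p)) (at 0)"
        using gK p ab False unfolding grad_def by blast
      ultimately show ?thesis
        unfolding F'_def using act_rot_zero[OF p]
        by (auto intro!: derivative_eq_intros simp: mult.commute)
    qed
    then show ?thesis
      by (intro integral_by_parts[OF j ab False, of "\<lambda>p. g p * tr (gen n a b * X p)"] nF')
        (simp_all add: g X)
  qed
  have sumF': "(\<Sum>a<n - 1. \<Sum>b<n - 1. F' a b p) = g p * S p - 4 * tr (K p * X p)"
    if p: "valid n p" for p
  proof -
    have f: "fits n (K p)" "fits n (X p)" using K X p by (auto simp: tame_mat_def)
    have KH: "K p * centre n = K p"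
      using arg_cong[OF skew(2)[OF p], of tp] skew(1)[OF p] by simp
    have "tr (K p * centre n * X p * centre n) = tr (K p * X p)"
      using tr_commute[of "K p * X p" "centre n"] KH skew(2)[OF p]
      by (metis mult.assoc)
    moreover have "tp (K p) * centre n * X p * centre n = - (K p * centre n * X p * centre n)"
      by (simp add: skew(1)[OF p])
    ultimately have "(\<Sum>a<n - 1. \<Sum>b<n - 1. tr (gen n a b * K p) * tr (gen n a b * X p))
        = - 4 * tr (K p * X p)"
      unfolding sum_gen_prod[OF f] by simp
    then show ?thesis
      unfolding F'_def sum.distrib S[OF p, symmetric] by (simp add: sum_distrib_left)
  qed
  have "0 = (\<Sum>a<n - 1. \<Sum>b<n - 1. \<integral>w. F' a b (P w) \<partial>M)"
    using zero by simp
  also have "\<dots> = (\<integral>w. (\<Sum>a<n - 1. \<Sum>b<n - 1. F' a b (P w)) \<partial>M)"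
    using tame_fun_integrable[OF nF'] by (simp add: Bochner_Integration.integral_sum)
  also have "\<dots> = (\<integral>w. g (P w) * S (P w) - 4 * tr (K (P w) * X (P w)) \<partial>M)"
    by (rule Bochner_Integration.integral_cong) (simp_all add: sumF' P_valid del: One_nat_def)
  also have "\<dots> = (\<integral>w. g (P w) * S (P w) \<partial>M) - 4 * (\<integral>w. tr (K (P w) * X (P w)) \<partial>M)"
  proof (subst Bochner_Integration.integral_diff)
    have t: "tame_fun (\<lambda>p. tr (K p * X p))" using K X by simp
    then show i4: "integrable M (\<lambda>w. 4 * tr (K (P w) * X (P w)))"
      using tame_fun_integrable[OF t] by simp
    have "integrable M (\<lambda>w. (\<Sum>a<n - 1. \<Sum>b<n - 1. F' a b (P w)) + 4 * tr (K (P w) * X (P w)))"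
      using tame_fun_integrable[OF nF'] i4 by auto
    then show "integrable M (\<lambda>w. g (P w) * S (P w))"
      by (rule Bochner_Integration.integrable_cong[THEN iffD1, rotated 2]) (simp_all add: sumF' P_valid del: One_nat_def)
  qed simp
  finally show ?thesis by simp
qed

end

section \<open>Linear and quadratic trace functions\<close>

lemma tr_rotate: "tr (A * (B * C)) = tr (B * (C * A))" "tr (A * (B * C)) = tr (C * (A * B))"
  using tr_commute[of A "B * C"] tr_commute[of "A * B" C] by (simp_all add: mult.assoc)

context rot_model
begin

abbreviation N :: real where "N \<equiv> real n - 1"

lemma tr_centre_n: "tr (centre n) = N"
  using n_pos by (rule tr_centre)

text \<open>The requirements on a matrix \<open>Q\<close> that stays fixed while block j is
  rotated.\<close>

definition indep_block :: "nat \<Rightarrow> ((nat \<Rightarrow> fmat) \<Rightarrow> fmat) \<Rightarrow> bool" where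
  "indep_block j Q \<longleftrightarrow> tame_mat Q \<and> (\<forall>p Y. Q (p(j := Y)) = Q p)
     \<and> (\<forall>p. valid n p \<longrightarrow> tp (Q p) = Q p \<and> centre n * Q p = Q p)"

lemma indep_blockD:
  assumes "indep_block j Q"
  shows "tame_mat Q" "Q (p(j := Y)) = Q p"
    "valid n p \<Longrightarrow> tp (Q p) = Q p" "valid n p \<Longrightarrow> centre n * Q p = Q p"
    "valid n p \<Longrightarrow> Q p * centre n = Q p" "valid n p \<Longrightarrow> fits n (Q p)"
proof -
  show "tame_mat Q" "Q (p(j := Y)) = Q p" and 1: "valid n p \<Longrightarrow> tp (Q p) = Q p"
    and 2: "valid n p \<Longrightarrow> centre n * Q p = Q p"
    using assms by (auto simp: indep_block_def)
  show "valid n p \<Longrightarrow> Q p * centre n = Q p"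
    using arg_cong[OF 2, of tp] 1 by simp
  show "valid n p \<Longrightarrow> fits n (Q p)"
    using assms by (auto simp: indep_block_def tame_mat_def)
qed

lemma mgrad_indep_mult:
  assumes "indep_block j Q"
  shows "mgrad n j (\<lambda>p. Q p * p j) (\<lambda>A p. Q p * (p j * A - A * p j))"
  using mgrad_mult[OF mgrad_const[of Q] mgrad_proj] indep_blockD(2)[OF assms] by simp

lemma grad_linear:
  assumes "indep_block j Q"
  shows "grad n j (\<lambda>p. tr (Q p * p j)) (\<lambda>p. Q p * p j - p j * Q p)"
proof (rule grad_tr[OF mgrad_indep_mult[OF assms]])
  fix A p
  show "tr (Q p * (p j * A - A * p j)) = tr (A * (Q p * p j - p j * Q p))"
    using tr_rotate(2)[of "Q p" "p j" A] tr_rotate(1)[of "Q p" A "p j"]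
    by (simp add: right_diff_distrib)
qed

lemma grad_quadratic:
  assumes "indep_block j Q"
  shows "grad n j (\<lambda>p. tr (Q p * p j * (Q p * p j)))
    (\<lambda>p. 2 *\<^sub>R (Q p * p j * (Q p * p j) - p j * Q p * (p j * Q p)))"
proof (rule grad_tr[OF mgrad_mult[OF mgrad_indep_mult[OF assms] mgrad_indep_mult[OF assms]]])
  fix A p
  let ?Q = "Q p" and ?P = "p j"
  have "tr (?Q * (?P * (?Q * (?P * A)))) = tr (A * (?Q * (?P * (?Q * ?P))))"
    "tr (?Q * (?P * (?Q * (A * ?P)))) = tr (A * (?P * (?Q * (?P * ?Q))))"
    "tr (?Q * (?P * (A * (?Q * ?P)))) = tr (A * (?Q * (?P * (?Q * ?P))))"
    "tr (?Q * (A * (?P * (?Q * ?P)))) = tr (A * (?P * (?Q * (?P * ?Q))))"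
    using tr_commute[of "?Q * (?P * (?Q * ?P))" A] tr_commute[of "?Q * (?P * ?Q)" "A * ?P"]
      tr_commute[of "?Q * ?P" "A * (?Q * ?P)"] tr_commute[of "?Q" "A * (?P * (?Q * ?P))"]
    by (simp_all add: mult.assoc)
  then show "tr (?Q * ?P * (?Q * (?P * A - A * ?P)) + ?Q * (?P * A - A * ?P) * (?Q * ?P))
      = tr (A * 2 *\<^sub>R (?Q * ?P * (?Q * ?P) - ?P * ?Q * (?P * ?Q)))"
    by (simp add: right_diff_distrib left_diff_distrib mult.assoc)
qed

lemma skew_linear:
  assumes "indep_block j Q" "valid n p"
  shows "tp (Q p * p j - p j * Q p) = - (Q p * p j - p j * Q p)"
    "centre n * (Q p * p j - p j * Q p) = Q p * p j - p j * Q p"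
  using indep_blockD(3-5)[OF assms(1,2)] validD[OF assms(2), of j]
  by (simp_all add: right_diff_distrib mult.assoc[symmetric])

lemma skew_quadratic:
  assumes "indep_block j Q" "valid n p"
  shows "tp (2 *\<^sub>R (Q p * p j * (Q p * p j) - p j * Q p * (p j * Q p)))
      = - (2 *\<^sub>R (Q p * p j * (Q p * p j) - p j * Q p * (p j * Q p)))"
    "centre n * (2 *\<^sub>R (Q p * p j * (Q p * p j) - p j * Q p * (p j * Q p)))
      = 2 *\<^sub>R (Q p * p j * (Q p * p j) - p j * Q p * (p j * Q p))"
  using indep_blockD(3-5)[OF assms(1,2)] validD[OF assms(2), of j]
  by (simp_all add: right_diff_distrib mult.assoc[symmetric] scaleR_right_diff_distrib)

text \<open>The field is tr(A Q P_j), for skew A half the derivative of tr(Q P_j). Its divergence is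
  -2 times the combination in parentheses, which is the eigenfunction property; a constant g shows
  that this combination has mean 0.\<close>

lemma linear_identity:
  assumes j: "j < k" and Q: "indep_block j Q"
    and g: "tame_fun g" and K: "tame_mat K" and gK: "grad n j g K"
    and skew: "\<And>p. valid n p \<Longrightarrow> tp (K p) = - K p" "\<And>p. valid n p \<Longrightarrow> centre n * K p = K p"
  shows "(\<integral>w. g (P w) * (N * tr (Q (P w) * P w j) - tr (Q (P w)) * tr (P w j)) \<partial>M)
    = - 2 * (\<integral>w. tr (K (P w) * (Q (P w) * P w j)) \<partial>M)"
proof -
  define S where "S p = - 2 * (N * tr (Q p * p j) - tr (Q p) * tr (p j))" for p
  have S: "(\<Sum>a<n - 1. \<Sum>b<n - 1. tr (gen n a b * (Q p * (p j * gen n a b - gen n a b * p j)))) = S p"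
    if p: "valid n p" for p
  proof -
    note q = indep_blockD(3-6)[OF Q p] and v = validD[OF p, of j]
    have f: "fits n (Q p * p j)" using q v by (simp add: fits_mult)
    \<comment> \<open>The factor \<open>idm n\<close> brings the first term into the shape of
      \<open>sum_gen_gen\<close>.\<close>
    have "tr (gen n a b * (Q p * (p j * gen n a b - gen n a b * p j)))
      = tr (gen n a b * (Q p * p j) * gen n a b * idm n) - tr (gen n a b * Q p * gen n a b * p j)" for a b
      using q v by (simp add: right_diff_distrib mult.assoc)
    then have "(\<Sum>a<n - 1. \<Sum>b<n - 1. tr (gen n a b * (Q p * (p j * gen n a b - gen n a b * p j))))
      = (2 * tr (tp (Q p * p j) * centre n * idm n * centre n)
          - 2 * tr (centre n * (Q p * p j)) * tr (centre n * idm n))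
        - (2 * tr (tp (Q p) * centre n * p j * centre n) - 2 * tr (centre n * Q p) * tr (centre n * p j))"
      by (simp only: sum_subtractf sum_gen_gen[OF f fits_basic(2)] sum_gen_gen[OF q(4) v(2)])
    also have "centre n * (Q p * p j) = Q p * p j"
      using q(2) by (simp add: mult.assoc[symmetric])
    also have "tp (Q p * p j) * centre n * idm n * centre n = p j * Q p"
      using q v by (simp add: mult.assoc)
    also have "tp (Q p) * centre n * p j * centre n = Q p * p j"
      using q v by (simp add: mult.assoc)
    finally show ?thesis
      using q v tr_commute[of "p j" "Q p"] tr_centre_n by (simp add: S_def algebra_simps)
  qed
  have "(\<integral>w. g (P w) * S (P w) \<partial>M) = 4 * (\<integral>w. tr (K (P w) * (Q (P w) * P w j)) \<partial>M)"
    by (rule master[OF j g K gK _ mgrad_indep_mult[OF Q] _ skew S])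
      (simp_all add: indep_blockD(1)[OF Q])
  moreover have "(\<integral>w. g (P w) * S (P w) \<partial>M)
      = - 2 * (\<integral>w. g (P w) * (N * tr (Q (P w) * P w j) - tr (Q (P w)) * tr (P w j)) \<partial>M)"
    unfolding S_def Bochner_Integration.integral_mult_right_zero[symmetric]
    by (rule Bochner_Integration.integral_cong[OF refl]) (rule mult.left_commute)
  ultimately show ?thesis by simp
qed

text \<open>tr(Q P Q P) is no eigenfunction, but besides n times itself its divergence contains only
  products of traces at most linear in P. Concentration of the quadratic trace is thereby reduced to
  that of linear ones. The factor is n = N + 1 because the commutator terms add one more
  copy.\<close>

lemma quadratic_identity:
  assumes j: "j < k" and Q: "indep_block j Q"
    and g: "tame_fun g" and K: "tame_mat K" and gK: "grad n j g K"
    and skew: "\<And>p. valid n p \<Longrightarrow> tp (K p) = - K p" "\<And>p. valid n p \<Longrightarrow> centre n * K p = K p"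
  shows "(\<integral>w. g (P w) * (real n * tr (Q (P w) * P w j * (Q (P w) * P w j))
      - ((tr (P w j) + 1) * tr (Q (P w) * Q (P w) * P w j) - (tr (Q (P w) * P w j))\<^sup>2
          + tr (Q (P w)) * tr (Q (P w) * P w j))) \<partial>M)
    = - 2 * (\<integral>w. tr (K (P w) * (Q (P w) * P w j * (Q (P w) * P w j))) \<partial>M)"
proof -
  define S where "S p = - 2 * (real n * tr (Q p * p j * (Q p * p j))
      - ((tr (p j) + 1) * tr (Q p * Q p * p j) - (tr (Q p * p j))\<^sup>2 + tr (Q p) * tr (Q p * p j)))" for p
  let ?D = "\<lambda>A p. Q p * p j * (Q p * (p j * A - A * p j)) + Q p * (p j * A - A * p j) * (Q p * p j)"
  have S: "(\<Sum>a<n - 1. \<Sum>b<n - 1. tr (gen n a b * ?D (gen n a b) p)) = S p"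
    if p: "valid n p" for p
  proof -
    note q = indep_blockD(3-6)[OF Q p] and v = validD[OF p, of j]
    have qq: "Q p * (centre n * X) = Q p * X" "centre n * (Q p * X) = Q p * X"
      "p j * (centre n * X) = p j * X" "centre n * (p j * X) = p j * X" for X
      using q v by (simp_all add: mult.assoc[symmetric])
    have f: "fits n (Q p * p j)" "fits n (Q p * (p j * (Q p * p j)))"
      "fits n (Q p * (p j * Q p))" "fits n (p j * (Q p * p j))"
      using q v by (simp_all add: fits_mult)
    have "tr (gen n a b * ?D (gen n a b) p)
      = tr (gen n a b * (Q p * (p j * (Q p * p j))) * gen n a b * idm n)
        - tr (gen n a b * (Q p * (p j * Q p)) * gen n a b * p j)
        + tr (gen n a b * (Q p * p j) * gen n a b * (Q p * p j))
        - tr (gen n a b * Q p * gen n a b * (p j * (Q p * p j)))" for a b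
      using q v by (simp add: right_diff_distrib left_diff_distrib distrib_left mult.assoc)
    then have "(\<Sum>a<n - 1. \<Sum>b<n - 1. tr (gen n a b * ?D (gen n a b) p))
      = (2 * tr (tp (Q p * (p j * (Q p * p j))) * centre n * idm n * centre n)
          - 2 * tr (centre n * (Q p * (p j * (Q p * p j)))) * tr (centre n * idm n))
        - (2 * tr (tp (Q p * (p j * Q p)) * centre n * p j * centre n)
            - 2 * tr (centre n * (Q p * (p j * Q p))) * tr (centre n * p j))
        + (2 * tr (tp (Q p * p j) * centre n * (Q p * p j) * centre n)
            - 2 * tr (centre n * (Q p * p j)) * tr (centre n * (Q p * p j)))
        - (2 * tr (tp (Q p) * centre n * (p j * (Q p * p j)) * centre n)
            - 2 * tr (centre n * Q p) * tr (centre n * (p j * (Q p * p j))))"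
      by (simp only: sum_subtractf sum.distrib sum_gen_gen[OF f(2) fits_basic(2)]
          sum_gen_gen[OF f(3) v(2)] sum_gen_gen[OF f(1) f(1)] sum_gen_gen[OF q(4) f(4)])
    also have "\<dots> = (2 * tr (p j * (Q p * (p j * Q p))) - 2 * tr (Q p * (p j * (Q p * p j))) * N)
        - (2 * tr (Q p * (p j * (Q p * p j))) - 2 * tr (Q p * (p j * Q p)) * tr (p j))
        + (2 * tr (p j * (Q p * (Q p * p j))) - 2 * tr (Q p * p j) * tr (Q p * p j))
        - (2 * tr (Q p * (p j * (Q p * p j))) - 2 * tr (Q p) * tr (p j * (Q p * p j)))"
      using q v by (simp add: mult.assoc qq tr_centre_n)
    also have "tr (p j * (Q p * (p j * Q p))) = tr (Q p * (p j * (Q p * p j)))"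
      using tr_commute[of "p j" "Q p * (p j * Q p)"] by (simp add: mult.assoc)
    also have "tr (Q p * (p j * Q p)) = tr (Q p * (Q p * p j))"
      by (rule tr_rotate(2))
    also have "tr (p j * (Q p * (Q p * p j))) = tr (Q p * (Q p * p j))"
      using tr_commute[of "p j" "Q p * (Q p * p j)"] v by (simp add: mult.assoc)
    also have "tr (p j * (Q p * p j)) = tr (Q p * p j)"
      using tr_commute[of "p j" "Q p * p j"] v by (simp add: mult.assoc)
    finally show ?thesis
      unfolding S_def by (simp add: mult.assoc power2_eq_square) (simp add: algebra_simps)
  qed
  have nQ: "tame_mat Q" by (rule indep_blockD(1)[OF Q])
  have "(\<integral>w. g (P w) * S (P w) \<partial>M)
      = 4 * (\<integral>w. tr (K (P w) * (Q (P w) * P w j * (Q (P w) * P w j))) \<partial>M)"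
    by (rule master[OF j g K gK _ mgrad_mult[OF mgrad_indep_mult[OF Q] mgrad_indep_mult[OF Q]] _ skew S])
      (simp_all add: nQ)
  moreover have "(\<integral>w. g (P w) * S (P w) \<partial>M)
      = - 2 * (\<integral>w. g (P w) * (real n * tr (Q (P w) * P w j * (Q (P w) * P w j))
      - ((tr (P w j) + 1) * tr (Q (P w) * Q (P w) * P w j) - (tr (Q (P w) * P w j))\<^sup>2
          + tr (Q (P w)) * tr (Q (P w) * P w j))) \<partial>M)"
    unfolding S_def Bochner_Integration.integral_mult_right_zero[symmetric]
    by (rule Bochner_Integration.integral_cong[OF refl]) (rule mult.left_commute)
  ultimately show ?thesis by simp
qed

lemma tame_fun_integral_mono:
  assumes "tame_fun f" "tame_fun g" "AE w in M. f (P w) \<le> g (P w)"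
  shows "(\<integral>w. f (P w) \<partial>M) \<le> (\<integral>w. g (P w) \<partial>M)"
  using assms by (intro integral_mono_AE tame_fun_integrable)

lemma tame_fun_integral_le_const:
  assumes "tame_fun f" "AE w in M. f (P w) \<le> c"
  shows "(\<integral>w. f (P w) \<partial>M) \<le> c"
  using tame_fun_integral_mono[of f "\<lambda>p. c"] assms by (simp add: prob_space)

end

text \<open>The ranks are prescribed only almost surely, because a singular Gram matrix will give
  the projection 0.\<close>

locale block_model = rot_model M n k P
  for M :: "'a measure" and n k :: nat and P :: "'a \<Rightarrow> nat \<Rightarrow> fmat" +
  fixes d :: "nat \<Rightarrow> nat"
  assumes n2: "2 \<le> n"
    and tr_P: "\<And>i. i < k \<Longrightarrow> AE w in M. tr (P w i) = real (d i)"
    and d_le: "\<And>i. i < k \<Longrightarrow> d i \<le> n"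
begin

lemma N_pos: "0 < N" "real n \<le> 2 * N" "1 \<le> N"
  using n2 by auto

lemma AE_P: "AE w in M. valid n (P w) \<and> (\<forall>i<k. tr (P w i) = real (d i))"
proof -
  have "AE w in M. \<forall>i\<in>{..<k}. tr (P w i) = real (d i)"
    using tr_P by (simp add: AE_finite_all)
  with AE_space show ?thesis by eventually_elim (auto simp: P_valid)
qed

text \<open>A Poincare inequality: testing the eigenfunction identity against the centred function
  itself gives N times its mean square on the left and a gradient term of order n on the right. The
  number c bounds the squared operator norm of \<open>Q\<close>.\<close>

lemma variance_linear:
  assumes j: "j < k" and Q: "indep_block j Q"
    and c: "\<And>p B. valid n p \<Longrightarrow> fro2 (Q p * B) \<le> c * fro2 B" "0 \<le> c"
  shows "(\<integral>w. (tr (Q (P w) * P w j) - real (d j) * tr (Q (P w)) / N)\<^sup>2 \<partial>M) \<le> 10 * c"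
proof -
  let ?g = "\<lambda>p. tr (Q p * p j) - real (d j) * tr (Q p) / N"
  let ?K = "\<lambda>p. Q p * p j - p j * Q p"
  have nQ: "tame_mat Q" by (rule indep_blockD(1)[OF Q])
  have g: "tame_fun ?g" by (simp add: nQ)
  have "grad n j ?g ?K"
    using grad_linear[OF Q] unfolding grad_def act_def
    by (auto simp: indep_blockD(2)[OF Q] intro!: derivative_eq_intros)
  from linear_identity[OF j Q g _ this skew_linear[OF Q]]
  have id: "(\<integral>w. ?g (P w) * (N * tr (Q (P w) * P w j) - tr (Q (P w)) * tr (P w j)) \<partial>M)
    = - 2 * (\<integral>w. tr (?K (P w) * (Q (P w) * P w j)) \<partial>M)"
    by (simp add: nQ)
  have "(\<integral>w. N * (?g (P w))\<^sup>2 \<partial>M)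
      = (\<integral>w. ?g (P w) * (N * tr (Q (P w) * P w j) - tr (Q (P w)) * tr (P w j)) \<partial>M)"
  proof (rule integral_cong_AE)
    show "AE w in M. N * (?g (P w))\<^sup>2
        = ?g (P w) * (N * tr (Q (P w) * P w j) - tr (Q (P w)) * tr (P w j))"
      using AE_P
    proof eventually_elim
      case (elim w)
      have "N * ?g (P w) = N * tr (Q (P w) * P w j) - tr (Q (P w)) * tr (P w j)"
        using elim j N_pos(1) by (simp add: right_diff_distrib)
      then show ?case by (metis mult.left_commute power2_eq_square)
    qed
  qed (intro tame_fun_measurable; simp add: nQ)+
  also have "\<dots> = (\<integral>w. - 2 * tr (?K (P w) * (Q (P w) * P w j)) \<partial>M)"
    unfolding id by simp
  \<comment> \<open>The commutator contributes 4 and \<open>X\<close> itself 1; later n \<le> 2 N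
    doubles the constant.\<close>
  also have "\<dots> \<le> 5 * c * real n"
  proof (rule tame_fun_integral_le_const)
    show "AE w in M. - 2 * tr (?K (P w) * (Q (P w) * P w j)) \<le> 5 * c * real n"
    proof (rule AE_I2)
      fix w assume "w \<in> space M"
      then have v: "valid n (P w)" by (rule P_valid)
      let ?X = "Q (P w) * P w j"
      have X: "fro2 ?X \<le> c * real n"
        using c(1)[OF v, of "P w j"] fro2_valid_le[OF v, of j] c(2) by (meson mult_left_mono order_trans)
      have "tp ?X = P w j * Q (P w)"
        using validD[OF v] indep_blockD(3)[OF Q v] by simp
      then have "fro2 (P w j * Q (P w)) = fro2 ?X"
        using fro2_tp[of ?X] by simp
      then have "fro2 (?K (P w)) \<le> 4 * fro2 ?X"
        using fro2_diff_le[of ?X "P w j * Q (P w)"] by simp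
      then show "- 2 * tr (?K (P w) * ?X) \<le> 5 * c * real n"
        using abs_tr_mult_le[of "?K (P w)" ?X] X by (auto simp: abs_le_iff)
    qed
  qed (simp add: nQ)
  also have "\<dots> \<le> 5 * c * (2 * N)"
    using N_pos c(2) by (intro mult_left_mono) auto
  finally have "N * (\<integral>w. (?g (P w))\<^sup>2 \<partial>M) \<le> N * (10 * c)"
    by (simp add: mult_ac)
  then show ?thesis using N_pos(1) by (simp only: mult_le_cancel_left_pos)
qed

text \<open>Again the identity is tested against the centred function. The remainder in it is not
  constant, so its deviation from a freely chosen r appears on the right, damped by 1/n^2.\<close>

lemma variance_quadratic:
  assumes j: "j < k" and Q: "indep_block j Q"
    and c: "\<And>p B. valid n p \<Longrightarrow> fro2 (Q p * B) \<le> c * fro2 B" "0 \<le> c"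
  shows "(\<integral>w. (tr (Q (P w) * P w j * (Q (P w) * P w j)) - r / real n)\<^sup>2 \<partial>M)
    \<le> 34 * c\<^sup>2 + (\<integral>w. ((tr (P w j) + 1) * tr (Q (P w) * Q (P w) * P w j)
        - (tr (Q (P w) * P w j))\<^sup>2 + tr (Q (P w)) * tr (Q (P w) * P w j) - r)\<^sup>2 \<partial>M) / (real n)\<^sup>2"
proof -
  let ?X = "\<lambda>p. Q p * p j * (Q p * p j)"
  let ?g = "\<lambda>p. tr (?X p) - r / real n"
  let ?K = "\<lambda>p. 2 *\<^sub>R (?X p - p j * Q p * (p j * Q p))"
  let ?R = "\<lambda>p. (tr (p j) + 1) * tr (Q p * Q p * p j) - (tr (Q p * p j))\<^sup>2 + tr (Q p) * tr (Q p * p j)"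
  have nQ: "tame_mat Q" by (rule indep_blockD(1)[OF Q])
  have g: "tame_fun ?g" by (simp add: nQ)
  have R: "tame_fun ?R" by (simp add: nQ)
  have n0: "0 < real n" using n_pos by simp
  have nK: "tame_mat ?K" by (simp add: nQ)
  have tK: "tame_fun (\<lambda>p. - 2 * tr (?K p * ?X p))" by (simp add: nQ)
  from quadratic_identity[OF j Q g nK grad_diff_const[OF grad_quadratic[OF Q]] skew_quadratic[OF Q]]
  have id: "(\<integral>w. ?g (P w) * (real n * tr (?X (P w)) - ?R (P w)) \<partial>M)
    = (\<integral>w. - 2 * tr (?K (P w) * ?X (P w)) \<partial>M)"
    by simp
  \<comment> \<open>17 = 16 + 1: in the squared norm of \<open>K\<close> the factor 2 contributes 4
    and the difference of two matrices of equal norm another 4.\<close>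
  have bound: "- 2 * tr (?K (P w) * ?X (P w)) \<le> 17 * c\<^sup>2 * real n" if "w \<in> space M" for w
  proof -
    have v: "valid n (P w)" using that by (rule P_valid)
    have "fro2 (Q (P w) * (P w j * (Q (P w) * P w j))) \<le> c * fro2 (P w j * (Q (P w) * P w j))"
      by (rule c(1)[OF v])
    also have "\<dots> \<le> c * fro2 (Q (P w) * P w j)"
      by (intro mult_left_mono fro2_proj_mult_le validD(1)[OF v] c(2))
    also have "\<dots> \<le> c * (c * fro2 (P w j))"
      by (intro mult_left_mono c v)
    also have "\<dots> \<le> c * (c * real n)"
      by (intro mult_left_mono c fro2_valid_le v)
    finally have X: "fro2 (?X (P w)) \<le> c\<^sup>2 * real n"
      by (simp add: mult.assoc power2_eq_square)
    have "tp (?X (P w)) = P w j * Q (P w) * (P w j * Q (P w))"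
      using validD[OF v] indep_blockD(3)[OF Q v] by (simp add: mult.assoc)
    then have "fro2 (P w j * Q (P w) * (P w j * Q (P w))) = fro2 (?X (P w))"
      using fro2_tp[of "?X (P w)"] by simp
    then have "fro2 (?K (P w)) \<le> 16 * fro2 (?X (P w))"
      using fro2_diff_le[of "?X (P w)" "P w j * Q (P w) * (P w j * Q (P w))"]
      by (simp add: fro2_scaleR)
    then show ?thesis
      using abs_tr_mult_le[of "?K (P w)" "?X (P w)"] X by (auto simp: abs_le_iff)
  qed
  \<comment> \<open>Completion of the square: with z and e the deviations of the quadratic trace and
    of the remainder, the gap between the two sides is (n z - e)^2 / n.\<close>
  have pt: "real n * (x - r / real n)\<^sup>2
      \<le> 2 * ((x - r / real n) * (real n * x - y)) + (y - r)\<^sup>2 / real n" for x y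
  proof -
    define z e where "z = x - r / real n" and "e = y - r"
    have eq: "real n * x - y = real n * z - e"
      using n0 by (simp add: z_def e_def field_simps)
    have "0 \<le> (real n * z - e)\<^sup>2 / real n"
      using n0 by simp
    also have "(real n * z - e)\<^sup>2 / real n = real n * z\<^sup>2 - 2 * (z * e) + e\<^sup>2 / real n"
      using n0 by (simp add: field_simps power2_eq_square)
    finally show ?thesis
      unfolding z_def[symmetric] e_def[symmetric] eq
      by (simp add: right_diff_distrib power2_eq_square mult_ac)
  qed
  have "real n * (\<integral>w. (?g (P w))\<^sup>2 \<partial>M) = (\<integral>w. real n * (?g (P w))\<^sup>2 \<partial>M)"
    by simp
  also have "\<dots> \<le> (\<integral>w. 2 * (?g (P w) * (real n * tr (?X (P w)) - ?R (P w)))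
      + (?R (P w) - r)\<^sup>2 / real n \<partial>M)"
    using pt by (intro tame_fun_integral_mono) (auto simp: nQ)
  also have "\<dots> = 2 * (\<integral>w. ?g (P w) * (real n * tr (?X (P w)) - ?R (P w)) \<partial>M)
      + (\<integral>w. (?R (P w) - r)\<^sup>2 \<partial>M) / real n"
  proof (subst Bochner_Integration.integral_add)
    have "tame_fun (\<lambda>p. 2 * (?g p * (real n * tr (?X p) - ?R p)))" by (simp add: nQ)
    from tame_fun_integrable[OF this]
    show "integrable M (\<lambda>w. 2 * (?g (P w) * (real n * tr (?X (P w)) - ?R (P w))))" .
    have "tame_fun (\<lambda>p. (?R p - r)\<^sup>2 / real n)" by (simp add: nQ)
    from tame_fun_integrable[OF this] show "integrable M (\<lambda>w. (?R (P w) - r)\<^sup>2 / real n)" .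
  qed simp
  also have "\<dots> \<le> 2 * (17 * c\<^sup>2 * real n) + (\<integral>w. (?R (P w) - r)\<^sup>2 \<partial>M) / real n"
    unfolding id by (intro add_right_mono mult_left_mono tame_fun_integral_le_const[OF tK] AE_I2 bound) auto
  also have "\<dots> = real n * (34 * c\<^sup>2 + (\<integral>w. (?R (P w) - r)\<^sup>2 \<partial>M) / (real n)\<^sup>2)"
    using n0 by (simp add: field_simps power2_eq_square)
  finally show ?thesis
    using n0 by (simp only: mult_le_cancel_left_pos)
qed

end

section \<open>The Stein identity\<close>

lemma power2_sum_le:
  fixes f :: "'b \<Rightarrow> real"
  shows "(\<Sum>x\<in>A. f x)\<^sup>2 \<le> real (card A) * (\<Sum>x\<in>A. (f x)\<^sup>2)"
  using Cauchy_Schwarz_ineq_sum[of "\<lambda>x. 1" f A] by simp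

lemma power2_add_le: "(x + y)\<^sup>2 \<le> 2 * x\<^sup>2 + 2 * y\<^sup>2" for x y :: real
  using zero_le_power2[of "x - y"] by (simp add: power2_sum power2_diff)

lemma power2_diff_le: "(x - y)\<^sup>2 \<le> 2 * x\<^sup>2 + 2 * y\<^sup>2" for x y :: real
  using zero_le_power2[of "x + y"] by (simp add: power2_sum power2_diff)

lemma sum_off_diagonal_remove:
  fixes f :: "nat \<Rightarrow> nat \<Rightarrow> real"
  assumes "j < k" "\<And>i l. f i l = f l i"
  shows "(\<Sum>i<k. \<Sum>l\<in>{..<k} - {i}. f i l)
    = 2 * (\<Sum>i\<in>{..<k} - {j}. f i j) + (\<Sum>i\<in>{..<k} - {j}. \<Sum>l\<in>{..<k} - {i, j}. f i l)"
proof -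
  have "(\<Sum>l\<in>{..<k} - {i}. f i l) = f i j + (\<Sum>l\<in>{..<k} - {i, j}. f i l)" if "i \<in> {..<k} - {j}" for i
  proof -
    have "{..<k} - {i} - {j} = {..<k} - {i, j}" by auto
    then show ?thesis using that assms(1) by (subst sum.remove[of _ j]) auto
  qed
  then have "(\<Sum>i\<in>{..<k} - {j}. \<Sum>l\<in>{..<k} - {i}. f i l)
      = (\<Sum>i\<in>{..<k} - {j}. f i j) + (\<Sum>i\<in>{..<k} - {j}. \<Sum>l\<in>{..<k} - {i, j}. f i l)"
    by (simp add: sum.distrib)
  moreover have "(\<Sum>l\<in>{..<k} - {j}. f j l) = (\<Sum>i\<in>{..<k} - {j}. f i j)"
    using assms(2) by (intro sum.cong) auto
  ultimately show ?thesis
    using assms(1) by (subst sum.remove[of _ j]) auto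
qed

text \<open>With Q the sum of the projections other than the j-th, these are the numbers around
  which the traces concentrate: \<open>mean2_of\<close> belongs to tr(P_i P_l), \<open>q0_of\<close>
  to tr Q, \<open>s0_of\<close> to tr(Q Q), \<open>r0_of\<close> to the remainder in the quadratic
  identity and \<open>v0_of\<close> to the Stein kernel. Each trace linear in P_j is replaced by d_j
  / N times the centre of its coefficient. \<open>v_of\<close> is the resulting approximate variance
  of the statistic.\<close>

definition mean2_of :: "nat \<Rightarrow> (nat \<Rightarrow> nat) \<Rightarrow> nat \<Rightarrow> nat \<Rightarrow> real" where
  "mean2_of n d i l = real (d i) * real (d l) / (real n - 1)"

definition q0_of :: "nat \<Rightarrow> (nat \<Rightarrow> nat) \<Rightarrow> nat \<Rightarrow> real" where
  "q0_of k d j = (\<Sum>i\<in>{..<k} - {j}. real (d i))"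

definition s0_of :: "nat \<Rightarrow> nat \<Rightarrow> (nat \<Rightarrow> nat) \<Rightarrow> nat \<Rightarrow> real" where
  "s0_of n k d j = (\<Sum>i\<in>{..<k} - {j}. \<Sum>l\<in>{..<k} - {j}. if i = l then real (d i) else mean2_of n d i l)"

definition r0_of :: "nat \<Rightarrow> nat \<Rightarrow> (nat \<Rightarrow> nat) \<Rightarrow> nat \<Rightarrow> real" where
  "r0_of n k d j = (real (d j) + 1) * (real (d j) * s0_of n k d j / (real n - 1))
     - (real (d j) * q0_of k d j / (real n - 1))\<^sup>2
     + q0_of k d j * (real (d j) * q0_of k d j / (real n - 1))"

definition v0_of :: "nat \<Rightarrow> nat \<Rightarrow> (nat \<Rightarrow> nat) \<Rightarrow> nat \<Rightarrow> real" where
  "v0_of n k d j = real (d j) * s0_of n k d j / (real n - 1) - r0_of n k d j / real n"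

definition v_of :: "nat \<Rightarrow> nat \<Rightarrow> (nat \<Rightarrow> nat) \<Rightarrow> real" where
  "v_of n k d = (\<Sum>j<k. v0_of n k d j) / (real n - 1)"

section \<open>Concentration of the traces that enter the Stein kernel\<close>

context block_model
begin

definition others :: "nat \<Rightarrow> (nat \<Rightarrow> fmat) \<Rightarrow> fmat" where
  "others j p = (\<Sum>i\<in>{..<k} - {j}. p i)"

lemma indep_proj: "i \<noteq> j \<Longrightarrow> indep_block j (\<lambda>p. p i)"
  unfolding indep_block_def by (auto dest: validD)

lemma indep_others: "indep_block j (others j)"
  unfolding indep_block_def others_def[abs_def]
  by (auto simp: tp_sum sum_distrib_left validD intro!: sum.cong)

lemma indep_others_sq: "indep_block j (\<lambda>p. others j p * others j p)"
  using indep_blockD[OF indep_others[of j]]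
  unfolding indep_block_def by (auto simp: mult.assoc[symmetric])

lemma card_others: "real (card ({..<k} - {j})) \<le> real k"
  using card_mono[of "{..<k}" "{..<k} - {j}"] by auto

lemma fro2_others_mult_le:
  assumes "valid n p"
  shows "fro2 (others j p * B) \<le> (real k)\<^sup>2 * fro2 B"
proof -
  have "fro2 (others j p * B) \<le> (real (card ({..<k} - {j})))\<^sup>2 * fro2 B"
    unfolding others_def sum_distrib_right
    by (intro fro2_sum_le fro2_proj_mult_le validD(1)[OF assms]) auto
  also have "\<dots> \<le> (real k)\<^sup>2 * fro2 B"
    using card_others by (intro mult_right_mono power_mono) auto
  finally show ?thesis .
qed

abbreviation mean2 where "mean2 \<equiv> mean2_of n d"
abbreviation q0 where "q0 \<equiv> q0_of k d"
abbreviation s0 where "s0 \<equiv> s0_of n k d"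
abbreviation r0 where "r0 \<equiv> r0_of n k d"
abbreviation v0 where "v0 \<equiv> v0_of n k d"
abbreviation v where "v \<equiv> v_of n k d"

lemma AE_tr_others: "AE w in M. tr (others j (P w)) = q0 j"
  using AE_P by eventually_elim (auto simp: others_def q0_of_def tr_sum intro!: sum.cong)

lemma variance_pair:
  assumes "i < k" "j < k" "i \<noteq> j"
  shows "(\<integral>w. (tr (P w i * P w j) - mean2 i j)\<^sup>2 \<partial>M) \<le> 10"
proof -
  have "(\<integral>w. (tr (P w i * P w j) - mean2 i j)\<^sup>2 \<partial>M)
      = (\<integral>w. (tr (P w i * P w j) - real (d j) * tr (P w i) / N)\<^sup>2 \<partial>M)"
  proof (rule integral_cong_AE)
    show "AE w in M. (tr (P w i * P w j) - mean2 i j)\<^sup>2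
        = (tr (P w i * P w j) - real (d j) * tr (P w i) / N)\<^sup>2"
      using AE_P by eventually_elim (simp add: mean2_of_def assms mult.commute)
  qed (intro tame_fun_measurable; simp)+
  also have "\<dots> \<le> 10 * 1"
    using assms by (intro variance_linear indep_proj) (auto intro: fro2_proj_mult_le validD)
  finally show ?thesis by simp
qed

text \<open>Apart from its constant diagonal, tr(Q Q) is a sum of at most k^2 pair traces;
  Cauchy-Schwarz costs one factor k^2 and the summation the other.\<close>

lemma variance_square:
  "(\<integral>w. (tr (others j (P w) * others j (P w)) - s0 j)\<^sup>2 \<partial>M) \<le> 10 * real k ^ 4"
proof -
  let ?I = "{..<k} - {j}"
  define f where "f i l p = (if i = l then 0 else tr (p i * p l) - mean2 i l)"
    for i l and p :: "nat \<Rightarrow> fmat"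
  have f: "tame_fun (f i l)" for i l
    unfolding f_def[abs_def] by (cases "i = l") auto
  have o: "tame_mat (others j)" by (rule indep_blockD(1)[OF indep_others])
  have "AE w in M. tr (others j (P w) * others j (P w)) - s0 j = (\<Sum>i\<in>?I. \<Sum>l\<in>?I. f i l (P w))"
    using AE_P
  proof eventually_elim
    case (elim w)
    have "(if i = l then 0 else tr (P w i * P w l) - mean2 i l)
        = tr (P w i * P w l) - (if i = l then real (d i) else mean2 i l)"
      if "i \<in> ?I" for i l
      using elim that validD(4)[of n "P w" i] by auto
    then have "(\<Sum>i\<in>?I. \<Sum>l\<in>?I. f i l (P w))
        = (\<Sum>i\<in>?I. \<Sum>l\<in>?I. tr (P w i * P w l) - (if i = l then real (d i) else mean2 i l))"
      unfolding f_def by (intro sum.cong) auto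
    then show ?case
      by (simp add: others_def s0_of_def sum_product tr_sum sum_subtractf)
  qed
  then have "AE w in M. (tr (others j (P w) * others j (P w)) - s0 j)\<^sup>2
      \<le> real (card (?I \<times> ?I)) * (\<Sum>x\<in>?I \<times> ?I. (f (fst x) (snd x) (P w))\<^sup>2)"
  proof eventually_elim
    case (elim w)
    show ?case
      unfolding elim using power2_sum_le[of "\<lambda>x. f (fst x) (snd x) (P w)" "?I \<times> ?I"]
      by (simp add: sum.cartesian_product case_prod_unfold)
  qed
  then have "(\<integral>w. (tr (others j (P w) * others j (P w)) - s0 j)\<^sup>2 \<partial>M)
      \<le> (\<integral>w. real (card (?I \<times> ?I)) * (\<Sum>x\<in>?I \<times> ?I. (f (fst x) (snd x) (P w))\<^sup>2) \<partial>M)"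
    by (intro tame_fun_integral_mono) (simp_all add: o f)
  also have "\<dots> = real (card (?I \<times> ?I)) * (\<Sum>x\<in>?I \<times> ?I. \<integral>w. (f (fst x) (snd x) (P w))\<^sup>2 \<partial>M)"
    using tame_fun_integrable[OF tame_fun_power[OF f]] by (simp add: Bochner_Integration.integral_sum)
  also have "\<dots> \<le> real (card (?I \<times> ?I)) * (\<Sum>x\<in>?I \<times> ?I. 10)"
  proof (intro mult_left_mono sum_mono)
    fix x assume "x \<in> ?I \<times> ?I"
    then show "(\<integral>w. (f (fst x) (snd x) (P w))\<^sup>2 \<partial>M) \<le> 10"
      using variance_pair[of "fst x" "snd x"] by (cases "fst x = snd x") (auto simp: f_def)
  qed simp
  also have "\<dots> = 10 * real (card ?I) ^ 4"
    by (simp add: card_cartesian_product power4_eq_xxxx)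
  also have "\<dots> \<le> 10 * real k ^ 4"
    using card_others by (intro mult_left_mono power_mono) auto
  finally show ?thesis .
qed

lemma d_div_N: "j < k \<Longrightarrow> real (d j) / N \<le> 2" "0 \<le> real (d j) / N"
proof -
  assume "j < k"
  then have "real (d j) \<le> real n" using d_le by simp
  then have "real (d j) \<le> 2 * N" using N_pos by linarith
  then show "real (d j) / N \<le> 2" using N_pos by (simp add: divide_le_eq)
qed (use N_pos in simp)

lemma variance_tau:
  assumes "j < k"
  shows "(\<integral>w. (tr (others j (P w) * P w j) - real (d j) * q0 j / N)\<^sup>2 \<partial>M) \<le> 10 * (real k)\<^sup>2"
proof -
  have o: "tame_mat (others j)" by (rule indep_blockD(1)[OF indep_others])
  have "(\<integral>w. (tr (others j (P w) * P w j) - real (d j) * q0 j / N)\<^sup>2 \<partial>M)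
      = (\<integral>w. (tr (others j (P w) * P w j) - real (d j) * tr (others j (P w)) / N)\<^sup>2 \<partial>M)"
  proof (rule integral_cong_AE)
    show "AE w in M. (tr (others j (P w) * P w j) - real (d j) * q0 j / N)\<^sup>2
        = (tr (others j (P w) * P w j) - real (d j) * tr (others j (P w)) / N)\<^sup>2"
      using AE_tr_others[of j] by eventually_elim simp
  qed (intro tame_fun_measurable; simp add: o)+
  also have "\<dots> \<le> 10 * (real k)\<^sup>2"
    by (intro variance_linear indep_others fro2_others_mult_le) (use assms in auto)
  finally show ?thesis .
qed

text \<open>tr(Q Q) is random as well: \<open>variance_linear\<close> compares with d_j tr(Q Q) / N,
  and d_j / N \<le> 2 carries over the deviation of tr(Q Q). Hence 100 = 2 * 10 + 8 * 10.\<close>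

lemma variance_beta:
  assumes "j < k"
  shows "(\<integral>w. (tr (others j (P w) * others j (P w) * P w j) - real (d j) * s0 j / N)\<^sup>2 \<partial>M)
    \<le> 100 * real k ^ 4"
proof -
  let ?Q = "\<lambda>p. others j p * others j p"
  have o: "tame_mat (others j)" by (rule indep_blockD(1)[OF indep_others])
  have "(\<integral>w. (tr (?Q (P w) * P w j) - real (d j) * s0 j / N)\<^sup>2 \<partial>M)
      \<le> (\<integral>w. 2 * (tr (?Q (P w) * P w j) - real (d j) * tr (?Q (P w)) / N)\<^sup>2
            + 8 * (tr (?Q (P w)) - s0 j)\<^sup>2 \<partial>M)"
  proof (intro tame_fun_integral_mono AE_I2)
    fix w
    define x y where "x = tr (?Q (P w) * P w j) - real (d j) * tr (?Q (P w)) / N"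
      and "y = tr (?Q (P w)) - s0 j"
    have "tr (?Q (P w) * P w j) - real (d j) * s0 j / N = x + real (d j) / N * y"
      by (simp add: x_def y_def right_diff_distrib diff_divide_distrib)
    then have "(tr (?Q (P w) * P w j) - real (d j) * s0 j / N)\<^sup>2
        \<le> 2 * x\<^sup>2 + 2 * ((real (d j) / N)\<^sup>2 * y\<^sup>2)"
      using power2_add_le[of x "real (d j) / N * y"] by (simp only: power_mult_distrib)
    also have "\<dots> \<le> 2 * x\<^sup>2 + 2 * (2\<^sup>2 * y\<^sup>2)"
      using d_div_N(1)[OF assms] d_div_N(2)[of j] by (intro add_left_mono mult_left_mono mult_right_mono power_mono) auto
    finally show "(tr (?Q (P w) * P w j) - real (d j) * s0 j / N)\<^sup>2
        \<le> 2 * (tr (?Q (P w) * P w j) - real (d j) * tr (?Q (P w)) / N)\<^sup>2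
            + 8 * (tr (?Q (P w)) - s0 j)\<^sup>2"
      by (simp add: x_def y_def)
  qed (simp_all add: o)
  also have "\<dots> = 2 * (\<integral>w. (tr (?Q (P w) * P w j) - real (d j) * tr (?Q (P w)) / N)\<^sup>2 \<partial>M)
      + 8 * (\<integral>w. (tr (?Q (P w)) - s0 j)\<^sup>2 \<partial>M)"
  proof -
    have 1: "integrable M (\<lambda>w. (tr (?Q (P w) * P w j) - real (d j) * tr (?Q (P w)) / N)\<^sup>2)"
      by (rule tame_fun_integrable) (simp add: o)
    have 2: "integrable M (\<lambda>w. (tr (?Q (P w)) - s0 j)\<^sup>2)"
      by (rule tame_fun_integrable) (simp add: o)
    show ?thesis
      using 1 2 by (subst Bochner_Integration.integral_add) simp_all
  qed
  also have "\<dots> \<le> 2 * (10 * real k ^ 4) + 8 * (10 * real k ^ 4)"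
  proof (intro add_mono mult_left_mono variance_square variance_linear[OF assms indep_others_sq])
    fix p B assume v: "valid n p"
    have "fro2 (others j p * (others j p * B)) \<le> (real k)\<^sup>2 * fro2 (others j p * B)"
      by (rule fro2_others_mult_le[OF v])
    also have "\<dots> \<le> (real k)\<^sup>2 * ((real k)\<^sup>2 * fro2 B)"
      by (intro mult_left_mono fro2_others_mult_le[OF v]) simp
    finally show "fro2 (others j p * others j p * B) \<le> real k ^ 4 * fro2 B"
      by (simp add: mult.assoc power4_eq_xxxx power2_eq_square)
  qed auto
  finally show ?thesis by simp
qed

lemma abs_tr_others_mult_le:
  assumes "valid n p"
  shows "\<bar>tr (others j p * p j)\<bar> \<le> real k * real n"
proof -
  have 1: "\<bar>tr (p i * p j)\<bar> \<le> real n" for i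
    using abs_tr_mult_le[of "p i" "p j"] fro2_valid_le[OF assms, of i] fro2_valid_le[OF assms, of j]
    by linarith
  have "\<bar>tr (others j p * p j)\<bar> \<le> (\<Sum>i\<in>{..<k} - {j}. \<bar>tr (p i * p j)\<bar>)"
    unfolding others_def sum_distrib_right tr_sum by (rule sum_abs)
  also have "\<dots> \<le> real (card ({..<k} - {j})) * real n"
    using sum_mono[of "{..<k} - {j}", OF 1] by simp
  also have "\<dots> \<le> real k * real n"
    using card_others by (intro mult_right_mono) auto
  finally show ?thesis .
qed

lemma q0_bounds: "0 \<le> q0 j" "q0 j \<le> real k * real n"
proof -
  show "0 \<le> q0 j" unfolding q0_of_def by (intro sum_nonneg) auto
  have "q0 j \<le> (\<Sum>i\<in>{..<k} - {j}. real n)"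
    unfolding q0_of_def using d_le by (intro sum_mono) auto
  also have "\<dots> \<le> real k * real n"
    using card_others[of j] by (simp add: mult_right_mono)
  finally show "q0 j \<le> real k * real n" .
qed

text \<open>The deviation of the remainder factors as (d_j + 1)(b - b0) + (q0 - t - t0)(t - t0),
  where b and t are the traces of Q Q P_j and Q P_j. The prefactors are O(n) and the deviations O(1)
  in mean square, so the bound is O(n^2), which the division by n^2 in
  \<open>variance_quadratic\<close> absorbs.\<close>

lemma variance_R:
  assumes j: "j < k"
  shows "(\<integral>w. ((tr (P w j) + 1) * tr (others j (P w) * others j (P w) * P w j)
        - (tr (others j (P w) * P w j))\<^sup>2 + tr (others j (P w)) * tr (others j (P w) * P w j)
        - r0 j)\<^sup>2 \<partial>M) \<le> 1120 * real k ^ 4 * (real n)\<^sup>2"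
proof -
  let ?b = "\<lambda>p. tr (others j p * others j p * p j)" and ?t = "\<lambda>p. tr (others j p * p j)"
  define b0 t0 where "b0 = real (d j) * s0 j / N" and "t0 = real (d j) * q0 j / N"
  have o: "tame_mat (others j)" by (rule indep_blockD(1)[OF indep_others])
  have t0: "0 \<le> t0" "t0 \<le> 2 * (real k * real n)"
  proof -
    have "t0 = real (d j) / N * q0 j" by (simp add: t0_def)
    moreover have "\<dots> \<le> 2 * (real k * real n)"
      using d_div_N(1)[OF j] d_div_N(2)[of j] q0_bounds[of j] by (intro mult_mono) auto
    ultimately show "t0 \<le> 2 * (real k * real n)" by simp
    show "0 \<le> t0" unfolding t0_def using q0_bounds[of j] N_pos by simp
  qed
  have "AE w in M. ((tr (P w j) + 1) * ?b (P w) - (?t (P w))\<^sup>2 + tr (others j (P w)) * ?t (P w) - r0 j)\<^sup>2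
      \<le> 8 * (real n)\<^sup>2 * (?b (P w) - b0)\<^sup>2 + 32 * (real k)\<^sup>2 * (real n)\<^sup>2 * (?t (P w) - t0)\<^sup>2"
    using AE_P AE_tr_others[of j]
  proof eventually_elim
    case (elim w)
    let ?x = "?b (P w)" and ?y = "?t (P w)"
    have y: "\<bar>?y\<bar> \<le> real k * real n"
      using elim by (intro abs_tr_others_mult_le) auto
    have c: "\<bar>q0 j - ?y - t0\<bar> \<le> 4 * (real k * real n)"
      using y t0 q0_bounds[of j] by linarith
    have d1: "\<bar>real (d j) + 1\<bar> \<le> 2 * real n"
      using d_le[OF j] n_pos by simp
    have "(real (d j) + 1) * ?x - ?y\<^sup>2 + q0 j * ?y - r0 j
        = (real (d j) + 1) * (?x - b0) + (q0 j - ?y - t0) * (?y - t0)"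
      unfolding r0_of_def b0_def[symmetric] t0_def[symmetric]
      by (simp add: algebra_simps power2_eq_square)
    then have "((real (d j) + 1) * ?x - ?y\<^sup>2 + q0 j * ?y - r0 j)\<^sup>2
        \<le> 2 * ((real (d j) + 1)\<^sup>2 * (?x - b0)\<^sup>2) + 2 * ((q0 j - ?y - t0)\<^sup>2 * (?y - t0)\<^sup>2)"
      using power2_add_le[of "(real (d j) + 1) * (?x - b0)" "(q0 j - ?y - t0) * (?y - t0)"]
      by (simp only: power_mult_distrib)
    also have "\<dots> \<le> 2 * ((2 * real n)\<^sup>2 * (?x - b0)\<^sup>2) + 2 * ((4 * (real k * real n))\<^sup>2 * (?y - t0)\<^sup>2)"
      using power_mono[OF d1, of 2] power_mono[OF c, of 2]
      by (intro add_mono mult_left_mono mult_right_mono) auto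
    finally show ?case
      using elim j by (simp add: power_mult_distrib mult_ac)
  qed
  then have "(\<integral>w. ((tr (P w j) + 1) * ?b (P w) - (?t (P w))\<^sup>2 + tr (others j (P w)) * ?t (P w) - r0 j)\<^sup>2 \<partial>M)
     \<le> (\<integral>w. 8 * (real n)\<^sup>2 * (?b (P w) - b0)\<^sup>2 + 32 * (real k)\<^sup>2 * (real n)\<^sup>2 * (?t (P w) - t0)\<^sup>2 \<partial>M)"
    by (intro tame_fun_integral_mono) (simp_all add: o)
  also have "\<dots> = 8 * (real n)\<^sup>2 * (\<integral>w. (?b (P w) - b0)\<^sup>2 \<partial>M)
      + 32 * (real k)\<^sup>2 * (real n)\<^sup>2 * (\<integral>w. (?t (P w) - t0)\<^sup>2 \<partial>M)"
  proof -
    have 1: "integrable M (\<lambda>w. (?b (P w) - b0)\<^sup>2)"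
      by (rule tame_fun_integrable) (simp add: o)
    have 2: "integrable M (\<lambda>w. (?t (P w) - t0)\<^sup>2)"
      by (rule tame_fun_integrable) (simp add: o)
    show ?thesis
      using 1 2 by (subst Bochner_Integration.integral_add) simp_all
  qed
  also have "\<dots> \<le> 8 * (real n)\<^sup>2 * (100 * real k ^ 4) + 32 * (real k)\<^sup>2 * (real n)\<^sup>2 * (10 * (real k)\<^sup>2)"
    unfolding b0_def t0_def
    by (intro add_mono mult_left_mono variance_beta variance_tau j) auto
  also have "\<dots> = 1120 * real k ^ 4 * (real n)\<^sup>2"
    by (simp add: power4_eq_xxxx power2_eq_square)
  finally show ?thesis .
qed

text \<open>On valid points this is half the squared Frobenius norm of the commutator of
  \<open>others j p\<close> and \<open>p j\<close>.\<close>

definition stein_kernel :: "nat \<Rightarrow> (nat \<Rightarrow> fmat) \<Rightarrow> real" where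
  "stein_kernel j p = tr (others j p * others j p * p j) - tr (others j p * p j * (others j p * p j))"

lemma stein_kernel_tame_fun [simp]: "tame_fun (stein_kernel j)"
  unfolding stein_kernel_def[abs_def] by (simp add: indep_blockD(1)[OF indep_others])

text \<open>Both traces of the kernel are within O(1) of their centres in mean square, and an error
  of this size is harmless after division by N. The constant is 2508 = 2 * 100 + 2 * 1154 with 1154
  = 34 + 1120; the summand 1 comes from bounding |x| by 1 + x^2.\<close>

lemma stein_kernel_concentration:
  assumes j: "j < k"
  shows "(\<integral>w. \<bar>stein_kernel j (P w) - v0 j\<bar> \<partial>M) \<le> 1 + 2508 * real k ^ 4"
proof -
  let ?b = "\<lambda>p. tr (others j p * others j p * p j)" and ?u = "\<lambda>p. tr (others j p * p j * (others j p * p j))"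
  define b0 where "b0 = real (d j) * s0 j / N"
  have o: "tame_mat (others j)" by (rule indep_blockD(1)[OF indep_others])
  have "(\<integral>w. (?u (P w) - r0 j / real n)\<^sup>2 \<partial>M)
      \<le> 34 * ((real k)\<^sup>2)\<^sup>2 + (1120 * real k ^ 4 * (real n)\<^sup>2) / (real n)\<^sup>2"
    by (rule order_trans[OF variance_quadratic[OF j indep_others fro2_others_mult_le]],
        assumption, simp, intro add_left_mono divide_right_mono variance_R j, simp)
  also have "\<dots> = 1154 * real k ^ 4"
    using n_pos by (simp add: power4_eq_xxxx power2_eq_square)
  finally have u: "(\<integral>w. (?u (P w) - r0 j / real n)\<^sup>2 \<partial>M) \<le> 1154 * real k ^ 4" .
  have abs_le: "\<bar>x - y\<bar> \<le> 1 + 2 * x\<^sup>2 + 2 * y\<^sup>2" for x y :: real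
  proof -
    have "\<bar>z\<bar> \<le> 1 + z\<^sup>2" for z :: real
      using zero_le_power2[of "\<bar>z\<bar> - 1"] abs_ge_zero[of z]
      unfolding power2_diff power2_abs one_power2 mult_1_right by linarith
    from this[of "x - y"] show ?thesis
      using power2_diff_le[of x y] by linarith
  qed
  have "(\<integral>w. \<bar>stein_kernel j (P w) - v0 j\<bar> \<partial>M)
      \<le> (\<integral>w. 1 + 2 * (?b (P w) - b0)\<^sup>2 + 2 * (?u (P w) - r0 j / real n)\<^sup>2 \<partial>M)"
  proof (intro tame_fun_integral_mono AE_I2)
    show "tame_fun (\<lambda>p. \<bar>stein_kernel j p - v0 j\<bar>)"
      by (rule tame_fun_compose) (auto intro: continuous_intros)
    show "\<bar>stein_kernel j (P w) - v0 j\<bar> \<le> 1 + 2 * (?b (P w) - b0)\<^sup>2 + 2 * (?u (P w) - r0 j / real n)\<^sup>2" for w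
      using abs_le[of "?b (P w) - b0" "?u (P w) - r0 j / real n"]
      by (simp add: stein_kernel_def v0_of_def b0_def algebra_simps)
  qed (simp_all add: o)
  also have "\<dots> = 1 + 2 * (\<integral>w. (?b (P w) - b0)\<^sup>2 \<partial>M) + 2 * (\<integral>w. (?u (P w) - r0 j / real n)\<^sup>2 \<partial>M)"
  proof -
    have 1: "integrable M (\<lambda>w. (?b (P w) - b0)\<^sup>2)"
      by (rule tame_fun_integrable) (simp add: o)
    have 2: "integrable M (\<lambda>w. (?u (P w) - r0 j / real n)\<^sup>2)"
      by (rule tame_fun_integrable) (simp add: o)
    show ?thesis
      using 1 2 by (simp add: prob_space)
  qed
  also have "\<dots> \<le> 1 + 2 * (100 * real k ^ 4) + 2 * (1154 * real k ^ 4)"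
    unfolding b0_def by (intro add_mono mult_left_mono variance_beta u j) auto
  finally show ?thesis by simp
qed

section \<open>The centred statistic and its Stein identity\<close>

definition T :: "(nat \<Rightarrow> fmat) \<Rightarrow> real" where
  "T p = (\<Sum>i<k. \<Sum>l\<in>{..<k} - {i}. tr (p i * p l) - mean2 i l) / 2"

lemma T_tame_fun [simp]: "tame_fun T"
  unfolding T_def[abs_def] by simp

text \<open>Only the pairs containing j vary. They occur in both orders, which cancels the factor
  1/2, so the gradient is that of tr(Q P_j).\<close>

lemma grad_T:
  assumes j: "j < k"
  shows "grad n j T (\<lambda>p. others j p * p j - p j * others j p)"
proof -
  define rest where "rest p = (\<Sum>i\<in>{..<k} - {j}. \<Sum>l\<in>{..<k} - {i, j}. tr (p i * p l) - mean2 i l) / 2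
      - (\<Sum>i\<in>{..<k} - {j}. mean2 i j)" for p :: "nat \<Rightarrow> fmat"
  have T: "T p = tr (others j p * p j) + rest p" for p
    unfolding T_def rest_def
    by (subst sum_off_diagonal_remove[OF j])
      (auto simp: tr_commute mean2_of_def others_def sum_distrib_right tr_sum sum_subtractf mult.commute
        add_divide_distrib)
  have "rest (p(j := Y)) = rest p" for p Y
    unfolding rest_def by (auto intro!: sum.cong arg_cong[where f = "\<lambda>x. x / 2"])
  then show ?thesis
    using grad_linear[OF indep_others, of j] unfolding grad_def T act_def
    by (auto intro!: derivative_eq_intros)
qed

text \<open>The eigenfunction identities with test function h(T) are added over j. On the left they
  sum to 2 N T h(T), since each pair trace is counted for both of its blocks; on the right the chain
  rule produces 2 h'(T) times the kernels. Replacing each kernel by its centre costs B times an O(1)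
  error.\<close>

theorem stein:
  assumes h: "\<And>x. (h has_real_derivative h' x) (at x)" and h': "continuous_on UNIV h'"
    and B: "\<And>x. \<bar>h' x\<bar> \<le> B"
  shows "\<bar>(\<integral>w. T (P w) * h (T (P w)) \<partial>M) - v * (\<integral>w. h' (T (P w)) \<partial>M)\<bar>
    \<le> B * (real k * (1 + 2508 * real k ^ 4)) / N"
proof -
  have B0: "0 \<le> B" using B[of 0] by linarith
  have "continuous_on UNIV h"
    by (intro continuous_at_imp_continuous_on ballI DERIV_isCont[OF h])
  then have nh: "tame_fun (\<lambda>p. h (T p))" by (rule tame_fun_compose[OF T_tame_fun])
  have nh': "tame_fun (\<lambda>p. h' (T p))" using h' by (rule tame_fun_compose[OF T_tame_fun])
  have o: "tame_mat (others j)" for j by (rule indep_blockD(1)[OF indep_others])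
  have id: "(\<integral>w. h (T (P w)) * (N * tr (others j (P w) * P w j) - tr (others j (P w)) * tr (P w j)) \<partial>M)
      = 2 * (\<integral>w. h' (T (P w)) * stein_kernel j (P w) \<partial>M)" if j: "j < k" for j
  proof -
    let ?K = "\<lambda>p. others j p * p j - p j * others j p"
    have 1: "tr (?K p * (others j p * p j)) = - stein_kernel j p" if p: "valid n p" for p
    proof -
      have "tr (p j * (others j p * (others j p * p j))) = tr (others j p * (others j p * p j))"
        using tr_commute[of "p j" "others j p * (others j p * p j)"] validD(4)[OF p, of j]
        by (simp add: mult.assoc)
      then show ?thesis by (simp add: stein_kernel_def left_diff_distrib mult.assoc)
    qed
    have "(\<integral>w. h (T (P w)) * (N * tr (others j (P w) * P w j) - tr (others j (P w)) * tr (P w j)) \<partial>M)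
      = - 2 * (\<integral>w. tr (h' (T (P w)) *\<^sub>R ?K (P w) * (others j (P w) * P w j)) \<partial>M)"
      using skew_linear[OF indep_others[of j]]
      by (intro linear_identity[OF j indep_others nh _ grad_compose[OF grad_T[OF j] h]])
        (simp_all add: o nh' scaleR_minus_right[symmetric] del: scaleR_minus_right)
    also have "\<dots> = - 2 * (\<integral>w. - (h' (T (P w)) * stein_kernel j (P w)) \<partial>M)"
      by (intro arg_cong[where f = "\<lambda>x. - 2 * x"] Bochner_Integration.integral_cong refl)
        (simp add: 1[OF P_valid])
    finally show ?thesis by simp
  qed
  have int1: "integrable M (\<lambda>w. h (T (P w)) * (N * tr (others j (P w) * P w j)
      - tr (others j (P w)) * tr (P w j)))" for j
    by (rule tame_fun_integrable) (simp add: nh o)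
  have int2: "integrable M (\<lambda>w. h' (T (P w)) * stein_kernel j (P w))" for j
    by (rule tame_fun_integrable) (simp add: nh')
  have "2 * N * (\<integral>w. T (P w) * h (T (P w)) \<partial>M) = (\<integral>w. 2 * N * (T (P w) * h (T (P w))) \<partial>M)"
    by simp
  also have "\<dots> = (\<integral>w. (\<Sum>j<k. h (T (P w)) * (N * tr (others j (P w) * P w j)
      - tr (others j (P w)) * tr (P w j))) \<partial>M)"
  proof (rule integral_cong_AE)
    show "AE w in M. 2 * N * (T (P w) * h (T (P w))) = (\<Sum>j<k. h (T (P w)) *
        (N * tr (others j (P w) * P w j) - tr (others j (P w)) * tr (P w j)))"
      using AE_P
    proof eventually_elim
      case (elim w)
      have "N * tr (others j (P w) * P w j) - tr (others j (P w)) * tr (P w j)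
          = N * (\<Sum>l\<in>{..<k} - {j}. tr (P w j * P w l) - mean2 j l)" if "j < k" for j
        using elim that N_pos(1)
        by (simp add: others_def sum_distrib_right sum_distrib_left sum_subtractf tr_sum mean2_of_def
            tr_commute[of "P w j"] right_diff_distrib mult.commute)
      then have "(\<Sum>j<k. h (T (P w)) * (N * tr (others j (P w) * P w j) - tr (others j (P w)) * tr (P w j)))
          = (\<Sum>j<k. h (T (P w)) * (N * (\<Sum>l\<in>{..<k} - {j}. tr (P w j * P w l) - mean2 j l)))"
        by (intro sum.cong) auto
      also have "\<dots> = h (T (P w)) * N * (\<Sum>j<k. \<Sum>l\<in>{..<k} - {j}. tr (P w j * P w l) - mean2 j l)"
        by (simp only: sum_distrib_left mult.assoc)
      also have "(\<Sum>j<k. \<Sum>l\<in>{..<k} - {j}. tr (P w j * P w l) - mean2 j l) = 2 * T (P w)"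
        by (simp add: T_def)
      finally show ?case by simp
    qed
    show "(\<lambda>w. 2 * N * (T (P w) * h (T (P w)))) \<in> borel_measurable M"
      by (rule tame_fun_measurable) (simp add: nh)
    show "(\<lambda>w. \<Sum>j<k. h (T (P w)) * (N * tr (others j (P w) * P w j)
        - tr (others j (P w)) * tr (P w j))) \<in> borel_measurable M"
      by (rule tame_fun_measurable) (simp add: nh o)
  qed
  also have "\<dots> = (\<Sum>j<k. 2 * (\<integral>w. h' (T (P w)) * stein_kernel j (P w) \<partial>M))"
    using int1 id by (simp add: Bochner_Integration.integral_sum)
  finally have eq: "N * (\<integral>w. T (P w) * h (T (P w)) \<partial>M)
      = (\<Sum>j<k. \<integral>w. h' (T (P w)) * stein_kernel j (P w) \<partial>M)"
    unfolding mult.assoc sum_distrib_left[symmetric] mult_cancel_left by simp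
  have diff: "\<bar>(\<integral>w. h' (T (P w)) * stein_kernel j (P w) \<partial>M) - v0 j * (\<integral>w. h' (T (P w)) \<partial>M)\<bar>
      \<le> B * (1 + 2508 * real k ^ 4)" if j: "j < k" for j
  proof -
    have n1: "tame_fun (\<lambda>p. h' (T p) * (stein_kernel j p - v0 j))" by (simp add: nh')
    have n2: "tame_fun (\<lambda>p. \<bar>h' (T p) * (stein_kernel j p - v0 j)\<bar>)"
      by (rule tame_fun_compose[OF n1]) (auto intro: continuous_intros)
    have n3: "tame_fun (\<lambda>p. \<bar>stein_kernel j p - v0 j\<bar>)"
      by (rule tame_fun_compose) (auto intro: continuous_intros)
    have eq: "(\<integral>w. h' (T (P w)) * stein_kernel j (P w) \<partial>M) - v0 j * (\<integral>w. h' (T (P w)) \<partial>M)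
        = (\<integral>w. h' (T (P w)) * (stein_kernel j (P w) - v0 j) \<partial>M)"
      using int2 tame_fun_integrable[OF nh'] by (simp add: right_diff_distrib mult.commute)
    have "\<bar>\<integral>w. h' (T (P w)) * (stein_kernel j (P w) - v0 j) \<partial>M\<bar> \<le> (\<integral>w. \<bar>h' (T (P w)) * (stein_kernel j (P w) - v0 j)\<bar> \<partial>M)"
      by (rule integral_abs_bound)
    also have "\<dots> \<le> (\<integral>w. B * \<bar>stein_kernel j (P w) - v0 j\<bar> \<partial>M)"
    proof (rule tame_fun_integral_mono[where f = "\<lambda>p. \<bar>h' (T p) * (stein_kernel j p - v0 j)\<bar>"
          and g = "\<lambda>p. B * \<bar>stein_kernel j p - v0 j\<bar>"])
      show "tame_fun (\<lambda>p. B * \<bar>stein_kernel j p - v0 j\<bar>)"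
        by (rule tame_fun_mult[OF tame_fun_const n3])
      show "AE w in M. \<bar>h' (T (P w)) * (stein_kernel j (P w) - v0 j)\<bar>
          \<le> B * \<bar>stein_kernel j (P w) - v0 j\<bar>"
        unfolding abs_mult by (intro AE_I2 mult_right_mono B abs_ge_zero)
    qed (rule n2)
    also have "\<dots> = B * (\<integral>w. \<bar>stein_kernel j (P w) - v0 j\<bar> \<partial>M)"
      by simp
    also have "\<dots> \<le> B * (1 + 2508 * real k ^ 4)"
      by (intro mult_left_mono stein_kernel_concentration j B0)
    finally show ?thesis unfolding eq .
  qed
  have eqN: "N * ((\<integral>w. T (P w) * h (T (P w)) \<partial>M) - v * (\<integral>w. h' (T (P w)) \<partial>M))
      = (\<Sum>j<k. (\<integral>w. h' (T (P w)) * stein_kernel j (P w) \<partial>M) - v0 j * (\<integral>w. h' (T (P w)) \<partial>M))"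
    using N_pos(1) eq by (simp add: v_of_def sum_subtractf sum_distrib_right right_diff_distrib)
  have "\<bar>N * ((\<integral>w. T (P w) * h (T (P w)) \<partial>M) - v * (\<integral>w. h' (T (P w)) \<partial>M))\<bar>
      \<le> (\<Sum>j<k. B * (1 + 2508 * real k ^ 4))"
    unfolding eqN by (rule order_trans[OF sum_abs], intro sum_mono diff) auto
  then have "N * \<bar>(\<integral>w. T (P w) * h (T (P w)) \<partial>M) - v * (\<integral>w. h' (T (P w)) \<partial>M)\<bar>
      \<le> B * (real k * (1 + 2508 * real k ^ 4))"
    using N_pos(1) by (simp add: abs_mult mult_ac)
  then show ?thesis
    using N_pos(1) by (simp add: le_divide_eq mult.commute)
qed

end

section \<open>The characteristic function\<close>

text \<open>Gronwall's argument for $f' = - v s f$ with integrating factor $e^{v s^2/2}$.\<close>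

lemma gaussian_ode_bound:
  fixes f f' :: "real \<Rightarrow> real"
  assumes f: "\<And>s. (f has_real_derivative f' s) (at s)"
    and bound: "\<And>s. \<bar>f' s + v * s * f s\<bar> \<le> D * \<bar>s\<bar>" and v: "0 \<le> v"
  shows "\<bar>f t - f 0 * exp (- (v * t\<^sup>2 / 2))\<bar> \<le> D * t\<^sup>2"
proof -
  define g where "g s = f s * exp (v * s\<^sup>2 / 2)" for s
  define g' where "g' s = (f' s + v * s * f s) * exp (v * s\<^sup>2 / 2)" for s
  have g: "(g has_real_derivative g' s) (at s)" for s
    unfolding g_def[abs_def] g'_def
    by (auto intro!: derivative_eq_intros f simp: algebra_simps)
  have D: "0 \<le> D" using bound[of 1] by linarith
  have "norm (g t - g 0) \<le> (D * \<bar>t\<bar> * exp (v * t\<^sup>2 / 2)) * norm (t - 0)"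
  proof (rule field_differentiable_bound[of "closed_segment 0 t" g g'])
    fix s assume "s \<in> closed_segment 0 t"
    then have s: "\<bar>s\<bar> \<le> \<bar>t\<bar>"
      by (auto simp: closed_segment_eq_real_ivl split: if_splits)
    then have "s\<^sup>2 \<le> t\<^sup>2" by (simp add: abs_le_square_iff)
    then have "exp (v * s\<^sup>2 / 2) \<le> exp (v * t\<^sup>2 / 2)"
      using v by (simp add: mult_left_mono)
    moreover have "\<bar>f' s + v * s * f s\<bar> \<le> D * \<bar>t\<bar>"
      using bound[of s] s D by (meson mult_left_mono order_trans)
    ultimately show "norm (g' s) \<le> D * \<bar>t\<bar> * exp (v * t\<^sup>2 / 2)"
      using D unfolding g'_def by (auto simp: abs_mult intro!: mult_mono)
  qed (auto intro: g DERIV_subset)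
  then have "\<bar>g t - g 0\<bar> * exp (- (v * t\<^sup>2 / 2)) \<le> D * \<bar>t\<bar> * exp (v * t\<^sup>2 / 2) * \<bar>t\<bar> * exp (- (v * t\<^sup>2 / 2))"
    by (intro mult_right_mono) auto
  also have "\<dots> = D * t\<^sup>2"
  proof -
    have e: "exp (v * t\<^sup>2 / 2) * exp (- (v * t\<^sup>2 / 2)) = 1"
      by (simp add: exp_add[symmetric])
    have c: "D * \<bar>t\<bar> * a * \<bar>t\<bar> * b = D * (\<bar>t\<bar> * \<bar>t\<bar>) * (a * b)" for a b
      by (simp add: mult_ac)
    show ?thesis unfolding c e by (simp add: power2_eq_square)
  qed
  also have "\<bar>g t - g 0\<bar> * exp (- (v * t\<^sup>2 / 2)) = \<bar>(g t - g 0) * exp (- (v * t\<^sup>2 / 2))\<bar>"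
    by (simp add: abs_mult)
  also have "(g t - g 0) * exp (- (v * t\<^sup>2 / 2)) = f t - f 0 * exp (- (v * t\<^sup>2 / 2))"
    by (simp add: g_def left_diff_distrib mult.assoc exp_add[symmetric])
  finally show ?thesis .
qed

context rot_model
begin

text \<open>A Lipschitz derivative bounds the Taylor remainder by the square of the increment. As Y
  is bounded by C, the difference quotient is within C^2 |h| of the claimed value.\<close>

lemma expectation_has_derivative:
  assumes Y: "tame_fun Y" and \<phi>: "\<And>x. (\<phi> has_real_derivative \<psi> x) (at x)"
    and lip: "\<And>x y. \<bar>\<psi> x - \<psi> y\<bar> \<le> \<bar>x - y\<bar>"
  shows "((\<lambda>t. \<integral>w. \<phi> (t * Y (P w)) \<partial>M) has_real_derivative (\<integral>w. Y (P w) * \<psi> (t * Y (P w)) \<partial>M)) (at t)"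
proof -
  obtain C where C: "\<And>p. valid n p \<Longrightarrow> \<bar>Y p\<bar> \<le> C" "0 \<le> C"
    using Y by (metis tame_funE)
  have c\<phi>: "continuous_on UNIV \<phi>"
    by (intro continuous_at_imp_continuous_on ballI DERIV_isCont[OF \<phi>])
  have c\<psi>: "continuous_on UNIV \<psi>"
    unfolding continuous_on_iff
  proof (intro ballI allI impI)
    fix x e :: real assume "0 < e"
    then show "\<exists>d>0. \<forall>x'\<in>UNIV. dist x' x < d \<longrightarrow> dist (\<psi> x') (\<psi> x) < e"
      using lip by (intro exI[of _ e]) (auto simp: dist_real_def intro: order_le_less_trans)
  qed
  have n\<phi>: "tame_fun (\<lambda>p. \<phi> (t * Y p))" for t
    using c\<phi> by (rule tame_fun_compose[rotated]) (simp add: Y)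
  have n\<psi>: "tame_fun (\<lambda>p. Y p * \<psi> (t * Y p))"
    by (rule tame_fun_mult[OF Y], rule tame_fun_compose[where h = \<psi>]) (simp_all add: Y c\<psi>)
  have taylor: "\<bar>\<phi> (x + y) - \<phi> x - y * \<psi> x\<bar> \<le> y\<^sup>2" for x y
  proof -
    have "norm ((\<phi> (x + y) - (x + y) * \<psi> x) - (\<phi> x - x * \<psi> x)) \<le> \<bar>y\<bar> * norm ((x + y) - x)"
    proof (rule field_differentiable_bound[of "closed_segment x (x + y)" "\<lambda>z. \<phi> z - z * \<psi> x"
          "\<lambda>z. \<psi> z - \<psi> x"])
      fix z assume "z \<in> closed_segment x (x + y)"
      then have "\<bar>z - x\<bar> \<le> \<bar>y\<bar>"
        by (auto simp: closed_segment_eq_real_ivl split: if_splits)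
      then show "norm (\<psi> z - \<psi> x) \<le> \<bar>y\<bar>"
        using lip[of z x] by simp
      show "((\<lambda>z. \<phi> z - z * \<psi> x) has_field_derivative \<psi> z - \<psi> x)
          (at z within closed_segment x (x + y))"
        by (auto intro!: derivative_eq_intros DERIV_subset[OF \<phi>])
    qed auto
    then show ?thesis by (simp add: algebra_simps power2_eq_square abs_mult[symmetric])
  qed
  let ?F = "\<lambda>t. \<integral>w. \<phi> (t * Y (P w)) \<partial>M" and ?D = "\<integral>w. Y (P w) * \<psi> (t * Y (P w)) \<partial>M"
  have bound: "\<bar>(?F (t + h) - ?F t) / h - ?D\<bar> \<le> C\<^sup>2 * \<bar>h\<bar>" if "h \<noteq> 0" for h
  proof -
    define G where "G p = \<phi> ((t + h) * Y p) - \<phi> (t * Y p) - h * (Y p * \<psi> (t * Y p))" for p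
    have nG: "tame_fun G" unfolding G_def[abs_def] by (simp add: n\<phi> n\<psi>)
    have nG': "tame_fun (\<lambda>p. \<bar>G p\<bar>)" by (rule tame_fun_compose[OF nG]) (auto intro: continuous_intros)
    have G: "(\<integral>w. G (P w) \<partial>M) = ?F (t + h) - ?F t - h * ?D"
      unfolding G_def using tame_fun_integrable[OF n\<phi>] tame_fun_integrable[OF n\<psi>] by simp
    have "\<bar>\<integral>w. G (P w) \<partial>M\<bar> \<le> (\<integral>w. \<bar>G (P w)\<bar> \<partial>M)"
      by (rule integral_abs_bound)
    also have "\<dots> \<le> h\<^sup>2 * C\<^sup>2"
    proof (rule tame_fun_integral_le_const[OF nG'], rule AE_I2)
      fix w assume "w \<in> space M"
      then have Yw: "\<bar>Y (P w)\<bar> \<le> C" by (intro C(1) P_valid)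
      have "\<bar>G (P w)\<bar> \<le> (h * Y (P w))\<^sup>2"
        using taylor[of "t * Y (P w)" "h * Y (P w)"] by (simp add: G_def algebra_simps)
      also have "\<dots> \<le> h\<^sup>2 * C\<^sup>2"
        using power_mono[OF Yw, of 2] by (simp add: power_mult_distrib mult_left_mono)
      finally show "\<bar>G (P w)\<bar> \<le> h\<^sup>2 * C\<^sup>2" .
    qed
    finally have 1: "\<bar>?F (t + h) - ?F t - h * ?D\<bar> \<le> h\<^sup>2 * C\<^sup>2" unfolding G .
    have "(?F (t + h) - ?F t) / h - ?D = (?F (t + h) - ?F t - h * ?D) / h"
      using that by (simp add: field_simps)
    then have "\<bar>(?F (t + h) - ?F t) / h - ?D\<bar> = \<bar>?F (t + h) - ?F t - h * ?D\<bar> / \<bar>h\<bar>"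
      by (simp only: abs_divide)
    also have "\<dots> \<le> h\<^sup>2 * C\<^sup>2 / \<bar>h\<bar>"
      using 1 by (intro divide_right_mono) auto
    also have "\<dots> = C\<^sup>2 * \<bar>h\<bar>"
      using that by (simp add: field_simps power2_eq_square abs_mult_self_eq)
    finally show ?thesis .
  qed
  have "((\<lambda>h. (?F (t + h) - ?F t) / h - ?D) \<longlongrightarrow> 0) (at 0)"
  proof (rule Lim_null_comparison)
    show "eventually (\<lambda>h. norm ((?F (t + h) - ?F t) / h - ?D) \<le> C\<^sup>2 * \<bar>h\<bar>) (at 0)"
      unfolding eventually_at using bound by (intro exI[of _ 1]) auto
    show "((\<lambda>h. C\<^sup>2 * \<bar>h\<bar>) \<longlongrightarrow> 0) (at 0)"
      by (auto intro!: tendsto_eq_intros)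
  qed
  then show ?thesis
    unfolding DERIV_def by (simp add: LIM_zero_iff)
qed

end

context block_model
begin

text \<open>For the test functions sin(s .) and cos(s .), whose derivatives are bounded by |s|, the
  Stein identity says that E cos(s T) and E sin(s T) satisfy f' = - v s f up to D |s|. The initial
  values are 1 and 0.\<close>

lemma cos_sin_bound:
  assumes v: "0 \<le> v"
  defines "D \<equiv> real k * (1 + 2508 * real k ^ 4) / N"
  shows "\<bar>(\<integral>w. cos (t * T (P w)) \<partial>M) - exp (- (v * t\<^sup>2 / 2))\<bar> \<le> D * t\<^sup>2"
    "\<bar>\<integral>w. sin (t * T (P w)) \<partial>M\<bar> \<le> D * t\<^sup>2"
proof -
  have sl: "\<bar>sin x - sin y\<bar> \<le> \<bar>x - y\<bar>" for x y :: real
    using field_differentiable_bound[of UNIV sin cos 1 x y] by (auto intro!: derivative_eq_intros)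
  have cl: "\<bar>cos x - cos y\<bar> \<le> \<bar>x - y\<bar>" for x y :: real
    using field_differentiable_bound[of UNIV cos "\<lambda>x. - sin x" 1 x y]
    by (auto intro!: derivative_eq_intros)
  have c: "((\<lambda>t. \<integral>w. cos (t * T (P w)) \<partial>M) has_real_derivative
      (\<integral>w. T (P w) * - sin (s * T (P w)) \<partial>M)) (at s)" for s
  proof (rule expectation_has_derivative[OF T_tame_fun])
    show "\<bar>- sin x - - sin y\<bar> \<le> \<bar>x - y\<bar>" for x y :: real using sl[of y x] by simp
  qed (rule DERIV_cos)
  have s: "((\<lambda>t. \<integral>w. sin (t * T (P w)) \<partial>M) has_real_derivative
      (\<integral>w. T (P w) * cos (s * T (P w)) \<partial>M)) (at s)" for s
    by (rule expectation_has_derivative[OF T_tame_fun DERIV_sin cl])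
  have b1: "\<bar>(\<integral>w. T (P w) * - sin (s * T (P w)) \<partial>M) + v * s * (\<integral>w. cos (s * T (P w)) \<partial>M)\<bar>
      \<le> D * \<bar>s\<bar>" for s
  proof -
    have "\<bar>(\<integral>w. T (P w) * sin (s * T (P w)) \<partial>M) - v * (\<integral>w. cos (s * T (P w)) * s \<partial>M)\<bar>
        \<le> \<bar>s\<bar> * (real k * (1 + 2508 * real k ^ 4)) / N"
      by (rule stein[where h = "\<lambda>x. sin (s * x)" and h' = "\<lambda>x. cos (s * x) * s"])
        (auto intro!: derivative_eq_intros continuous_intros simp: abs_mult mult_left_le_one_le)
    then show ?thesis by (simp add: D_def mult_ac)
  qed
  have b2: "\<bar>(\<integral>w. T (P w) * cos (s * T (P w)) \<partial>M) + v * s * (\<integral>w. sin (s * T (P w)) \<partial>M)\<bar>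
      \<le> D * \<bar>s\<bar>" for s
  proof -
    have "\<bar>(\<integral>w. T (P w) * cos (s * T (P w)) \<partial>M) - v * (\<integral>w. - (sin (s * T (P w)) * s) \<partial>M)\<bar>
        \<le> \<bar>s\<bar> * (real k * (1 + 2508 * real k ^ 4)) / N"
      by (rule stein[where h = "\<lambda>x. cos (s * x)" and h' = "\<lambda>x. - (sin (s * x) * s)"])
        (auto intro!: derivative_eq_intros continuous_intros simp: abs_mult mult_left_le_one_le)
    then show ?thesis by (simp add: D_def mult_ac)
  qed
  show "\<bar>(\<integral>w. cos (t * T (P w)) \<partial>M) - exp (- (v * t\<^sup>2 / 2))\<bar> \<le> D * t\<^sup>2"
    using gaussian_ode_bound[OF c b1 v, of t] by (simp add: prob_space)
  show "\<bar>\<integral>w. sin (t * T (P w)) \<partial>M\<bar> \<le> D * t\<^sup>2"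
    using gaussian_ode_bound[OF s b2 v, of t] by simp
qed

lemma char_bound:
  assumes v: "0 \<le> v"
  shows "norm (char (distr M borel (\<lambda>w. T (P w) / \<sigma>)) t - of_real (exp (- (v * (t / \<sigma>)\<^sup>2 / 2))))
    \<le> 2 * (real k * (1 + 2508 * real k ^ 4) / N) * (t / \<sigma>)\<^sup>2"
proof -
  define s where "s = t / \<sigma>"
  have [measurable]: "(\<lambda>w. T (P w)) \<in> borel_measurable M" by simp
  have ic: "integrable M (\<lambda>w. cos (s * T (P w)))" and isn: "integrable M (\<lambda>w. sin (s * T (P w)))"
    by (rule integrable_const_bound[of _ 1]; simp)+
  have "char (distr M borel (\<lambda>w. T (P w) / \<sigma>)) t = (\<integral>w. iexp (s * T (P w)) \<partial>M)"
    unfolding char_def s_def by (subst integral_distr) simp_all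
  also have "\<dots> = (\<integral>w. of_real (cos (s * T (P w))) + \<i> * of_real (sin (s * T (P w))) \<partial>M)"
    by (intro Bochner_Integration.integral_cong refl) (simp only: exp_Euler cos_of_real sin_of_real)
  also have "\<dots> = of_real (\<integral>w. cos (s * T (P w)) \<partial>M) + \<i> * of_real (\<integral>w. sin (s * T (P w)) \<partial>M)"
    using ic isn by simp
  finally have "char (distr M borel (\<lambda>w. T (P w) / \<sigma>)) t - of_real (exp (- (v * s\<^sup>2 / 2)))
      = of_real ((\<integral>w. cos (s * T (P w)) \<partial>M) - exp (- (v * s\<^sup>2 / 2)))
        + \<i> * of_real (\<integral>w. sin (s * T (P w)) \<partial>M)"
    by simp
  then have "norm (char (distr M borel (\<lambda>w. T (P w) / \<sigma>)) t - of_real (exp (- (v * s\<^sup>2 / 2))))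
      \<le> \<bar>(\<integral>w. cos (s * T (P w)) \<partial>M) - exp (- (v * s\<^sup>2 / 2))\<bar> + \<bar>\<integral>w. sin (s * T (P w)) \<partial>M\<bar>"
    using norm_triangle_ineq[of "of_real ((\<integral>w. cos (s * T (P w)) \<partial>M) - exp (- (v * s\<^sup>2 / 2))) :: complex"
        "\<i> * of_real (\<integral>w. sin (s * T (P w)) \<partial>M)"]
    by (simp add: norm_mult del: of_real_diff)
  then show ?thesis
    using cos_sin_bound[OF v, of s] unfolding s_def[symmetric] by linarith
qed

end

section \<open>The asymptotic variance\<close>

definition b_of :: "nat \<Rightarrow> nat \<Rightarrow> (nat \<Rightarrow> nat) \<Rightarrow> real" where
  "b_of n k d = (\<Sum>i<k. \<Sum>j\<in>{..<k} - {i}. real (d i) * real (d j) * (real n - 1 - real (d i))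
     * (real n - 1 - real (d j)) / (real n - 1) ^ 4)"

definition b_lim :: "nat \<Rightarrow> (nat \<Rightarrow> real) \<Rightarrow> real" where
  "b_lim k y = (\<Sum>i<k. \<Sum>j\<in>{..<k} - {i}. y i * y j * (1 - y i) * (1 - y j))"

lemma b_lim_pos:
  assumes "2 \<le> k" "\<And>i. i < k \<Longrightarrow> 0 < y i \<and> y i < 1"
  shows "0 < b_lim k y"
  unfolding b_lim_def
proof (intro sum_pos)
  fix i j assume "i \<in> {..<k}" "j \<in> {..<k} - {i}"
  then show "0 < y i * y j * (1 - y i) * (1 - y j)"
    using assms(2)[of i] assms(2)[of j] by simp
next
  fix i assume "i \<in> {..<k}"
  have "(if i = 0 then 1 else 0) \<in> {..<k} - {i}" using assms(1) by auto
  then show "{..<k} - {i} \<noteq> {}" by blast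
qed (use assms(1) in \<open>auto simp: lessThan_empty_iff\<close>)

lemma ratio_limit:
  assumes "(\<lambda>n. real (d n) / real n) \<longlonglongrightarrow> y"
  shows "(\<lambda>n. real (d n) / (real n - 1)) \<longlonglongrightarrow> y"
proof -
  have "(\<lambda>n. real n / (real n - 1)) \<longlonglongrightarrow> 1" by real_asymp
  from tendsto_mult[OF assms this]
  have "(\<lambda>n. real (d n) / real n * (real n / (real n - 1))) \<longlonglongrightarrow> y" by simp
  moreover have "eventually (\<lambda>n. real (d n) / real n * (real n / (real n - 1))
      = real (d n) / (real n - 1)) sequentially"
    using eventually_gt_at_top[of 0] by eventually_elim simp
  ultimately show ?thesis by (rule Lim_transform_eventually)
qed

lemma b_limit:
  assumes "\<And>i. i < k \<Longrightarrow> (\<lambda>n. real (d n i) / real n) \<longlonglongrightarrow> y i"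
  shows "(\<lambda>n. b_of n k (d n)) \<longlonglongrightarrow> b_lim k y"
proof -
  define x where "x n i = real (d n i) / (real n - 1)" for n i
  have x: "(\<lambda>n. x n i) \<longlonglongrightarrow> y i" if "i < k" for i
    unfolding x_def by (rule ratio_limit[OF assms[OF that]])
  have "(\<lambda>n. \<Sum>i<k. \<Sum>j\<in>{..<k} - {i}. x n i * x n j * (1 - x n i) * (1 - x n j)) \<longlonglongrightarrow> b_lim k y"
    unfolding b_lim_def by (intro tendsto_intros x) auto
  moreover have "eventually (\<lambda>n. (\<Sum>i<k. \<Sum>j\<in>{..<k} - {i}. x n i * x n j * (1 - x n i) * (1 - x n j))
      = b_of n k (d n)) sequentially"
    using eventually_gt_at_top[of 1]
  proof eventually_elim
    case (elim n)
    then have N: "real n - 1 \<noteq> 0" by simp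
    have "x n i * x n j * (1 - x n i) * (1 - x n j) = real (d n i) * real (d n j)
        * (real n - 1 - real (d n i)) * (real n - 1 - real (d n j)) / (real n - 1) ^ 4" for i j
    proof -
      have "1 - x n i = (real n - 1 - real (d n i)) / (real n - 1)" for i
        using N by (simp add: x_def diff_divide_distrib)
      then show ?thesis by (simp add: x_def power4_eq_xxxx)
    qed
    then show ?case unfolding b_of_def by simp
  qed
  ultimately show ?thesis by (rule Lim_transform_eventually)
qed

text \<open>In the ratios x_i = d_i / N the approximate variance is a polynomial up to factors
  tending to 1 and terms tending to 0. The limit factorises because the double sum \<open>s\<close>
  and q^2 differ only on the diagonal, by y_i - y_i^2.\<close>

lemma v_limit:
  assumes "\<And>i. i < k \<Longrightarrow> (\<lambda>n. real (d n i) / real n) \<longlonglongrightarrow> y i"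
  shows "(\<lambda>n. v_of n k (d n)) \<longlonglongrightarrow> b_lim k y"
proof -
  define x where "x n i = real (d n i) / (real n - 1)" for n i
  have x: "(\<lambda>n. x n i) \<longlonglongrightarrow> y i" if "i < k" for i
    unfolding x_def by (rule ratio_limit[OF assms[OF that]])
  define q where "q z j = (\<Sum>i\<in>{..<k} - {j}. z i)" for z :: "nat \<Rightarrow> real" and j
  define s where "s z j = (\<Sum>i\<in>{..<k} - {j}. \<Sum>l\<in>{..<k} - {j}. if i = l then z i else z i * z l)"
    for z :: "nat \<Rightarrow> real" and j
  have ql: "(\<lambda>n. q (x n) j) \<longlonglongrightarrow> q y j" for j
    unfolding q_def by (intro tendsto_intros x) auto
  have sl: "(\<lambda>n. s (x n) j) \<longlonglongrightarrow> s y j" for j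
    unfolding s_def
  proof (intro tendsto_sum)
    fix i l assume "i \<in> {..<k} - {j}" "l \<in> {..<k} - {j}"
    then show "(\<lambda>n. if i = l then x n i else x n i * x n l) \<longlonglongrightarrow> (if i = l then y i else y i * y l)"
      by (cases "i = l") (auto intro!: tendsto_intros x)
  qed
  have i1: "(\<lambda>n. 1 / (real n - 1)) \<longlonglongrightarrow> 0" by real_asymp
  have i2: "(\<lambda>n. (real n - 1) / real n) \<longlonglongrightarrow> 1" by real_asymp
  have "(\<lambda>n. \<Sum>j<k. x n j * s (x n) j - (real n - 1) / real n
      * ((x n j + 1 / (real n - 1)) * (x n j * s (x n) j) - (x n j * q (x n) j)\<^sup>2
          + q (x n) j * (x n j * q (x n) j))) \<longlonglongrightarrow>
      (\<Sum>j<k. y j * s y j - 1 * ((y j + 0) * (y j * s y j) - (y j * q y j)\<^sup>2 + q y j * (y j * q y j)))"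
    by (intro tendsto_intros x ql sl i1 i2) auto
  also have "(\<Sum>j<k. y j * s y j - 1 * ((y j + 0) * (y j * s y j) - (y j * q y j)\<^sup>2 + q y j * (y j * q y j)))
      = b_lim k y"
    unfolding b_lim_def
  proof (rule sum.cong)
    fix j assume "j \<in> {..<k}"
    let ?I = "{..<k} - {j}"
    have "s y j - (q y j)\<^sup>2 = (\<Sum>i\<in>?I. \<Sum>l\<in>?I. if i = l then y i - y i * y i else 0)"
      unfolding s_def q_def power2_eq_square sum_product sum_subtractf[symmetric]
      by (intro sum.cong) auto
    also have "\<dots> = (\<Sum>i\<in>?I. y i * (1 - y i))"
      by (simp add: algebra_simps)
    finally have sq: "s y j - (q y j)\<^sup>2 = (\<Sum>i\<in>?I. y i * (1 - y i))" .
    have "y j * s y j - 1 * ((y j + 0) * (y j * s y j) - (y j * q y j)\<^sup>2 + q y j * (y j * q y j))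
        = y j * (1 - y j) * (s y j - (q y j)\<^sup>2)"
      by (simp add: algebra_simps power2_eq_square)
    also have "\<dots> = (\<Sum>i\<in>?I. y j * y i * (1 - y j) * (1 - y i))"
      unfolding sq sum_distrib_left by (intro sum.cong) (simp_all add: mult_ac)
    finally show "y j * s y j - 1 * ((y j + 0) * (y j * s y j) - (y j * q y j)\<^sup>2 + q y j * (y j * q y j))
        = (\<Sum>i\<in>?I. y j * y i * (1 - y j) * (1 - y i))" .
  qed simp
  finally have lim: "(\<lambda>n. \<Sum>j<k. x n j * s (x n) j - (real n - 1) / real n
      * ((x n j + 1 / (real n - 1)) * (x n j * s (x n) j) - (x n j * q (x n) j)\<^sup>2
          + q (x n) j * (x n j * q (x n) j))) \<longlonglongrightarrow> b_lim k y" .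
  moreover have "eventually (\<lambda>n. (\<Sum>j<k. x n j * s (x n) j - (real n - 1) / real n
      * ((x n j + 1 / (real n - 1)) * (x n j * s (x n) j) - (x n j * q (x n) j)\<^sup>2
          + q (x n) j * (x n j * q (x n) j))) = v_of n k (d n)) sequentially"
    using eventually_gt_at_top[of 1]
  proof eventually_elim
    case (elim n)
    define N where "N = real n - 1"
    have N: "N \<noteq> 0" "real n \<noteq> 0" using elim by (auto simp: N_def)
    have xd: "real (d n i) = N * x n i" for i using N by (simp add: x_def N_def)
    have q: "q0_of k (d n) j = N * q (x n) j" for j
      unfolding q0_of_def q_def xd sum_distrib_left ..
    have m: "mean2_of n (d n) i l = N * (x n i * x n l)" for i l
      unfolding mean2_of_def xd N_def[symmetric] using N by simp
    have s: "s0_of n k (d n) j = N * s (x n) j" for j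
      unfolding s0_of_def s_def m xd sum_distrib_left by (intro sum.cong) auto
    have r: "r0_of n k (d n) j = N\<^sup>2 * ((x n j + 1 / N) * (x n j * s (x n) j) - (x n j * q (x n) j)\<^sup>2
          + q (x n) j * (x n j * q (x n) j))" for j
      unfolding r0_of_def q s xd N_def[symmetric] using N by (simp add: field_simps power2_eq_square)
    have "v0_of n k (d n) j / N = x n j * s (x n) j - N / real n
      * ((x n j + 1 / N) * (x n j * s (x n) j) - (x n j * q (x n) j)\<^sup>2
          + q (x n) j * (x n j * q (x n) j))" for j
      unfolding v0_of_def r s xd N_def[symmetric] diff_divide_distrib
      using N by (simp add: power2_eq_square)
    then show ?case
      unfolding v_of_def N_def[symmetric] sum_divide_distrib by simp
  qed
  ultimately show ?thesis by (rule Lim_transform_eventually)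
qed

text \<open>As \<open>v_of\<close> and \<open>b_of\<close> share the positive limit
  \<open>b_lim\<close>, the exponent tends to - t^2 / 2, while the error in
  \<open>char_bound\<close> is O(1/N).\<close>

theorem block_model_char_limit:
  fixes M :: "nat \<Rightarrow> 'a measure"
  assumes model: "eventually (\<lambda>n. block_model (M n) n k (P n) (d n)) sequentially"
    and k: "2 \<le> k" and y: "\<And>i. i < k \<Longrightarrow> 0 < y i \<and> y i < 1"
    and lim: "\<And>i. i < k \<Longrightarrow> (\<lambda>n. real (d n i) / real n) \<longlonglongrightarrow> y i"
  shows "(\<lambda>n. char (distr (M n) borel (\<lambda>w. block_model.T n k (d n) (P n w) / sqrt (b_of n k (d n)))) t)
    \<longlonglongrightarrow> of_real (exp (- (t\<^sup>2 / 2)))"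
proof -
  have b0: "0 < b_lim k y" using k y by (rule b_lim_pos)
  let ?e = "\<lambda>n. exp (- (v_of n k (d n) * (t / sqrt (b_of n k (d n)))\<^sup>2 / 2))"
  let ?D = "\<lambda>n. 2 * (real k * (1 + 2508 * real k ^ 4) * (1 / (real n - 1))) * (t / sqrt (b_of n k (d n)))\<^sup>2"
  have ts: "(\<lambda>n. t / sqrt (b_of n k (d n))) \<longlonglongrightarrow> t / sqrt (b_lim k y)"
    using b0 by (intro tendsto_intros b_limit lim) auto
  have "?e \<longlonglongrightarrow> exp (- (b_lim k y * (t / sqrt (b_lim k y))\<^sup>2 / 2))"
    by (intro tendsto_intros v_limit lim ts) auto
  then have e: "?e \<longlonglongrightarrow> exp (- (t\<^sup>2 / 2))"
    using b0 by (simp add: power_divide)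
  have "(\<lambda>n. 1 / (real n - 1)) \<longlonglongrightarrow> 0" by real_asymp
  then have "?D \<longlonglongrightarrow> 2 * (real k * (1 + 2508 * real k ^ 4) * 0) * (t / sqrt (b_lim k y))\<^sup>2"
    by (intro tendsto_intros ts)
  then have D: "?D \<longlonglongrightarrow> 0" by simp
  have "eventually (\<lambda>n. 0 < v_of n k (d n)) sequentially"
    using order_tendstoD(1)[OF v_limit[OF lim] b0] .
  with model have "eventually (\<lambda>n. norm (char (distr (M n) borel
      (\<lambda>w. block_model.T n k (d n) (P n w) / sqrt (b_of n k (d n)))) t - of_real (?e n)) \<le> ?D n) sequentially"
  proof eventually_elim
    case (elim n)
    then interpret block_model "M n" n k "P n" "d n" by simp
    show ?case using char_bound[of "sqrt (b_of n k (d n))" t] elim(2) by simp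
  qed
  then have "(\<lambda>n. char (distr (M n) borel
      (\<lambda>w. block_model.T n k (d n) (P n w) / sqrt (b_of n k (d n)))) t - of_real (?e n)) \<longlonglongrightarrow> 0"
    by (rule Lim_null_comparison[OF _ D])
  from tendsto_add[OF this tendsto_of_real[OF e]] show ?thesis by simp
qed

section \<open>Square roots of positive semidefinite matrices\<close>

text \<open>The quadratic form of a matrix, evaluated on all columns of X at once.\<close>

definition qf :: "fmat \<Rightarrow> fmat \<Rightarrow> real" where
  "qf A X = tr (tp X * (A * X))"

lemma qf_arith:
  "qf (A + B) X = qf A X + qf B X" "qf (A - B) X = qf A X - qf B X" "qf (r *\<^sub>R A) X = r * qf A X"
  by (simp_all add: qf_def algebra_simps)

lemma qf_idm: "fits d X \<Longrightarrow> qf (idm d) X = fro2 X"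
  by (simp add: qf_def fro2_def)

lemma qf_diff:
  assumes "tp A = A"
  shows "qf A (X - Z) = qf A X - 2 * tr (tp Z * (A * X)) + qf A Z"
proof -
  have "tr (tp X * (A * Z)) = tr (tp Z * (A * X))"
    using tr_tp[of "tp X * (A * Z)"] assms by (simp add: mult.assoc)
  then show ?thesis
    by (simp add: qf_def left_diff_distrib right_diff_distrib)
qed

lemma fro2_mult_le: "fro2 (A * B) \<le> fro2 A * fro2 B"
proof -
  obtain n where n: "fits n A" "fits n B" by (rule fits_common[of A B A])
  have "fro2 (A * B) = (\<Sum>a<n. \<Sum>b<n. (\<Sum>c<n. ent A a c * ent B c b)\<^sup>2)"
    by (simp add: fro2_eq[OF fits_mult[OF n]] ent_mult_left[OF n(1)])
  also have "\<dots> \<le> (\<Sum>a<n. \<Sum>b<n. (\<Sum>c<n. (ent A a c)\<^sup>2) * (\<Sum>c<n. (ent B c b)\<^sup>2))"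
    by (intro sum_mono Cauchy_Schwarz_ineq_sum)
  also have "\<dots> = fro2 A * (\<Sum>b<n. \<Sum>c<n. (ent B c b)\<^sup>2)"
    unfolding fro2_eq[OF n(1)] by (rule sum_product[symmetric])
  also have "(\<Sum>b<n. \<Sum>c<n. (ent B c b)\<^sup>2) = fro2 B"
    unfolding fro2_eq[OF n(2)] by (rule sum.swap)
  finally show ?thesis .
qed

lemma fro2_zero [simp]: "fro2 0 = 0"
  by (simp add: fro2_def)

lemma fro2_eq_zero:
  assumes "fro2 A = 0"
  shows "A = 0"
proof (rule fmat_eqI)
  fix a b
  have "(ent A a b)\<^sup>2 \<le> fro2 A"
  proof (cases "a < fdim A \<and> b < fdim A")
    case True
    have "(ent A a b)\<^sup>2 \<le> (\<Sum>b<fdim A. (ent A a b)\<^sup>2)"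
      using True by (intro member_le_sum) auto
    also have "\<dots> \<le> fro2 A"
      unfolding fro2_eq[OF fits_fdim] using True
      by (intro member_le_sum[where f = "\<lambda>a. \<Sum>b<fdim A. (ent A a b)\<^sup>2"]) (auto intro: sum_nonneg)
    finally show ?thesis .
  next
    case False
    then have "ent A a b = 0" using fits_fdim[of A] by (auto simp: fits_def not_less)
    then show ?thesis by simp
  qed
  then show "ent A a b = ent 0 a b" using assms by (simp add: ent_ring)
qed

text \<open>\<open>B\<close> lies between 0 and the identity in the Loewner order. Testing on
  matrices X amounts to testing on vectors, column by column.\<close>

definition contr :: "nat \<Rightarrow> fmat \<Rightarrow> bool" where
  "contr d B \<longleftrightarrow> fits d B \<and> tp B = B \<and> (\<forall>X. fits d X \<longrightarrow> 0 \<le> qf B X \<and> qf B X \<le> fro2 X)"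

text \<open>Expand 0 \<le> \<open>qf B (X - B * X)\<close> and bound both remaining forms of
  \<open>B\<close> by squared norms.\<close>

lemma contr_fro2:
  assumes "contr d B" "fits d X"
  shows "fro2 (B * X) \<le> fro2 X"
proof -
  have B: "fits d B" "tp B = B" "\<And>X. fits d X \<Longrightarrow> 0 \<le> qf B X" "\<And>X. fits d X \<Longrightarrow> qf B X \<le> fro2 X"
    using assms(1) by (auto simp: contr_def)
  have f: "fits d (B * X)" using B(1) assms(2) by (rule fits_mult)
  have "tr (tp (B * X) * (B * X)) = fro2 (B * X)" by (simp add: fro2_def)
  then have "0 \<le> qf B X - 2 * fro2 (B * X) + qf B (B * X)"
    using B(3)[OF fits_arith(3)[OF assms(2) f]] qf_diff[OF B(2), of X "B * X"] by simp
  then show ?thesis using B(4)[OF assms(2)] B(4)[OF f] by linarith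
qed

text \<open>The exponent is shifted: \<open>pw B m\<close> is the power m + 1 of \<open>B\<close>,
  because the ring has no unit.\<close>

fun pw :: "fmat \<Rightarrow> nat \<Rightarrow> fmat" where
  "pw B 0 = B"
| "pw B (Suc m) = B * pw B m"

lemma pw_mult: "pw B m * pw B l = pw B (Suc (m + l))"
  by (induction m) (auto simp: mult.assoc)

text \<open>The polynomials in \<open>B\<close> with nonnegative coefficients and no constant term.
  They commute, are closed under products and, for a contraction, are positive semidefinite, so
  membership serves as a certificate of positivity.\<close>

inductive_set pcone :: "fmat \<Rightarrow> fmat set" for B where
  power: "pw B m \<in> pcone B"
| add: "X \<in> pcone B \<Longrightarrow> Y \<in> pcone B \<Longrightarrow> X + Y \<in> pcone B"
| scale: "X \<in> pcone B \<Longrightarrow> 0 \<le> c \<Longrightarrow> c *\<^sub>R X \<in> pcone B"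

lemma pcone_mult:
  assumes "X \<in> pcone B" "Y \<in> pcone B"
  shows "X * Y \<in> pcone B"
proof -
  have 1: "X * pw B m \<in> pcone B" for m
    using assms(1) by induction (auto simp: pw_mult distrib_right simp del: pw.simps intro: pcone.intros)
  show ?thesis
    using assms(2) by induction (auto simp: distrib_left intro: pcone.intros 1)
qed

lemma pcone_commute:
  assumes "X \<in> pcone B" "Y \<in> pcone B"
  shows "X * Y = Y * X"
proof -
  have 1: "X * pw B m = pw B m * X" for m
    using assms(1) by induction (auto simp: pw_mult distrib_right distrib_left add.commute)
  show ?thesis
    using assms(2) by induction (auto simp: distrib_left distrib_right 1)
qed

text \<open>A power of \<open>B\<close> is \<open>B\<close> itself, its square, or
  \<open>B * C * B\<close> with a power \<open>C\<close> two steps lower; hence the induction that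
  descends by two.\<close>

lemma pcone_psd:
  assumes B: "contr d B" and "Y \<in> pcone B"
  shows "fits d Y" "tp Y = Y" "fits d X \<Longrightarrow> 0 \<le> qf Y X"
proof -
  have c: "fits d B" "tp B = B" "\<And>X. fits d X \<Longrightarrow> 0 \<le> qf B X"
    using B by (auto simp: contr_def)
  have f: "fits d (pw B m)" for m by (induction m) (auto simp: c fits_mult)
  have comm: "pw B m * B = B * pw B m" for m
    by (induction m) (auto simp: mult.assoc)
  have t: "tp (pw B m) = pw B m" for m
    by (induction m) (auto simp: c comm)
  have q: "fits d X \<Longrightarrow> 0 \<le> qf (pw B m) X" for m X
  proof (induction m arbitrary: X rule: less_induct)
    case (less m)
    consider "m = 0" | "m = 1" | l where "m = Suc (Suc l)"
      by (metis One_nat_def not0_implies_Suc)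
    then show ?case
    proof cases
      case 1 then show ?thesis using c(3)[OF less.prems] by simp
    next
      case 2
      then have "qf (pw B m) X = fro2 (B * X)"
        by (simp add: qf_def fro2_def c mult.assoc)
      then show ?thesis by simp
    next
      case 3
      have "qf (pw B m) X = qf (pw B l) (B * X)"
        by (simp add: 3 qf_def c mult.assoc) (metis comm mult.assoc)
      then show ?thesis
        using less.IH[of l "B * X"] 3 fits_mult[OF c(1) less.prems] by simp
    qed
  qed
  show "fits d Y" using assms(2) by induction (auto simp: f fits_arith)
  show "tp Y = Y" using assms(2) by induction (auto simp: t)
  show "fits d X \<Longrightarrow> 0 \<le> qf Y X"
    using assms(2) by induction (auto simp: q qf_arith)
qed

text \<open>Visser iteration: the limit $L$ of this increasing sequence solves $2L = B + L^2$,
  that is, $(1 - L)^2 = 1 - B$.\<close>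

primrec visser :: "fmat \<Rightarrow> nat \<Rightarrow> fmat" where
  "visser B 0 = 0"
| "visser B (Suc m) = (1/2) *\<^sub>R (B + visser B m * visser B m)"

lemma visser_pcone: "visser B (Suc m) \<in> pcone B"
proof (induction m)
  case 0
  have "B \<in> pcone B" using pcone.power[of B 0] by simp
  then show ?case by (auto intro: pcone.scale)
next
  case (Suc m)
  have "B \<in> pcone B" using pcone.power[of B 0] by simp
  then have "(1/2) *\<^sub>R (B + visser B (Suc m) * visser B (Suc m)) \<in> pcone B"
    using Suc by (intro pcone.scale pcone.add pcone_mult) auto
  then show ?case by (simp only: visser.simps(2)[of B "Suc m"])
qed

text \<open>For consecutive iterates Y and X the next increment is half of (X + Y)(X - Y), a product
  of two elements of the cone.\<close>

lemma visser_increasing: "visser B (Suc m) - visser B m \<in> pcone B"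
proof (induction m)
  case 0
  show ?case using visser_pcone[of B 0] by simp
next
  case (Suc m)
  define X Y where "X = visser B (Suc m)" and "Y = visser B m"
  have X: "X \<in> pcone B" "X - Y \<in> pcone B" using Suc visser_pcone by (auto simp: X_def Y_def)
  have XY: "X + Y \<in> pcone B"
  proof (cases m)
    case 0 then show ?thesis using X by (simp add: Y_def)
  next
    case (Suc l) then show ?thesis using X visser_pcone[of B l] by (auto simp: Y_def intro: pcone.add)
  qed
  have comm: "Y * X = X * Y" using pcone_commute[OF X(1) X(2)] by (simp add: algebra_simps)
  have "visser B (Suc (Suc m)) = (1/2) *\<^sub>R (B + X * X)" "X = (1/2) *\<^sub>R (B + Y * Y)"
    by (simp_all add: X_def Y_def)
  then have "visser B (Suc (Suc m)) - X = (1/2) *\<^sub>R (B + X * X) - (1/2) *\<^sub>R (B + Y * Y)"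
    by simp
  also have "\<dots> = (1/2) *\<^sub>R ((X + Y) * (X - Y))"
    by (simp add: algebra_simps comm)
  finally show ?case
    using X XY unfolding X_def[symmetric] by (auto intro!: pcone.scale pcone_mult)
qed

lemma visser_fits: "contr d B \<Longrightarrow> fits d (visser B m) \<and> tp (visser B m) = visser B m"
  using pcone_psd(1,2)[OF _ visser_pcone, of d B "m - 1"] by (cases m) (auto simp: fits_arith)

lemma visser_fro2:
  assumes "contr d B" "fits d X"
  shows "fro2 (visser B m * X) \<le> fro2 X"
  using assms(2)
proof (induction m arbitrary: X)
  case (Suc m)
  let ?Y = "visser B m"
  have f: "fits d (?Y * X)" using visser_fits[OF assms(1), of m] Suc.prems by (simp add: fits_mult)
  have "fro2 (visser B (Suc m) * X) = (1/2)\<^sup>2 * fro2 (B * X + ?Y * (?Y * X))"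
    by (simp add: fro2_scaleR[symmetric] distrib_right mult.assoc)
  also have "\<dots> \<le> (1/2)\<^sup>2 * (2 * fro2 (B * X) + 2 * fro2 (?Y * (?Y * X)))"
    by (intro mult_left_mono fro2_add_le) auto
  also have "\<dots> \<le> (1/2)\<^sup>2 * (2 * fro2 X + 2 * fro2 X)"
    using contr_fro2[OF assms(1) Suc.prems] Suc.IH[OF f] Suc.IH[OF Suc.prems]
    by (intro mult_left_mono) auto
  finally show ?case by (simp add: power2_eq_square)
qed simp

section \<open>Convergence of the iteration\<close>

lemma qf_le_fro2: "fro2 (A * X) \<le> fro2 X \<Longrightarrow> qf A X \<le> fro2 X"
  unfolding qf_def using tr_le_fro2[of X "A * X"] by linarith

text \<open>A basis vector stored in column 0 of a square matrix, so that \<open>qf\<close> can be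
  evaluated on it. Polarisation over these recovers the entries of a symmetric matrix from its
  form.\<close>

definition unit_col :: "nat \<Rightarrow> nat \<Rightarrow> fmat" where
  "unit_col d a = fcut d d (\<lambda>r s. if r = a \<and> s = 0 then 1 else 0)"

lemma ent_polar:
  assumes A: "fits d A" "tp A = A" and ab: "a < d" "b < d"
  shows "ent A a b = (qf A (unit_col d a + unit_col d b) - qf A (unit_col d a - unit_col d b)) / 4"
proof -
  let ?a = "unit_col d a" and ?b = "unit_col d b"
  have f: "fits d ?a" "fits d ?b" by (simp_all add: unit_col_def)
  have d: "0 < d" using ab by simp
  have "tr (tp ?a * (A * ?b)) = (\<Sum>s<d. \<Sum>c<d. ent ?a c s * (\<Sum>e<d. ent A c e * ent ?b e s))"
    using A f by (simp add: tr_eq[of d] fits_mult ent_mult_left[of d] ent_tp)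
  also have "\<dots> = (\<Sum>c<d. ent ?a c 0 * (\<Sum>e<d. ent A c e * ent ?b e 0))"
  proof -
    define F where "F s = (\<Sum>c<d. ent ?a c s * (\<Sum>e<d. ent A c e * ent ?b e s))" for s
    have "F s = (if s = 0 then F 0 else 0)" for s
    proof -
      have "ent ?a c s = 0" if "s \<noteq> 0" for c using that by (simp add: unit_col_def ent_fcut)
      then show ?thesis by (simp add: F_def)
    qed
    then have "(\<Sum>s<d. F s) = (\<Sum>s<d. if s = 0 then F 0 else 0)"
      by (intro sum.cong refl)
    then show ?thesis using d by (simp add: F_def)
  qed
  also have "\<dots> = (\<Sum>c<d. (if a = c then 1 else 0) * (\<Sum>e<d. ent A c e * (if e = b then 1 else 0)))"
    using d by (intro sum.cong refl arg_cong2[where f = "(*)"]) (auto simp: unit_col_def ent_fcut)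
  also have "\<dots> = ent A a b"
    using ab by (simp add: sum_delta_mult)
  finally have 1: "tr (tp ?a * (A * ?b)) = ent A a b" .
  have 2: "tr (tp ?b * (A * ?a)) = tr (tp ?a * (A * ?b))"
    using tr_tp[of "tp ?a * (A * ?b)"] A by (simp add: mult.assoc)
  show ?thesis
    unfolding qf_def by (simp add: distrib_left distrib_right left_diff_distrib right_diff_distrib 2 1)
qed

text \<open>The iterates increase in the Loewner order and are bounded by the identity, so every
  quadratic form converges and, by polarisation, every entry. The root is the identity minus the
  limit and inherits the bounds 0 and 1.\<close>

lemma psd_sqrt:
  assumes B: "contr d B"
  obtains R where "fits d R" "tp R = R" "R * R = idm d - B"
    "\<And>X. fits d X \<Longrightarrow> 0 \<le> qf R X" "\<And>X. fits d X \<Longrightarrow> qf R X \<le> fro2 X"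
proof -
  let ?Y = "visser B"
  note f = visser_fits[OF B]
  have mono: "qf (?Y m) X \<le> qf (?Y (Suc m)) X" if "fits d X" for m X
    using pcone_psd(3)[OF B visser_increasing that, of m] by (simp add: qf_arith del: visser.simps)
  have bd: "qf (?Y m) X \<le> fro2 X" if "fits d X" for m X
    using visser_fro2[OF B that] by (rule qf_le_fro2)
  have conv: "convergent (\<lambda>m. qf (?Y m) X)" if X: "fits d X" for X
  proof -
    obtain L where "(\<lambda>m. qf (?Y m) X) \<longlonglongrightarrow> L"
      by (rule incseq_convergent[of "\<lambda>m. qf (?Y m) X" "fro2 X"])
        (auto intro: incseq_SucI mono[OF X] bd[OF X] simp del: visser.simps)
    then show ?thesis by (auto simp: convergent_def)
  qed
  have "convergent (\<lambda>m. ent (?Y m) a b)" for a b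
  proof (cases "a < d \<and> b < d")
    case True
    have u: "fits d (unit_col d a + unit_col d b)" "fits d (unit_col d a - unit_col d b)"
      by (simp_all add: unit_col_def fits_arith)
    have "convergent (\<lambda>m. (qf (?Y m) (unit_col d a + unit_col d b)
        - qf (?Y m) (unit_col d a - unit_col d b)) * (1 / 4))"
      by (intro convergent_mult convergent_diff conv u convergent_const)
    moreover have "ent (?Y m) a b = (qf (?Y m) (unit_col d a + unit_col d b)
        - qf (?Y m) (unit_col d a - unit_col d b)) * (1 / 4)" for m
      using ent_polar[of d "?Y m" a b] f[of m] True by simp
    ultimately show ?thesis by (simp only:)
  next
    case False
    then have "ent (?Y m) a b = 0" for m using f[of m] by (auto simp: fits_def not_less)
    then show ?thesis by (simp add: convergent_const)
  qed
  then have lim: "(\<lambda>m. ent (?Y m) a b) \<longlonglongrightarrow> lim (\<lambda>m. ent (?Y m) a b)" for a b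
    by (simp add: convergent_LIMSEQ_iff)
  define L where "L = fcut d d (\<lambda>a b. lim (\<lambda>m. ent (?Y m) a b))"
  have fL: "fits d L" by (simp add: L_def)
  have L: "(\<lambda>m. ent (?Y m) a b) \<longlonglongrightarrow> ent L a b" for a b
  proof (cases "a < d \<and> b < d")
    case True then show ?thesis using lim by (simp add: L_def ent_fcut)
  next
    case False
    then have "ent (?Y m) a b = 0" "ent L a b = 0" for m
      using f[of m] fL by (auto simp: fits_def not_less)
    then show ?thesis by simp
  qed
  have LL: "(\<lambda>m. ent (?Y m * ?Y m) a b) \<longlonglongrightarrow> ent (L * L) a b" for a b
    using fL f by (simp add: ent_mult_left[of d]) (intro tendsto_intros L)
  have qL: "(\<lambda>m. qf (?Y m) X) \<longlonglongrightarrow> qf L X" if X: "fits d X" for X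
  proof -
    have "qf A X = (\<Sum>s<d. \<Sum>c<d. ent X c s * (\<Sum>e<d. ent A c e * ent X e s))" if "fits d A" for A
      using that X by (simp add: qf_def tr_eq[of d] fits_mult ent_mult_left[of d] ent_tp)
    then show ?thesis
      using f fL by (simp add: fits_def[symmetric]) (intro tendsto_intros L)
  qed
  have tL: "tp L = L"
  proof (rule fmat_eqI)
    fix a b
    have "ent (?Y m) b a = ent (?Y m) a b" for m
      using f[of m] ent_tp[of "?Y m" a b] by simp
    then show "ent (tp L) a b = ent L a b"
      using LIMSEQ_unique[OF L[of b a]] L[of a b] by (simp add: ent_tp)
  qed
  have eq: "L = (1/2) *\<^sub>R (B + L * L)"
  proof (rule fmat_eqI)
    fix a b
    have "(\<lambda>m. ent (?Y (Suc m)) a b) \<longlonglongrightarrow> 1/2 * (ent B a b + ent (L * L) a b)"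
      unfolding visser.simps ent_scaleR ent_ring by (intro tendsto_intros LL)
    moreover have "(\<lambda>m. ent (?Y (Suc m)) a b) \<longlonglongrightarrow> ent L a b"
      using L by (rule LIMSEQ_Suc)
    ultimately have "1/2 * (ent B a b + ent (L * L) a b) = ent L a b"
      by (rule LIMSEQ_unique)
    then show "ent L a b = ent ((1/2) *\<^sub>R (B + L * L)) a b"
      by (simp add: ent_scaleR ent_ring)
  qed
  have "2 *\<^sub>R L = B + L * L" by (subst eq) simp
  then have "L + L = B + L * L" by (simp add: scaleR_2)
  then have R: "(idm d - L) * (idm d - L) = idm d - B"
    using fL by (simp add: algebra_simps)
  have q0: "0 \<le> qf L X" if X: "fits d X" for X
  proof (rule LIMSEQ_le_const[OF qL[OF X]])
    have "0 \<le> qf (?Y (Suc m)) X" for m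
      using pcone_psd(3)[OF B visser_pcone X] .
    then show "\<exists>N. \<forall>m\<ge>N. 0 \<le> qf (?Y m) X"
      by (intro exI[of _ 1] allI impI) (metis One_nat_def Suc_le_D)
  qed
  have q1: "qf L X \<le> fro2 X" if X: "fits d X" for X
    using bd[OF X] by (intro LIMSEQ_le_const2[OF qL[OF X]]) auto
  show ?thesis
    by (rule that[of "idm d - L"]) (use fL tL R q0 q1 in \<open>auto simp: fits_arith qf_arith qf_idm\<close>)
qed

lemma psd_qf_zero:
  assumes R: "fits d R" "tp R = R" "\<And>X. fits d X \<Longrightarrow> qf R X \<le> fro2 X"
      "\<And>X. fits d X \<Longrightarrow> 0 \<le> qf R X"
    and X: "fits d X" "qf R X = 0"
  shows "R * X = 0"
proof -
  have f: "fits d (R * X)" using R X by (simp add: fits_mult)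
  have "0 \<le> qf R X - 2 * fro2 (R * X) + qf R (R * X)"
    using R(4)[OF fits_arith(3)[OF X(1) f]] qf_diff[OF R(2), of X "R * X"] by (simp add: fro2_def)
  then have "fro2 (R * X) \<le> 0" using R(3)[OF f] X(2) by linarith
  then have "fro2 (R * X) = 0" using fro2_nonneg[of "R * X"] by linarith
  then show ?thesis by (rule fro2_eq_zero)
qed

section \<open>The inverse square root\<close>

definition of_mat :: "real mat \<Rightarrow> fmat" where
  "of_mat A = fcut (dim_row A) (dim_col A) (\<lambda>a b. A $$ (a, b))"

definition to_mat :: "nat \<Rightarrow> fmat \<Rightarrow> real mat" where
  "to_mat d A = mat d d (\<lambda>(a, b). ent A a b)"

lemma to_mat_carrier [simp]: "to_mat d A \<in> carrier_mat d d"
  by (simp add: to_mat_def)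

lemma fits_of_mat: "A \<in> carrier_mat m n \<Longrightarrow> m \<le> k \<Longrightarrow> n \<le> k \<Longrightarrow> fits k (of_mat A)"
  by (auto simp: of_mat_def)

lemma of_mat_to_mat: "fits d A \<Longrightarrow> of_mat (to_mat d A) = A"
  by (rule fmat_eqI) (auto simp: of_mat_def to_mat_def ent_fcut fits_def not_less)

lemma to_mat_of_mat: "A \<in> carrier_mat d d \<Longrightarrow> to_mat d (of_mat A) = A"
  by (auto simp: of_mat_def to_mat_def ent_fcut)

lemma of_mat_inject: "A \<in> carrier_mat d d \<Longrightarrow> B \<in> carrier_mat d d \<Longrightarrow> of_mat A = of_mat B \<Longrightarrow> A = B"
  using to_mat_of_mat by metis

lemma of_mat_mult:
  assumes "A \<in> carrier_mat a b" "B \<in> carrier_mat b c"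
  shows "of_mat (A * B) = of_mat A * of_mat B"
proof (rule fmat_eqI)
  fix r s
  have f: "fits (a + b) (of_mat A)" "fits (b + c) (of_mat B)" using assms by (auto intro: fits_of_mat)
  have "ent (of_mat A * of_mat B) r s = (\<Sum>e<a + b. ent (of_mat A) r e * ent (of_mat B) e s)"
    by (rule ent_mult_left[OF f(1)])
  also have "\<dots> = (\<Sum>e<b. ent (of_mat A) r e * ent (of_mat B) e s)"
    using assms by (intro sum.mono_neutral_right) (auto simp: of_mat_def ent_fcut)
  also have "\<dots> = ent (of_mat (A * B)) r s"
    using assms by (auto simp: of_mat_def ent_fcut scalar_prod_def atLeast0LessThan intro!: sum.cong)
  finally show "ent (of_mat (A * B)) r s = ent (of_mat A * of_mat B) r s" by simp
qed

lemma of_mat_one: "of_mat (1\<^sub>m d) = idm d"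
  by (rule fmat_eqI) (auto simp: of_mat_def idm_def ent_fcut)

lemma of_mat_transpose: "of_mat (transpose_mat A) = tp (of_mat A)"
  by (rule fmat_eqI) (auto simp: of_mat_def ent_fcut ent_tp)

lemma of_mat_zero: "of_mat (0\<^sub>m d e) = 0"
  by (rule fmat_eqI) (auto simp: of_mat_def ent_fcut ent_ring)

lemma of_mat_smult: "of_mat (c \<cdot>\<^sub>m A) = c *\<^sub>R of_mat A"
  by (rule fmat_eqI) (auto simp: of_mat_def ent_fcut ent_scaleR)

lemma mat_trace_eq_tr: "A \<in> carrier_mat d d \<Longrightarrow> mat_trace A = tr (of_mat A)"
  using tr_eq[OF fits_of_mat[of A d d d]] by (auto simp: mat_trace_def of_mat_def ent_fcut)

text \<open>For singular G the inverse of the determinant is 0, so that finv is 0, in accordance with the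
  default value chosen for the inverse square root.\<close>

definition finv :: "nat \<Rightarrow> fmat \<Rightarrow> fmat" where
  "finv d G = inverse (det (to_mat d G)) *\<^sub>R of_mat (adj_mat (to_mat d G))"

lemma fits_finv: "fits d (finv d G)"
  unfolding finv_def using adj_mat(1)[of "to_mat d G" d] by (auto intro!: fits_arith fits_of_mat)

lemma finv_inverse:
  assumes "fits d G" "det (to_mat d G) \<noteq> 0"
  shows "finv d G * G = idm d" "G * finv d G = idm d"
proof -
  note a = adj_mat[OF to_mat_carrier[of d G]]
  have "of_mat (adj_mat (to_mat d G)) * G = det (to_mat d G) *\<^sub>R idm d"
    using of_mat_mult[OF a(1) to_mat_carrier[of d G]] a(3) assms(1) by (simp add: of_mat_smult of_mat_one of_mat_to_mat)
  then show "finv d G * G = idm d" using assms(2) by (simp add: finv_def)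
  have "G * of_mat (adj_mat (to_mat d G)) = det (to_mat d G) *\<^sub>R idm d"
    using of_mat_mult[OF to_mat_carrier[of d G] a(1)] a(2) assms(1) by (simp add: of_mat_smult of_mat_one of_mat_to_mat)
  then show "G * finv d G = idm d" using assms(2) by (simp add: finv_def)
qed

lemma finv_sym:
  assumes "fits d G" "tp G = G"
  shows "tp (finv d G) = finv d G" "finv d G * G * finv d G = finv d G"
proof -
  show "finv d G * G * finv d G = finv d G"
  proof (cases "det (to_mat d G) = 0")
    case False
    then show ?thesis using finv_inverse[OF assms(1)] fits_finv[of d G] by simp
  qed (simp add: finv_def)
  show "tp (finv d G) = finv d G"
  proof (cases "det (to_mat d G) = 0")
    case False
    note i = finv_inverse[OF assms(1) False]
    have "tp (finv d G) * G = idm d"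
      using arg_cong[OF i(2), of tp] assms(2) by simp
    then have "tp (finv d G) * (G * finv d G) = finv d G"
      using fits_finv[of d G] by (simp add: mult.assoc[symmetric])
    then show ?thesis using i(2) fits_finv[of d G] by simp
  qed (simp add: finv_def)
qed

section \<open>Positive definite matrices and existence of a positive definite root\<close>

lemma qf_of_mat:
  assumes R: "R \<in> carrier_mat d d" and X: "fits d X"
  shows "qf (of_mat R) X = (\<Sum>s<d. vec d (\<lambda>r. ent X r s) \<bullet> (R *\<^sub>v vec d (\<lambda>r. ent X r s)))"
proof -
  have fR: "fits d (of_mat R)" using R by (rule fits_of_mat) auto
  have "qf (of_mat R) X = (\<Sum>s<d. \<Sum>c<d. ent X c s * (\<Sum>e<d. ent (of_mat R) c e * ent X e s))"
    using fR X by (simp add: qf_def tr_eq[of d] fits_mult ent_mult_left[of d] ent_tp)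
  also have "\<dots> = (\<Sum>s<d. vec d (\<lambda>r. ent X r s) \<bullet> (R *\<^sub>v vec d (\<lambda>r. ent X r s)))"
    using R by (auto simp: scalar_prod_def of_mat_def ent_fcut atLeast0LessThan intro!: sum.cong)
  finally show ?thesis .
qed

lemma pos_def_mat_qf:
  assumes R: "pos_def_mat d R" and X: "fits d X"
  shows "0 \<le> qf (of_mat R) X" "qf (of_mat R) X = 0 \<Longrightarrow> X = 0"
proof -
  have Rc: "R \<in> carrier_mat d d" using R by (simp add: pos_def_mat_def)
  let ?v = "\<lambda>s. vec d (\<lambda>r. ent X r s)"
  have nonneg: "0 \<le> ?v s \<bullet> (R *\<^sub>v ?v s)" for s
    using R unfolding pos_def_mat_def
    by (cases "?v s = 0\<^sub>v d") (auto intro: less_imp_le)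
  then show "0 \<le> qf (of_mat R) X"
    unfolding qf_of_mat[OF Rc X] by (intro sum_nonneg) auto
  assume "qf (of_mat R) X = 0"
  then have z: "?v s \<bullet> (R *\<^sub>v ?v s) = 0" if "s < d" for s
    using nonneg that unfolding qf_of_mat[OF Rc X] by (subst (asm) sum_nonneg_eq_0_iff) auto
  have v0: "?v s = 0\<^sub>v d" if "s < d" for s
    using R z[OF that] unfolding pos_def_mat_def by (metis less_irrefl vec_carrier)
  have "ent X r s = 0" if "r < d" "s < d" for r s
    using arg_cong[OF v0[OF that(2)], of "\<lambda>v. v $ r"] that by simp
  then show "X = 0"
    using X by (intro fmat_eqI) (metis ent_ring(1) fits_def not_less)
qed

lemma pos_def_matI:
  assumes F: "fits d F" "tp F = F" and pos: "\<And>X. fits d X \<Longrightarrow> 0 \<le> qf F X"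
    "\<And>X. fits d X \<Longrightarrow> qf F X = 0 \<Longrightarrow> X = 0"
  shows "pos_def_mat d (to_mat d F)"
  unfolding pos_def_mat_def
proof (intro conjI ballI impI)
  have "of_mat (transpose_mat (to_mat d F)) = of_mat (to_mat d F)"
    using F by (simp add: of_mat_transpose of_mat_to_mat)
  then show "transpose_mat (to_mat d F) = to_mat d F"
    by (rule of_mat_inject[of "transpose_mat (to_mat d F)" d, rotated 2]) auto
  fix v :: "real vec" assume v: "v \<in> carrier_vec d" "v \<noteq> 0\<^sub>v d"
  define X where "X = fcut d d (\<lambda>r s. if s = 0 then v $ r else 0)"
  have X: "fits d X" by (simp add: X_def)
  have d: "0 < d" using v by (cases d) auto
  have x0: "vec d (\<lambda>r. ent X r s) = (if s = 0 then v else 0\<^sub>v d)" if "s < d" for s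
    using that v(1) by (auto simp: X_def ent_fcut)
  have z: "0\<^sub>v d \<bullet> (to_mat d F *\<^sub>v 0\<^sub>v d) = 0"
    by (rule scalar_prod_left_zero) (rule mult_mat_vec_carrier[OF to_mat_carrier], simp)
  have "qf F X = (\<Sum>s<d. if s = 0 then v \<bullet> (to_mat d F *\<^sub>v v) else 0)"
    using qf_of_mat[OF to_mat_carrier X, of F] x0 v(1) by (simp add: of_mat_to_mat[OF F(1)] if_distrib z cong: if_cong)
  then have q: "qf F X = v \<bullet> (to_mat d F *\<^sub>v v)" using d by simp
  have "X \<noteq> 0"
  proof
    assume "X = 0"
    then have "ent X i 0 = 0" for i by (simp add: ent_ring)
    moreover have "ent X i 0 = v $ i" if "i < d" for i
      using that d by (simp add: X_def ent_fcut)
    ultimately have "v = 0\<^sub>v d"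
      using v(1) by (intro eq_vecI) auto
    then show False using v(2) by simp
  qed
  then show "0 < v \<bullet> (to_mat d F *\<^sub>v v)"
    using pos[OF X] unfolding q by force
qed simp

text \<open>After division by c, the identity minus C / c satisfies \<open>contr\<close>, and
  \<open>psd_sqrt\<close> returns a root of C / c. The left inverse \<open>G\<close> makes the root
  definite: S X = 0 implies C X = 0.\<close>

lemma sqrt_exists:
  assumes C: "fits d C" "tp C = C" "\<And>X. fits d X \<Longrightarrow> 0 \<le> qf C X"
    and G: "G * C = idm d"
  obtains S where "fits d S" "tp S = S" "S * S = C"
    "\<And>X. fits d X \<Longrightarrow> 0 \<le> qf S X" "\<And>X. fits d X \<Longrightarrow> qf S X = 0 \<Longrightarrow> X = 0"
proof -
  \<comment> \<open>The origin is 2 <X, C X> \<le> |X|^2 + |C X|^2 together with |C X|^2 \<le>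
    \<open>fro2 C\<close> |X|^2; the summand 1 also keeps c positive.\<close>
  define c where "c = 1 + fro2 C"
  have c: "0 < c" by (simp add: c_def add_pos_nonneg)
  have qc: "qf C X \<le> c * fro2 X" for X
  proof -
    have "2 * qf C X \<le> fro2 X + fro2 (C * X)"
      unfolding qf_def using tr_le_fro2[of X "C * X"] by linarith
    also have "\<dots> \<le> c * fro2 X"
      using fro2_mult_le[of C X] by (simp add: c_def algebra_simps)
    also have "\<dots> \<le> 2 * (c * fro2 X)"
      using c by simp
    finally show ?thesis by simp
  qed
  define B where "B = idm d - (1 / c) *\<^sub>R C"
  have "contr d B"
    unfolding contr_def
  proof (intro conjI allI impI)
    fix X assume X: "fits d X"
    have q: "qf B X = fro2 X - qf C X / c" by (simp add: B_def qf_arith qf_idm[OF X])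
    show "0 \<le> qf B X" using qc[of X] c by (simp add: q divide_le_eq mult.commute)
    show "qf B X \<le> fro2 X" using C(3)[OF X] c by (simp add: q)
  qed (simp_all add: B_def C fits_arith)
  then obtain R where R: "fits d R" "tp R = R" "R * R = idm d - B"
    "\<And>X. fits d X \<Longrightarrow> 0 \<le> qf R X" "\<And>X. fits d X \<Longrightarrow> qf R X \<le> fro2 X"
    by (rule psd_sqrt) (rule that)
  define S where "S = sqrt c *\<^sub>R R"
  have SS: "S * S = C"
    using R(3) c by (simp add: S_def B_def)
  show ?thesis
  proof (rule that[of S])
    show "S * S = C" by (rule SS)
    fix X assume X: "fits d X" "qf S X = 0"
    then have "qf R X = 0" using c by (simp add: S_def qf_arith)
    then have "R * X = 0" by (intro psd_qf_zero[OF R(1,2,5,4)] X)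
    then have "C * X = 0" by (simp add: SS[symmetric] S_def mult.assoc)
    then have "idm d * X = 0" unfolding G[symmetric] by (simp add: mult.assoc)
    then show "X = 0" using X(1) by simp
  qed (use R c in \<open>auto simp: S_def fits_arith qf_arith\<close>)
qed

text \<open>For a singular Gram matrix no candidate exists, since R R A = 1 forces det A to be
  nonzero, and the defaults of \<open>inv_sqrt_mat\<close> and \<open>finv\<close> are both 0.
  Otherwise the root of the inverse is a candidate, and its uniqueness selects the non-default
  branch of the definition.\<close>

theorem inv_sqrt_mat_eq:
  assumes Y: "fits m Y" and G: "fits d (Y * tp Y)"
  defines "S \<equiv> inv_sqrt_mat (to_mat d (Y * tp Y))"
  shows "S \<in> carrier_mat d d" "tp (of_mat S) = of_mat S" "of_mat S * of_mat S = finv d (Y * tp Y)"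
proof -
  define A where "A = to_mat d (Y * tp Y)"
  define C where "C = finv d (Y * tp Y)"
  let ?P = "\<lambda>R. pos_def_mat d R \<and> R * R * A = 1\<^sub>m d"
  have A: "A \<in> carrier_mat d d" "dim_row A = d" by (simp_all add: A_def to_mat_def)
  have fA: "of_mat A = Y * tp Y" using G by (simp add: A_def of_mat_to_mat)
  have Sdef: "S = (if \<exists>!R. ?P R then (THE R. ?P R) else 0\<^sub>m d d)"
    unfolding S_def A_def[symmetric] inv_sqrt_mat_def A(2) Let_def by simp
  have symG: "tp (Y * tp Y) = Y * tp Y" by simp
  note fs = finv_sym[OF G symG, folded C_def]
  have "S \<in> carrier_mat d d \<and> tp (of_mat S) = of_mat S \<and> of_mat S * of_mat S = C"
  proof (cases "det A = 0")
    case True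
    have "\<not> ?P R" for R
    proof
      assume R: "?P R"
      then have c: "R * R \<in> carrier_mat d d" by (auto simp: pos_def_mat_def)
      have "det (R * R) * det A = 1"
        using R det_mult[OF c A(1)] by simp
      with True show False by simp
    qed
    then have "S = 0\<^sub>m d d" unfolding Sdef by auto
    then show ?thesis using True by (simp add: of_mat_zero C_def finv_def A_def)
  next
    case False
    note i = finv_inverse[OF G False[unfolded A_def], folded C_def]
    have fC: "fits d C" by (simp add: C_def fits_finv)
    have qC: "0 \<le> qf C X" for X
    proof -
      have "qf C X = fro2 (tp Y * (C * X))"
        using fs by (simp add: qf_def fro2_def) (metis mult.assoc)
      then show ?thesis by simp
    qed
    obtain T where T: "fits d T" "tp T = T" "T * T = C"
      "\<And>X. fits d X \<Longrightarrow> 0 \<le> qf T X" "\<And>X. fits d X \<Longrightarrow> qf T X = 0 \<Longrightarrow> X = 0"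
      by (rule sqrt_exists[OF fC fs(1) qC i(2)]) (rule that)
    have char: "?P R \<longleftrightarrow> pos_def_mat d R \<and> of_mat R * of_mat R = C" for R
    proof (cases "R \<in> carrier_mat d d")
      case True
      have "R * R * A = 1\<^sub>m d \<longleftrightarrow> of_mat (R * R * A) = of_mat (1\<^sub>m d)"
        using of_mat_inject[of "R * R * A" d "1\<^sub>m d"] True A(1) by (metis mult_carrier_mat one_carrier_mat)
      also have "of_mat (R * R * A) = of_mat R * of_mat R * (Y * tp Y)"
        using of_mat_mult[of "R * R" d d A d] of_mat_mult[OF True True] True A(1) fA by simp
      also have "of_mat R * of_mat R * (Y * tp Y) = of_mat (1\<^sub>m d) \<longleftrightarrow> of_mat R * of_mat R = C"
      proof
        assume "of_mat R * of_mat R * (Y * tp Y) = of_mat (1\<^sub>m d)"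
        then have "of_mat R * of_mat R * (Y * tp Y * C) = idm d * C"
          by (simp only: of_mat_one mult.assoc[symmetric])
        then show "of_mat R * of_mat R = C"
          using i(2) fC fits_mult[OF fits_of_mat[OF True] fits_of_mat[OF True], of d] by simp
      qed (use i(1) in \<open>simp add: of_mat_one\<close>)
      finally show ?thesis by simp
    qed (simp add: pos_def_mat_def)
    have "pos_def_mat d (to_mat d T)"
    proof (rule pos_def_matI[OF T(1,2)])
      fix X assume "fits d X"
      then show "0 \<le> qf T X" by (rule T(4))
    next
      fix X assume "fits d X" "qf T X = 0"
      then show "X = 0" by (rule T(5))
    qed
    moreover have "of_mat (to_mat d T) * of_mat (to_mat d T) = C"
      by (simp only: of_mat_to_mat[OF T(1)] T(3))
    ultimately have ex: "?P (to_mat d T)"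
      by (rule char[THEN iffD2, OF conjI])
    have uniq: "R = to_mat d T" if R: "?P R" for R
    proof -
      have Rc: "pos_def_mat d R" "R \<in> carrier_mat d d" "of_mat R * of_mat R = C"
        using R char by (auto simp: pos_def_mat_def)
      have fR: "fits d (of_mat R)" using Rc(2) by (rule fits_of_mat) auto
      define D where "D = of_mat R - T"
      have fD: "fits d D" using fR T(1) by (simp add: D_def fits_arith)
      have tR: "tp (of_mat R) = of_mat R"
        using Rc(1) of_mat_transpose[of R] by (simp add: pos_def_mat_def)
      then have tD: "tp D = D" using T(2) by (simp add: D_def)
      \<comment> \<open>A Sylvester equation for the difference of two roots: R D + D T = R^2 - T^2.
        Tested against D it gives a sum of two nonnegative forms equal to 0, and definiteness of T
        yields D = 0.\<close>
      have "of_mat R * D + D * T = 0"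
        using Rc(3) T(3) by (simp add: D_def algebra_simps)
      then have "tr (D * (of_mat R * D)) + tr (D * (D * T)) = 0"
        using tr_add[of "D * (of_mat R * D)" "D * (D * T)"] by (simp add: distrib_left[symmetric])
      moreover have "tr (D * (D * T)) = tr (D * (T * D))"
        using tr_commute[of D "D * T"] by (simp add: mult.assoc)
      ultimately have "qf (of_mat R) D + qf T D = 0" by (simp add: qf_def tD)
      then have "qf T D = 0"
        using pos_def_mat_qf(1)[OF Rc(1) fD] T(4)[OF fD] by linarith
      then have "D = 0" by (rule T(5)[OF fD])
      then have "of_mat R = of_mat (to_mat d T)" using T(1) by (simp add: D_def of_mat_to_mat)
      then show ?thesis by (rule of_mat_inject[OF Rc(2) to_mat_carrier])
    qed
    have "\<exists>!R. ?P R" using ex uniq by (rule ex1I)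
    moreover have "(THE R. ?P R) = to_mat d T" using ex uniq by (rule the_equality)
    ultimately have "S = to_mat d T" unfolding Sdef by (simp only: if_True)
    then show ?thesis using T(2,3) by (simp add: of_mat_to_mat[OF T(1)])
  qed
  then show "S \<in> carrier_mat d d" "tp (of_mat S) = of_mat S" "of_mat S * of_mat S = finv d (Y * tp Y)"
    by (auto simp: C_def)
qed

section \<open>Block indices\<close>

lemma blk_off_Suc: "blk_off pp (Suc i) = blk_off pp i + pp i"
  by (simp add: blk_off_def)

lemma blk_off_mono: "i \<le> j \<Longrightarrow> blk_off pp i \<le> blk_off pp j"
  unfolding blk_off_def by (intro sum_mono2) auto

lemma blk_off_add_less:
  assumes "i < k" "a < pp i"
  shows "blk_off pp i + a < blk_off pp k"
  using blk_off_mono[of "Suc i" k pp] assms by (simp add: blk_off_Suc)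

lemma blk_of_eq:
  assumes "blk_off pp i \<le> r" "r < blk_off pp (Suc i)"
  shows "blk_of pp r = i"
  unfolding blk_of_def
proof (rule Least_equality)
  fix l assume l: "r < blk_off pp (Suc l)"
  show "i \<le> l"
  proof (rule ccontr)
    assume "\<not> i \<le> l"
    then have "blk_off pp (Suc l) \<le> blk_off pp i" by (intro blk_off_mono) simp
    with l assms(1) show False by simp
  qed
qed (rule assms(2))

lemma blk_of_add: "a < pp i \<Longrightarrow> blk_of pp (blk_off pp i + a) = i"
  by (rule blk_of_eq) (simp_all add: blk_off_Suc)

lemma blk_of_bounds:
  assumes "r < blk_off pp k"
  shows "blk_of pp r < k" "blk_off pp (blk_of pp r) \<le> r" "r - blk_off pp (blk_of pp r) < pp (blk_of pp r)"
proof -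
  have "\<exists>i<k. blk_off pp i \<le> r \<and> r < blk_off pp (Suc i)"
    using assms
  proof (induction k)
    case (Suc k)
    then show ?case by (cases "r < blk_off pp k") (auto intro: less_SucI)
  qed (simp add: blk_off_def)
  then obtain i where i: "i < k" "blk_off pp i \<le> r" "r < blk_off pp (Suc i)" by blast
  have "blk_of pp r = i" using i by (intro blk_of_eq)
  then show "blk_of pp r < k" "blk_off pp (blk_of pp r) \<le> r" "r - blk_off pp (blk_of pp r) < pp (blk_of pp r)"
    using i by (auto simp: blk_off_Suc)
qed

section \<open>The block projections of a data array\<close>

text \<open>\<open>fits\<close> has a single bound for rows and columns; for the Gram matrix and the
  projection of rectangular data the two have to be kept apart.\<close>

definition rect :: "nat \<Rightarrow> nat \<Rightarrow> fmat \<Rightarrow> bool" where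
  "rect m n A \<longleftrightarrow> (\<forall>a b. m \<le> a \<or> n \<le> b \<longrightarrow> ent A a b = 0)"

lemma rect_fits: "rect d d A = fits d A"
  by (simp add: rect_def fits_def)

lemma rect_fcut: "rect m n (fcut m n f)"
  by (auto simp: rect_def ent_fcut)

lemma rect_tp: "rect m n A \<Longrightarrow> rect n m (tp A)"
  by (auto simp: rect_def ent_tp)

lemma rect_mult: "rect m l A \<Longrightarrow> rect l' n B \<Longrightarrow> rect m n (A * B)"
  unfolding rect_def[of m n "A * B"] ent_mult_left[OF fits_fdim] by (auto simp: rect_def)

text \<open>An array z holds the r-th coordinate of the j-th observation at (j, r).\<close>

definition block_data :: "(nat \<Rightarrow> nat) \<Rightarrow> nat \<Rightarrow> nat \<Rightarrow> (nat \<times> nat \<Rightarrow> real) \<Rightarrow> fmat" where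
  "block_data pp n i z = fcut (pp i) n (\<lambda>a j. z (j, blk_off pp i + a))"

definition centred :: "(nat \<Rightarrow> nat) \<Rightarrow> nat \<Rightarrow> nat \<Rightarrow> (nat \<times> nat \<Rightarrow> real) \<Rightarrow> fmat" where
  "centred pp n i z = block_data pp n i z * centre n"

definition gram :: "(nat \<Rightarrow> nat) \<Rightarrow> nat \<Rightarrow> nat \<Rightarrow> (nat \<times> nat \<Rightarrow> real) \<Rightarrow> fmat" where
  "gram pp n i z = centred pp n i z * tp (centred pp n i z)"

text \<open>The projection onto the row space of the centred data if the Gram matrix is invertible,
  and 0 otherwise; thus a projection for every array. Indices beyond k are filled with 0 to meet
  \<open>valid\<close>.\<close>

definition bproj :: "nat \<Rightarrow> (nat \<Rightarrow> nat) \<Rightarrow> nat \<Rightarrow> (nat \<times> nat \<Rightarrow> real) \<Rightarrow> nat \<Rightarrow> fmat" where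
  "bproj k pp n z i = (if i < k
     then tp (centred pp n i z) * finv (pp i) (gram pp n i z) * centred pp n i z else 0)"

lemma rect_centred: "rect (pp i) n (centred pp n i z)"
proof -
  have "rect n n (centre n)" by (simp add: rect_fits)
  then show ?thesis
    unfolding centred_def block_data_def by (rule rect_mult[OF rect_fcut])
qed

lemma ent_centred:
  assumes "a < pp i" "j < n"
  shows "ent (centred pp n i z) a j = z (j, blk_off pp i + a) - (\<Sum>m<n. z (m, blk_off pp i + a)) / real n"
proof -
  let ?r = "blk_off pp i + a"
  have "ent (centred pp n i z) a j = (\<Sum>m<n. ent (block_data pp n i z) a m * ent (centre n) m j)"
    unfolding centred_def by (rule ent_mult_right) simp
  also have "\<dots> = (\<Sum>m<n. z (m, ?r) * (if m = j then 1 else 0) - z (m, ?r) / real n)"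
    using assms by (intro sum.cong refl) (simp add: block_data_def ent_fcut centre_def right_diff_distrib)
  also have "\<dots> = (\<Sum>m<n. z (m, ?r) * (if m = j then 1 else 0)) - (\<Sum>m<n. z (m, ?r)) / real n"
    by (simp only: sum_subtractf sum_divide_distrib)
  also have "(\<Sum>m<n. z (m, ?r) * (if m = j then 1 else 0)) = z (j, ?r)"
    using assms by (intro sum_delta_mult(2)) simp
  finally show ?thesis .
qed

lemma fits_gram: "fits (pp i) (gram pp n i z)"
  unfolding gram_def rect_fits[symmetric] by (rule rect_mult[OF rect_centred rect_tp[OF rect_centred]])

lemma tp_gram: "tp (gram pp n i z) = gram pp n i z"
  by (simp add: gram_def)

lemma valid_bproj: "valid n (bproj k pp n z)"
  unfolding valid_def
proof
  fix i
  let ?Y = "centred pp n i z" and ?C = "finv (pp i) (gram pp n i z)"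
  note s = finv_sym[OF fits_gram tp_gram, of pp i n z]
  have "tp ?Y * ?C * ?Y * (tp ?Y * ?C * ?Y) = tp ?Y * (?C * gram pp n i z * ?C) * ?Y"
    by (simp add: gram_def mult.assoc)
  then have 1: "proj (tp ?Y * ?C * ?Y)"
    unfolding proj_def s by (simp add: s mult.assoc)
  have "rect (pp i) (pp i) ?C" by (simp add: rect_fits fits_finv)
  then have 2: "fits n (tp ?Y * ?C * ?Y)"
    unfolding rect_fits[symmetric]
    by (rule rect_mult[OF rect_mult[OF rect_tp[OF rect_centred]] rect_centred])
  have "centre n * tp ?Y = tp ?Y"
    by (simp add: centred_def mult.assoc[symmetric] centre_idem)
  then have 3: "centre n * (tp ?Y * ?C * ?Y) = tp ?Y * ?C * ?Y"
    by (simp add: mult.assoc[symmetric])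
  have "proj 0" by (simp add: proj_def)
  then show "proj (bproj k pp n z i) \<and> fits n (bproj k pp n z i) \<and> centre n * bproj k pp n z i = bproj k pp n z i"
    using 1 2 3 by (simp add: bproj_def fits_arith)
qed

lemma tr_bproj:
  assumes "i < k" "det (to_mat (pp i) (gram pp n i z)) \<noteq> 0"
  shows "tr (bproj k pp n z i) = real (pp i)"
proof -
  let ?Y = "centred pp n i z" and ?C = "finv (pp i) (gram pp n i z)"
  have "tr (tp ?Y * ?C * ?Y) = tr (?C * gram pp n i z)"
    using tr_commute[of "tp ?Y" "?C * ?Y"] by (simp add: gram_def mult.assoc)
  then show ?thesis
    using finv_inverse(1)[OF fits_gram assms(2)] assms(1) by (simp add: bproj_def)
qed

text \<open>Right multiplication of the data of block j by \<open>R\<close>, mixing observations and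
  not coordinates. The restricted abstraction keeps the array inside the product space.\<close>

definition rotate_data :: "(nat \<Rightarrow> nat) \<Rightarrow> nat \<Rightarrow> nat \<Rightarrow> nat \<Rightarrow> fmat \<Rightarrow> (nat \<times> nat \<Rightarrow> real) \<Rightarrow> nat \<times> nat \<Rightarrow> real" where
  "rotate_data pp k n j R z = (\<lambda>(l, r)\<in>{..<n} \<times> {..<blk_off pp k}.
     if blk_of pp r = j then \<Sum>m<n. z (m, r) * ent R m l else z (l, r))"

lemma block_data_rotate:
  assumes "fits n R" "i < k"
  shows "block_data pp n i (rotate_data pp k n j R z)
    = (if i = j then block_data pp n i z * R else block_data pp n i z)"
proof (rule fmat_eqI)
  fix a l
  have f: "fits (max n (pp i)) (block_data pp n i z)"
    by (auto simp: block_data_def)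
  have "ent (block_data pp n i z * R) a l = (\<Sum>m<n. ent (block_data pp n i z) a m * ent R m l)"
    using assms(1) by (rule ent_mult_right)
  moreover have "ent R m l = 0" if "\<not> l < n" for m using that assms(1) by (auto simp: fits_def)
  ultimately show "ent (block_data pp n i (rotate_data pp k n j R z)) a l
      = ent (if i = j then block_data pp n i z * R else block_data pp n i z) a l"
    using assms(2) blk_off_add_less[of i k a pp] blk_of_add[of a pp i]
    by (auto simp: block_data_def ent_fcut rotate_data_def)
qed

text \<open>\<open>R\<close> passes through the centring and \<open>R * tp R\<close> is the
  identity, so the Gram matrix does not change and only the outer factors of the projection
  rotate.\<close>

lemma bproj_rotate:
  assumes R: "rotation n R" and j: "j < k"
  shows "bproj k pp n (rotate_data pp k n j R z) = act j R (bproj k pp n z)"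
proof
  fix i
  have f: "fits n R" and RR: "R * tp R = idm n" and RH: "R * centre n = centre n * R"
    using R by (auto simp: rotation_def)
  let ?z = "rotate_data pp k n j R z"
  show "bproj k pp n ?z i = act j R (bproj k pp n z) i"
  proof (cases "i < k")
    case True
    show ?thesis
    proof (cases "i = j")
      case False
      then have "centred pp n i ?z = centred pp n i z"
        using block_data_rotate[OF f True, of pp j z] by (simp add: centred_def)
      then show ?thesis using False by (simp add: bproj_def gram_def act_def)
    next
      case e: True
      have Y: "centred pp n i ?z = centred pp n i z * R"
        using block_data_rotate[OF f True, of pp j z] e by (simp add: centred_def mult.assoc RH)
      have "centred pp n i z * R * (tp R * tp (centred pp n i z))
          = block_data pp n i z * (centre n * (R * tp R)) * tp (centred pp n i z)"
        by (simp add: centred_def mult.assoc)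
      then have "gram pp n i ?z = gram pp n i z"
        by (simp add: gram_def Y RR) (simp add: centred_def)
      then have "bproj k pp n ?z i = tp R * bproj k pp n z i * R"
        using True by (simp add: bproj_def Y mult.assoc)
      then show ?thesis using e by (simp add: act_def)
    qed
  next
    case False
    then show ?thesis using j by (auto simp: bproj_def act_def)
  qed
qed

lemma bproj_cong:
  assumes "\<And>j r. j < n \<Longrightarrow> r < blk_off pp k \<Longrightarrow> z (j, r) = z' (j, r)"
  shows "bproj k pp n z = bproj k pp n z'"
proof
  fix i
  have "block_data pp n i z = block_data pp n i z'" if "i < k"
    using blk_off_add_less[OF that] assms
    by (intro fmat_eqI) (auto simp: block_data_def ent_fcut)
  then show "bproj k pp n z i = bproj k pp n z' i"
    by (simp add: bproj_def gram_def centred_def)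
qed

section \<open>Measurability\<close>

lemma borel_measurable_det:
  assumes "\<And>z. A z \<in> carrier_mat d d"
    and "\<And>i j. i < d \<Longrightarrow> j < d \<Longrightarrow> (\<lambda>z. A z $$ (i, j) :: real) \<in> borel_measurable \<Omega>"
  shows "(\<lambda>z. det (A z)) \<in> borel_measurable \<Omega>"
  unfolding det_def'[OF assms(1)]
proof (intro borel_measurable_sum borel_measurable_times borel_measurable_prod borel_measurable_const)
  fix p i assume "p \<in> {p. p permutes {0..<d}}" "i \<in> {0..<d}"
  then have "p i < d" using permutes_in_image[of p "{0..<d}" i] by simp
  then show "(\<lambda>z. A z $$ (i, p i)) \<in> borel_measurable \<Omega>"
    using \<open>i \<in> {0..<d}\<close> by (intro assms(2)) auto
qed

text \<open>A size common to all z gives the sums over entries a fixed index range, so that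
  measurability can be checked termwise.\<close>

definition mfun :: "'a measure \<Rightarrow> ('a \<Rightarrow> fmat) \<Rightarrow> bool" where
  "mfun \<Omega> X \<longleftrightarrow> (\<exists>d. \<forall>z. fits d (X z)) \<and> (\<forall>a b. (\<lambda>z. ent (X z) a b) \<in> borel_measurable \<Omega>)"

lemma mfun_ent: "mfun \<Omega> X \<Longrightarrow> (\<lambda>z. ent (X z) a b) \<in> borel_measurable \<Omega>"
  by (simp add: mfun_def)

lemma mfun_const: "mfun \<Omega> (\<lambda>z. A)"
  unfolding mfun_def using fits_fdim by auto

lemma mfun_tp: "mfun \<Omega> X \<Longrightarrow> mfun \<Omega> (\<lambda>z. tp (X z))"
  unfolding mfun_def ent_tp by auto

lemma mfun_mult:
  assumes X: "mfun \<Omega> X" and Y: "mfun \<Omega> Y"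
  shows "mfun \<Omega> (\<lambda>z. X z * Y z)"
proof -
  obtain d e where de: "\<And>z. fits d (X z)" "\<And>z. fits e (Y z)" using X Y unfolding mfun_def by auto
  have f: "fits (max d e) (X z)" "fits (max d e) (Y z)" for z
    using fits_mono[OF de(1)] fits_mono[OF de(2)] by auto
  have "(\<lambda>z. \<Sum>c<max d e. ent (X z) a c * ent (Y z) c b) \<in> borel_measurable \<Omega>" for a b
    by (intro borel_measurable_sum borel_measurable_times mfun_ent X Y)
  moreover have "\<exists>d. \<forall>z. fits d (X z * Y z)" using fits_mult[OF f] by blast
  ultimately show ?thesis
    unfolding mfun_def ent_mult_left[OF f(1)] by blast
qed

lemma mfun_sum:
  assumes "\<And>i. i \<in> I \<Longrightarrow> mfun \<Omega> (X i)"
  shows "mfun \<Omega> (\<lambda>z. \<Sum>i\<in>I. X i z)"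
  using assms
proof (induction I rule: infinite_finite_induct)
  case (insert i I)
  have X: "mfun \<Omega> (X i)" and S: "mfun \<Omega> (\<lambda>z. \<Sum>i\<in>I. X i z)"
    using insert by auto
  obtain d where d: "\<And>z. fits d (X i z)" using X by (auto simp: mfun_def)
  obtain e where e: "\<And>z. fits e (\<Sum>i\<in>I. X i z)" using S by (auto simp: mfun_def)
  have "fits (max d e) (X i z + (\<Sum>i\<in>I. X i z))" for z
    using fits_mono[OF d, of "max d e"] fits_mono[OF e, of "max d e"] by (simp add: fits_arith)
  moreover have "(\<lambda>z. ent (X i z + (\<Sum>i\<in>I. X i z)) a b) \<in> borel_measurable \<Omega>" for a b
    unfolding ent_ring by (intro borel_measurable_add mfun_ent X S)
  ultimately show ?case using insert.hyps by (auto simp: mfun_def)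
qed (auto intro: mfun_const)

lemma mfun_tr:
  assumes "mfun \<Omega> X"
  shows "(\<lambda>z. tr (X z)) \<in> borel_measurable \<Omega>"
proof -
  obtain d where d: "\<And>z. fits d (X z)" using assms unfolding mfun_def by auto
  show ?thesis unfolding tr_eq[OF d] by (intro borel_measurable_sum mfun_ent assms)
qed

lemma mfun_det: "mfun \<Omega> X \<Longrightarrow> (\<lambda>z. det (to_mat d (X z))) \<in> borel_measurable \<Omega>"
  by (intro borel_measurable_det) (auto simp: to_mat_def intro: mfun_ent)

text \<open>The entries are cofactors, polynomial in the entries of X, times the real
  \<open>inverse\<close> of the determinant, which is measurable with its value 0 at 0.\<close>

lemma mfun_finv:
  assumes X: "mfun \<Omega> X"
  shows "mfun \<Omega> (\<lambda>z. finv d (X z))"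
proof -
  have "(\<lambda>z. ent (finv d (X z)) a b) \<in> borel_measurable \<Omega>" for a b
  proof (cases "a < d \<and> b < d")
    case True
    have "(\<lambda>z. det (mat_delete (to_mat d (X z)) b a)) \<in> borel_measurable \<Omega>"
    proof (rule borel_measurable_det)
      show "mat_delete (to_mat d (X z)) b a \<in> carrier_mat (d - 1) (d - 1)" for z
        by (rule mat_delete_carrier) simp
      fix i j assume "i < d - 1" "j < d - 1"
      then show "(\<lambda>z. mat_delete (to_mat d (X z)) b a $$ (i, j)) \<in> borel_measurable \<Omega>"
        by (auto simp: mat_delete_def to_mat_def intro: mfun_ent[OF X])
    qed
    then have "(\<lambda>z. inverse (det (to_mat d (X z))) * ((-1) ^ (b + a) * det (mat_delete (to_mat d (X z)) b a)))
        \<in> borel_measurable \<Omega>"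
      using mfun_det[OF X, of d] by (intro borel_measurable_times borel_measurable_inverse) auto
    then show ?thesis
      using True by (simp add: finv_def ent_scaleR of_mat_def ent_fcut adj_mat_def to_mat_def cofactor_def)
  next
    case False
    then have "ent (finv d (X z)) a b = 0" for z
      using fits_finv[of d "X z"] by (auto simp: fits_def not_less)
    then show ?thesis by simp
  qed
  then show ?thesis unfolding mfun_def using fits_finv by blast
qed

lemma mfun_bproj:
  assumes "\<And>j r. j < n \<Longrightarrow> r < blk_off pp k \<Longrightarrow> (\<lambda>w. Z w (j, r)) \<in> borel_measurable \<Omega>"
  shows "mfun \<Omega> (\<lambda>w. bproj k pp n (Z w) i)" "i < k \<Longrightarrow> mfun \<Omega> (\<lambda>w. gram pp n i (Z w))"
proof -
  have Y: "mfun \<Omega> (\<lambda>w. centred pp n i (Z w))" if "i < k"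
    unfolding centred_def
  proof (rule mfun_mult[OF _ mfun_const])
    have "(\<lambda>w. ent (block_data pp n i (Z w)) a b) \<in> borel_measurable \<Omega>" for a b
      using assms blk_off_add_less[OF that, of a pp] by (cases "a < pp i \<and> b < n") (auto simp: block_data_def ent_fcut)
    moreover have "fits (max n (pp i)) (block_data pp n i (Z w))" for w
      by (auto simp: block_data_def)
    ultimately show "mfun \<Omega> (\<lambda>w. block_data pp n i (Z w))"
      unfolding mfun_def by blast
  qed
  then show g: "i < k \<Longrightarrow> mfun \<Omega> (\<lambda>w. gram pp n i (Z w))"
    unfolding gram_def by (intro mfun_mult mfun_tp)
  show "mfun \<Omega> (\<lambda>w. bproj k pp n (Z w) i)"
  proof (cases "i < k")
    case True
    then show ?thesis
      unfolding bproj_def using Y g by (simp add: mfun_mult mfun_tp mfun_finv)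
  qed (simp add: bproj_def mfun_const)
qed

section \<open>Schott's statistic in terms of the projections\<close>

text \<open>Picks the coordinates of block i. The block-diagonal matrix with blocks S_i becomes the
  sum of \<open>tp (select pp p i) * S_i * select pp p i\<close>, which reduces index arithmetic to
  matrix algebra.\<close>

definition select :: "(nat \<Rightarrow> nat) \<Rightarrow> nat \<Rightarrow> nat \<Rightarrow> fmat" where
  "select pp p i = fcut (pp i) p (\<lambda>a r. if r = blk_off pp i + a then 1 else 0)"

lemma select_mult:
  assumes i: "i < k" and A: "fits m A" "blk_off pp k \<le> m"
  shows "ent (select pp (blk_off pp k) i * A) a b
    = (if a < pp i then ent A (blk_off pp i + a) b else 0)"
proof (cases "a < pp i")
  case True
  let ?p = "blk_off pp k"
  have lt: "blk_off pp i + a < m"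
    using blk_off_add_less[of i k a pp] i True A(2) by simp
  have "ent (select pp ?p i * A) a b = (\<Sum>c<m. ent (select pp ?p i) a c * ent A c b)"
    using A(1) by (rule ent_mult_right)
  also have "\<dots> = (\<Sum>c<m. (if blk_off pp i + a = c then 1 else 0) * ent A c b)"
    using True i blk_off_add_less[of i k a pp]
    by (intro sum.cong refl) (auto simp: select_def ent_fcut)
  also have "\<dots> = ent A (blk_off pp i + a) b"
    using lt by (rule sum_delta_mult)
  finally show ?thesis using True by simp
qed (use A in \<open>auto simp: ent_mult_right[OF A(1)] select_def ent_fcut\<close>)

text \<open>With W = D X one has B = W W', hence tr B^2 = tr (W' W)^2. In W' W only the squares of
  the inverse roots survive, so it is the sum of the X_i' (X_i X_i')^(-1) X_i, with 0 in place of a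
  missing inverse.\<close>

theorem schott_stat_eq:
  "schott_stat k pp n x
    = tr ((\<Sum>i<k. bproj k pp n (\<lambda>(j, r). x j r) i) * (\<Sum>i<k. bproj k pp n (\<lambda>(j, r). x j r) i)) / 2
      - real (blk_off pp k) / 2"
proof -
  define p where "p = blk_off pp k"
  define z where "z = (\<lambda>(j, r). x j r)"
  define X where "X = data_mat p n x"
  define S where "S i = inv_sqrt_mat (sub_data_mat pp n i X * transpose_mat (sub_data_mat pp n i X))" for i
  define D where "D = mat p p (\<lambda>(r, c). if blk_of pp r = blk_of pp c
     then S (blk_of pp r) $$ (r - blk_off pp (blk_of pp r), c - blk_off pp (blk_of pp r)) else 0)"
  have B: "block_corr k pp n x = D * (X * transpose_mat X) * D"
    unfolding block_corr_def Let_def p_def[symmetric] X_def[symmetric] S_def[symmetric] D_def[symmetric] ..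
  have X: "X \<in> carrier_mat p n" by (simp add: X_def data_mat_def)
  have D: "D \<in> carrier_mat p p" by (simp add: D_def)
  let ?J = "select pp p"
  define N where "N = max n p"
  have fX: "fits N (of_mat X)" using X by (rule fits_of_mat) (auto simp: N_def)
  have entX: "ent (of_mat X) r j = (if r < p \<and> j < n then x j r - (\<Sum>l<n. x l r) / real n else 0)" for r j
    by (simp add: X_def data_mat_def of_mat_def ent_fcut)
  have JX: "?J i * of_mat X = centred pp n i z" if i: "i < k" for i
  proof (rule fmat_eqI)
    fix a j
    have "ent (?J i * of_mat X) a j = (if a < pp i then ent (of_mat X) (blk_off pp i + a) j else 0)"
      unfolding p_def by (rule select_mult[OF i fX]) (simp add: N_def p_def)
    also have "\<dots> = ent (centred pp n i z) a j"
    proof (cases "a < pp i \<and> j < n")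
      case True
      then have "blk_off pp i + a < p" using blk_off_add_less[OF i, of a pp] by (simp add: p_def)
      then show ?thesis using True by (simp add: entX ent_centred z_def)
    next
      case False
      then show ?thesis
        using rect_centred[of pp i n z] by (auto simp: rect_def entX not_less)
    qed
    finally show "ent (?J i * of_mat X) a j = ent (centred pp n i z) a j" .
  qed
  have sub: "of_mat (sub_data_mat pp n i X) = centred pp n i z" if i: "i < k" for i
  proof -
    have "of_mat (sub_data_mat pp n i X) = ?J i * of_mat X"
    proof (rule fmat_eqI)
      fix a j
      have "ent (?J i * of_mat X) a j = (if a < pp i then ent (of_mat X) (blk_off pp i + a) j else 0)"
        unfolding p_def by (rule select_mult[OF i fX]) (simp add: N_def p_def)
      then show "ent (of_mat (sub_data_mat pp n i X)) a j = ent (?J i * of_mat X) a j"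
        using blk_off_add_less[OF i, of a pp] X
        by (auto simp: sub_data_mat_def of_mat_def ent_fcut p_def)
    qed
    then show ?thesis using JX[OF i] by simp
  qed
  have S: "S i \<in> carrier_mat (pp i) (pp i)" "tp (of_mat (S i)) = of_mat (S i)"
    "of_mat (S i) * of_mat (S i) = finv (pp i) (gram pp n i z)" if i: "i < k" for i
  proof -
    let ?X = "sub_data_mat pp n i X"
    have c: "?X \<in> carrier_mat (pp i) n" by (simp add: sub_data_mat_def)
    have "of_mat (?X * transpose_mat ?X) = gram pp n i z"
      using of_mat_mult[OF c, of "transpose_mat ?X" "pp i"] c by (simp add: of_mat_transpose sub[OF i] gram_def)
    then have "?X * transpose_mat ?X = to_mat (pp i) (gram pp n i z)"
      using to_mat_of_mat[of "?X * transpose_mat ?X" "pp i"] c by simp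
    then have "S i = inv_sqrt_mat (to_mat (pp i) (centred pp n i z * tp (centred pp n i z)))"
      by (simp add: S_def gram_def)
    then show "S i \<in> carrier_mat (pp i) (pp i)" "tp (of_mat (S i)) = of_mat (S i)"
      "of_mat (S i) * of_mat (S i) = finv (pp i) (gram pp n i z)"
      using inv_sqrt_mat_eq[OF fits_fdim[of "centred pp n i z"], of "pp i"] fits_gram[of pp i n z]
      unfolding gram_def by auto
  qed
  have fJ: "fits p (tp (?J i))" if "i < k" for i
  proof -
    have "pp i \<le> p" using blk_off_mono[of "Suc i" k pp] that by (simp add: p_def blk_off_Suc)
    then show ?thesis by (simp add: select_def)
  qed
  have fS: "fits p (of_mat (S i))" if "i < k" for i
    using S(1)[OF that] fJ[OF that] blk_off_mono[of "Suc i" k pp] that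
    by (auto intro!: fits_of_mat simp: p_def blk_off_Suc)
  have JA: "ent (tp (?J i) * A) r b = (if blk_of pp r = i \<and> r < p then ent A (r - blk_off pp i) b else 0)"
    if i: "i < k" and A: "rect (pp i) m A" for i A r b m
  proof -
    have "ent (tp (?J i) * A) r b = (\<Sum>c<p. ent (?J i) c r * ent A c b)"
      using ent_mult_left[OF fJ[OF i], of A r b] by (simp add: ent_tp)
    also have "\<dots> = (\<Sum>c<p. if blk_of pp r = i \<and> r < p \<and> c = r - blk_off pp i then ent A c b else 0)"
    proof (intro sum.cong refl)
      fix c
      have "ent A c b = 0" if "\<not> c < pp i" using that A by (auto simp: rect_def)
      then show "ent (?J i) c r * ent A c b
          = (if blk_of pp r = i \<and> r < p \<and> c = r - blk_off pp i then ent A c b else 0)"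
        using blk_of_add[of c pp i] blk_of_bounds[of r pp k]
        by (auto simp: select_def ent_fcut p_def)
    qed
    also have "\<dots> = (if blk_of pp r = i \<and> r < p then ent A (r - blk_off pp i) b else 0)"
    proof (cases "blk_of pp r = i \<and> r < p")
      case True
      then have "r - blk_off pp i < p" by (meson less_imp_diff_less)
      then show ?thesis using True by simp
    qed auto
    finally show ?thesis .
  qed
  have fmD: "of_mat D = (\<Sum>i<k. tp (?J i) * (of_mat (S i) * ?J i))"
  proof (rule fmat_eqI)
    fix r c
    have e: "ent (tp (?J i) * (of_mat (S i) * ?J i)) r c
        = (if blk_of pp r = i \<and> r < p \<and> blk_of pp c = i \<and> c < p
            then S i $$ (r - blk_off pp i, c - blk_off pp i) else 0)" if i: "i < k" for i
    proof -
      have r1: "rect (pp i) p (of_mat (S i) * ?J i)"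
        using S(1)[OF i] by (intro rect_mult[of _ "pp i" _ "pp i"]) (auto simp: rect_def of_mat_def ent_fcut select_def)
      have r2: "rect (pp i) (pp i) (of_mat (S i))" using S(1)[OF i] by (auto simp: rect_def of_mat_def ent_fcut)
      have "ent (of_mat (S i) * ?J i) a c = ent (tp (?J i) * of_mat (S i)) c a" for a
        using ent_tp[of "of_mat (S i) * ?J i" c a] S(2)[OF i] by simp
      moreover have "ent (of_mat (S i)) b a = ent (of_mat (S i)) a b" for a b
        using ent_tp[of "of_mat (S i)" b a] S(2)[OF i] by simp
      ultimately have e1: "ent (of_mat (S i) * ?J i) a c
          = (if blk_of pp c = i \<and> c < p then ent (of_mat (S i)) a (c - blk_off pp i) else 0)" for a
        using JA[OF i r2] by metis
      have e2: "ent (of_mat (S i)) (r - blk_off pp i) (c - blk_off pp i)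
          = S i $$ (r - blk_off pp i, c - blk_off pp i)"
        if "blk_of pp r = i \<and> r < p" "blk_of pp c = i \<and> c < p"
        using that blk_of_bounds(3)[of r pp k] blk_of_bounds(3)[of c pp k] S(1)[OF i]
        by (simp add: of_mat_def ent_fcut p_def)
      show ?thesis
        unfolding JA[OF i r1, of r c] e1 using e2 by auto
    qed
    have "ent (\<Sum>i<k. tp (?J i) * (of_mat (S i) * ?J i)) r c
        = (\<Sum>i<k. if blk_of pp r = i \<and> r < p \<and> blk_of pp c = i \<and> c < p
            then S i $$ (r - blk_off pp i, c - blk_off pp i) else 0)"
      unfolding ent_sum by (intro sum.cong refl e) simp
    also have "\<dots> = (\<Sum>i<k. if i = blk_of pp r then (if r < p \<and> c < p \<and> blk_of pp r = blk_of pp c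
            then S i $$ (r - blk_off pp i, c - blk_off pp i) else 0) else 0)"
      by (intro sum.cong refl) auto
    also have "\<dots> = ent (of_mat D) r c"
      using blk_of_bounds(1)[of r pp k] by (auto simp: D_def of_mat_def ent_fcut p_def)
    finally show "ent (of_mat D) r c = ent (\<Sum>i<k. tp (?J i) * (of_mat (S i) * ?J i)) r c" by simp
  qed
  \<comment> \<open>Coordinates picked for different blocks are orthogonal; this removes the cross
    terms in W' W.\<close>
  have JJ: "?J i * tp (?J l) = (if i = l then idm (pp i) else 0)" if i: "i < k" and l: "l < k" for i l
  proof (rule fmat_eqI)
    fix a b
    have "ent (?J i * tp (?J l)) a b = (if a < pp i then ent (?J l) b (blk_off pp i + a) else 0)"
      unfolding p_def using select_mult[OF i fJ[OF l]] by (simp add: p_def ent_tp)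
    also have "\<dots> = ent (if i = l then idm (pp i) else 0) a b"
      using blk_of_add[of a pp i] blk_of_add[of b pp l] blk_off_add_less[OF i, of a pp]
      by (auto simp: select_def idm_def ent_fcut ent_ring p_def split: if_splits)
    finally show "ent (?J i * tp (?J l)) a b = ent (if i = l then idm (pp i) else 0) a b" .
  qed
  have DX: "of_mat D * of_mat X = (\<Sum>i<k. tp (?J i) * (of_mat (S i) * centred pp n i z))"
    unfolding fmD sum_distrib_right by (intro sum.cong refl) (simp add: mult.assoc JX)
  have "tp (of_mat D) = (\<Sum>i<k. tp (?J i) * (of_mat (S i) * ?J i))"
    unfolding fmD tp_sum by (intro sum.cong refl) (simp add: S mult.assoc)
  then have tD: "tp (of_mat D) = of_mat D" by (simp add: fmD)
  have main: "tp (of_mat D * of_mat X) * (of_mat D * of_mat X) = (\<Sum>i<k. bproj k pp n z i)"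
  proof -
    have "tp (of_mat D * of_mat X) * (of_mat D * of_mat X)
        = (\<Sum>i<k. \<Sum>l<k. tp (centred pp n i z) * of_mat (S i) * (?J i * tp (?J l)) * (of_mat (S l) * centred pp n l z))"
      unfolding DX tp_sum sum_product by (intro sum.cong refl) (simp add: S mult.assoc)
    also have "\<dots> = (\<Sum>i<k. \<Sum>l<k. if l = i then bproj k pp n z i else 0)"
    proof (intro sum.cong refl)
      fix i l assume "i \<in> {..<k}" "l \<in> {..<k}"
      then have il: "i < k" "l < k" by auto
      have "fits (pp i) (of_mat (S i))" using S(1)[OF il(1)] by (rule fits_of_mat) auto
      then have "tp (centred pp n i z) * of_mat (S i) * idm (pp i) * (of_mat (S i) * centred pp n i z)
          = tp (centred pp n i z) * (of_mat (S i) * of_mat (S i)) * centred pp n i z"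
        by (simp add: mult.assoc)
      then show "tp (centred pp n i z) * of_mat (S i) * (?J i * tp (?J l)) * (of_mat (S l) * centred pp n l z)
          = (if l = i then bproj k pp n z i else 0)"
        using JJ[OF il] il(1) by (auto simp: S(3)[OF il(1)] bproj_def)
    qed
    finally show ?thesis by simp
  qed
  have XX: "X * transpose_mat X \<in> carrier_mat p p"
    using mult_carrier_mat[OF X, of "transpose_mat X" p] X by simp
  have Bc: "D * (X * transpose_mat X) * D \<in> carrier_mat p p"
    by (rule mult_carrier_mat[OF mult_carrier_mat[OF D XX] D])
  have fB: "of_mat (block_corr k pp n x) = of_mat D * (of_mat X * tp (of_mat X)) * of_mat D"
    unfolding B using of_mat_mult[OF mult_carrier_mat[OF D XX] D] of_mat_mult[OF D XX]
      of_mat_mult[OF X, of "transpose_mat X" p] X by (simp add: of_mat_transpose)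
  have "mat_trace (block_corr k pp n x * block_corr k pp n x)
      = tr (of_mat (block_corr k pp n x) * of_mat (block_corr k pp n x))"
    using mat_trace_eq_tr[of "block_corr k pp n x * block_corr k pp n x" p] Bc of_mat_mult[of _ p p _ p]
    unfolding B by simp
  also have "\<dots> = tr ((tp (of_mat D * of_mat X) * (of_mat D * of_mat X)) * (tp (of_mat D * of_mat X) * (of_mat D * of_mat X)))"
    unfolding fB using tr_commute[of "of_mat D * of_mat X" "tp (of_mat X) * of_mat D * (of_mat D * (of_mat X * tp (of_mat X)) * of_mat D)"]
    by (simp add: tD mult.assoc)
  finally show ?thesis
    unfolding schott_stat_def Let_def main z_def by simp
qed

section \<open>The Cramer-Wold device\<close>

text \<open>Divided by its integral, h is a density under which Y has a law on the line, and
  one-dimensional uniqueness applies. The case t = 0 shows that h has the same integral under both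
  measures; if it is 0, both sides vanish.\<close>

lemma char_determines_weighted:
  fixes h Y :: "'b \<Rightarrow> real"
  assumes P: "prob_space \<mu>" "prob_space \<nu>" and sets: "sets \<mu> = sets \<nu>"
    and h: "h \<in> borel_measurable \<mu>" "\<And>z. 0 \<le> h z" "\<And>z. h z \<le> B" and Y: "Y \<in> borel_measurable \<mu>"
    and eq: "\<And>t. (\<integral>z. h z *\<^sub>R iexp (t * Y z) \<partial>\<mu>) = (\<integral>z. h z *\<^sub>R iexp (t * Y z) \<partial>\<nu>)"
    and A: "A \<in> sets borel"
  shows "(\<integral>z. h z * indicator A (Y z) \<partial>\<mu>) = (\<integral>z. h z * indicator A (Y z) \<partial>\<nu>)"
proof -
  have meas: "h \<in> borel_measurable \<nu>" "Y \<in> borel_measurable \<nu>"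
    using h(1) Y by (simp_all add: measurable_cong_sets[OF sets refl])
  define m where "m = (\<integral>z. h z \<partial>\<mu>)"
  have int: "integrable \<kappa> h" and int': "integrable \<kappa> (\<lambda>z. h z * indicator A (Y z))"
    if "prob_space \<kappa>" "h \<in> borel_measurable \<kappa>" "Y \<in> borel_measurable \<kappa>" for \<kappa>
  proof -
    interpret prob_space \<kappa> by fact
    note [measurable] = that(2,3) A
    show "integrable \<kappa> h"
      by (rule integrable_const_bound[of _ B]) (use h in auto)
    then show "integrable \<kappa> (\<lambda>z. h z * indicator A (Y z))"
      by (rule Bochner_Integration.integrable_bound) (auto simp: h indicator_def)
  qed
  have "complex_of_real (\<integral>z. h z \<partial>\<mu>) = complex_of_real (\<integral>z. h z \<partial>\<nu>)"
    using eq[of 0] int[OF P(1) h(1) Y] int[OF P(2) meas]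
    by (simp add: scaleR_conv_of_real)
  then have m': "m = (\<integral>z. h z \<partial>\<nu>)" by (simp add: m_def)
  have m0: "0 \<le> m" unfolding m_def by (rule Bochner_Integration.integral_nonneg) (rule h)
  show ?thesis
  proof (cases "m = 0")
    case True
    have "(\<integral>z. h z * indicator A (Y z) \<partial>\<kappa>) = 0"
      if "prob_space \<kappa>" "h \<in> borel_measurable \<kappa>" "Y \<in> borel_measurable \<kappa>" "(\<integral>z. h z \<partial>\<kappa>) = 0" for \<kappa>
    proof -
      have "(\<integral>z. h z * indicator A (Y z) \<partial>\<kappa>) \<le> (\<integral>z. h z \<partial>\<kappa>)"
        by (intro integral_mono int int' that) (auto simp: h indicator_def)
      moreover have "0 \<le> (\<integral>z. h z * indicator A (Y z) \<partial>\<kappa>)"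
        by (rule Bochner_Integration.integral_nonneg) (simp add: h)
      ultimately show ?thesis using that(4) by simp
    qed
    then show ?thesis using P h(1) Y meas True m' m_def by metis
  next
    case False
    then have m: "0 < m" using m0 by simp
    define D where "D \<kappa> = distr (density \<kappa> (\<lambda>z. ennreal (h z / m))) borel Y" for \<kappa>
    have D: "real_distribution (D \<kappa>)" "char (D \<kappa>) t = (\<integral>z. h z *\<^sub>R iexp (t * Y z) \<partial>\<kappa>) / of_real m"
      "measure (D \<kappa>) A = (\<integral>z. h z * indicator A (Y z) \<partial>\<kappa>) / m"
      if l: "prob_space \<kappa>" "h \<in> borel_measurable \<kappa>" "Y \<in> borel_measurable \<kappa>" "(\<integral>z. h z \<partial>\<kappa>) = m" for \<kappa> t
    proof -
      note [measurable] = l(2,3) A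
      let ?d = "density \<kappa> (\<lambda>z. ennreal (h z / m))"
      have "emeasure ?d (space ?d) = (\<integral>\<^sup>+z. ennreal (h z / m) \<partial>\<kappa>)"
        by (subst emeasure_density) (auto intro!: nn_integral_cong)
      also have "\<dots> = ennreal (\<integral>z. h z / m \<partial>\<kappa>)"
        using int[OF l(1-3)] m h by (intro nn_integral_eq_integral) auto
      also have "(\<integral>z. h z / m \<partial>\<kappa>) = 1" using l(4) m by simp
      finally have pd: "prob_space ?d" by (intro prob_spaceI) simp
      have "prob_space (D \<kappa>)"
        unfolding D_def by (rule prob_space.prob_space_distr[OF pd]) simp
      then show rd: "real_distribution (D \<kappa>)"
        by (simp add: real_distribution_def real_distribution_axioms_def D_def)
      have "char (D \<kappa>) t = (\<integral>z. iexp (t * Y z) \<partial>?d)"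
        unfolding char_def D_def by (rule integral_distr) auto
      also have "\<dots> = (\<integral>z. (h z / m) *\<^sub>R iexp (t * Y z) \<partial>\<kappa>)"
        by (rule integral_density) (use h m in auto)
      also have "\<dots> = (\<integral>z. (h z *\<^sub>R iexp (t * Y z)) / of_real m \<partial>\<kappa>)"
        by (simp add: scaleR_conv_of_real)
      finally show "char (D \<kappa>) t = (\<integral>z. h z *\<^sub>R iexp (t * Y z) \<partial>\<kappa>) / of_real m" by simp
      interpret D: real_distribution "D \<kappa>" by (rule rd)
      have "measure (D \<kappa>) A = (\<integral>x. indicator A x \<partial>D \<kappa>)"
        using A by (simp add: D_def)
      also have "\<dots> = (\<integral>z. indicator A (Y z) \<partial>?d)"
        unfolding D_def by (rule integral_distr) auto
      also have "\<dots> = (\<integral>z. (h z / m) *\<^sub>R indicator A (Y z) \<partial>\<kappa>)"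
        by (rule integral_density) (use h m in auto)
      also have "\<dots> = (\<integral>z. (h z * indicator A (Y z)) / m \<partial>\<kappa>)"
        by simp
      finally show "measure (D \<kappa>) A = (\<integral>z. h z * indicator A (Y z) \<partial>\<kappa>) / m" by simp
    qed
    note D\<mu> = D[OF P(1) h(1) Y m_def[symmetric]] and D\<nu> = D[OF P(2) meas m'[symmetric]]
    have "D \<mu> = D \<nu>"
      by (rule Levy_uniqueness[OF D\<mu>(1) D\<nu>(1)]) (intro ext, simp only: D\<mu>(2) D\<nu>(2) eq)
    then show ?thesis using D\<mu>(3) D\<nu>(3) m by simp
  qed
qed

lemma integral_add_divide:
  fixes f g h :: "'b \<Rightarrow> complex"
  assumes "integrable M f" "integrable M g" "integrable M h"
  shows "(\<integral>z. f z + (g z + h z) / c \<partial>M) = (\<integral>z. f z \<partial>M) + ((\<integral>z. g z \<partial>M) + (\<integral>z. h z \<partial>M)) / c"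
    "(\<integral>z. f z + (g z - h z) / c \<partial>M) = (\<integral>z. f z \<partial>M) + ((\<integral>z. g z \<partial>M) - (\<integral>z. h z \<partial>M)) / c"
  using assms by simp_all

lemma integral_complex_parts:
  fixes a b c :: "'b \<Rightarrow> real"
  assumes "integrable M a" "integrable M b" "integrable M c"
  shows "(\<integral>z. complex_of_real (a z - b z) + \<i> * of_real (c z - b z) \<partial>M)
    = of_real ((\<integral>z. a z \<partial>M) - (\<integral>z. b z \<partial>M)) + \<i> * of_real ((\<integral>z. c z \<partial>M) - (\<integral>z. b z \<partial>M))"
  using assms by simp

text \<open>Indicators replace exponentials one coordinate at a time: the weights 1, $1 + \cos$ and $1 + \sin$ are
  nonnegative, so one-dimensional uniqueness applies to the weighted measures.\<close>

theorem cramer_wold: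
  fixes \<mu> \<nu> :: "('i \<Rightarrow> real) measure"
  assumes I: "finite I" and P: "prob_space \<mu>" "prob_space \<nu>"
    and sets: "sets \<mu> = sets (PiM I (\<lambda>_. borel))" "sets \<nu> = sets (PiM I (\<lambda>_. borel))"
    and eq: "\<And>c. (\<integral>z. iexp (\<Sum>i\<in>I. c i * z i) \<partial>\<mu>) = (\<integral>z. iexp (\<Sum>i\<in>I. c i * z i) \<partial>\<nu>)"
  shows "\<mu> = \<nu>"
proof -
  have sets': "sets \<mu> = sets \<nu>" using sets by simp
  have comp: "(\<lambda>z. z i) \<in> borel_measurable \<mu>" "(\<lambda>z. z i) \<in> borel_measurable \<nu>" if "i \<in> I" for i
    using that by (simp_all add: measurable_cong_sets[OF sets(1) refl] measurable_cong_sets[OF sets(2) refl])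
  define W where "W J A z = (\<Prod>i\<in>J. indicator (A i) (z i) :: real)" for J and A :: "'i \<Rightarrow> real set" and z
  have W01: "0 \<le> W J A z" "W J A z \<le> 1" for J A z
    unfolding W_def by (auto intro!: prod_nonneg prod_le_1)
  have Wm: "W J A \<in> borel_measurable \<kappa>"
    if "\<kappa> \<in> {\<mu>, \<nu>}" "J \<subseteq> I" "\<And>i. A i \<in> sets borel" for \<kappa> J A
  proof -
    have [measurable]: "A i \<in> sets borel" for i by (rule that(3))
    have [measurable]: "(\<lambda>z. z i) \<in> borel_measurable \<kappa>" if "i \<in> J" for i
      using comp \<open>\<kappa> \<in> {\<mu>, \<nu>}\<close> \<open>J \<subseteq> I\<close> that by auto
    show ?thesis unfolding W_def[abs_def] by measurable
  qed
  have sm: "(\<lambda>z. \<Sum>i\<in>J. c i * z i) \<in> borel_measurable \<kappa>" if "\<kappa> \<in> {\<mu>, \<nu>}" "J \<subseteq> I" for \<kappa> J and c :: "'i \<Rightarrow> real"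
    using comp that by (intro borel_measurable_sum borel_measurable_times) auto
  \<comment> \<open>The induction on \<open>J\<close> leads from the hypothesis, \<open>J\<close>
    empty, to equality on boxes, \<open>J = I\<close>.\<close>
  have claim: "(\<integral>z. W J A z *\<^sub>R iexp (\<Sum>i\<in>I - J. c i * z i) \<partial>\<mu>)
      = (\<integral>z. W J A z *\<^sub>R iexp (\<Sum>i\<in>I - J. c i * z i) \<partial>\<nu>)"
    if "finite J" "J \<subseteq> I" "\<And>i. A i \<in> sets borel" for J A c
    using that
  proof (induction J arbitrary: c rule: finite_induct)
    case empty
    then show ?case using eq by (simp add: W_def)
  next
    case (insert r J)
    have J: "J \<subseteq> I" "r \<in> I" using insert.prems by auto
    have A: "\<And>i. A i \<in> sets borel" by (rule insert.prems)
    define \<theta> where "\<theta> z = (\<Sum>i\<in>I - insert r J. c i * z i)" for z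
    \<comment> \<open>The coefficient at r is free and the phase of the remaining coordinates may be
      scaled by s. The values 0, 1 and -1 of s express the weights 1 + cos and 1 + sin through
      exponentials.\<close>
    have IH: "(\<integral>z. W J A z *\<^sub>R iexp (t * z r + s * \<theta> z) \<partial>\<mu>)
        = (\<integral>z. W J A z *\<^sub>R iexp (t * z r + s * \<theta> z) \<partial>\<nu>)" for t s
    proof -
      have "(\<Sum>i\<in>I - J. (if i = r then t else s * c i) * z i) = t * z r + s * \<theta> z" for z
      proof -
        have "(\<Sum>i\<in>I - J. (if i = r then t else s * c i) * z i)
            = t * z r + (\<Sum>i\<in>I - J - {r}. (if i = r then t else s * c i) * z i)"
          using J insert.hyps I by (subst sum.remove[of _ r]) auto
        also have "(\<Sum>i\<in>I - J - {r}. (if i = r then t else s * c i) * z i) = s * \<theta> z"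
          unfolding \<theta>_def sum_distrib_left by (rule sum.cong) (auto simp: mult.assoc)
        finally show ?thesis .
      qed
      then show ?thesis
        using insert.IH[OF J(1) A, of "\<lambda>i. if i = r then t else s * c i"] by simp
    qed
    have \<theta>m: "\<theta> \<in> borel_measurable \<kappa>" if "\<kappa> \<in> {\<mu>, \<nu>}" for \<kappa>
      unfolding \<theta>_def[abs_def] using that by (rule sm) auto
    have pr: "prob_space \<kappa>" if "\<kappa> \<in> {\<mu>, \<nu>}" for \<kappa> using P that by auto
    have rm: "(\<lambda>z. z r) \<in> borel_measurable \<kappa>" if "\<kappa> \<in> {\<mu>, \<nu>}" for \<kappa> using comp[OF J(2)] that by auto
    define E where "E \<kappa> t s = (\<integral>z. W J A z *\<^sub>R iexp (t * z r + s * \<theta> z) \<partial>\<kappa>)" for \<kappa> t s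
    have Eeq: "E \<mu> t s = E \<nu> t s" for t s unfolding E_def by (rule IH)
    have Ei: "integrable \<kappa> (\<lambda>z. W J A z *\<^sub>R iexp (t * z r + s * \<theta> z))" if l: "\<kappa> \<in> {\<mu>, \<nu>}" for \<kappa> t s
    proof -
      interpret prob_space \<kappa> by (rule pr[OF l])
      note [measurable] = Wm[OF l J(1) A] \<theta>m[OF l] rm[OF l]
      show ?thesis
        by (rule integrable_const_bound[of _ 1]) (auto simp: W01 norm_mult)
    qed
    have iexp_plus: "iexp (x + 1 * y) = iexp x * (of_real (cos y) + \<i> * of_real (sin y))"
      and iexp_minus: "iexp (x + (-1) * y) = iexp x * (of_real (cos y) - \<i> * of_real (sin y))" for x y
    proof -
      have "iexp (x + w) = iexp x * (of_real (cos w) + \<i> * of_real (sin w))" for w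
        unfolding of_real_add distrib_left exp_add by (simp only: exp_Euler cos_of_real sin_of_real distrib_left)
      from this[of "1 * y"] this[of "(-1) * y"]
      show "iexp (x + 1 * y) = iexp x * (of_real (cos y) + \<i> * of_real (sin y))"
        "iexp (x + (-1) * y) = iexp x * (of_real (cos y) - \<i> * of_real (sin y))" by simp_all
    qed
    have c1: "(\<integral>z. (W J A z * (1 + cos (\<theta> z))) *\<^sub>R iexp (t * z r) \<partial>\<kappa>)
        = E \<kappa> t 0 + (E \<kappa> t 1 + E \<kappa> t (-1)) / 2" if l: "\<kappa> \<in> {\<mu>, \<nu>}" for \<kappa> t
    proof -
      have pt: "(W J A z * (1 + cos (\<theta> z))) *\<^sub>R iexp (t * z r)
          = W J A z *\<^sub>R iexp (t * z r + 0 * \<theta> z) + (W J A z *\<^sub>R iexp (t * z r + 1 * \<theta> z)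
            + W J A z *\<^sub>R iexp (t * z r + (-1) * \<theta> z)) / 2" for z
      proof -
        have "iexp (t * z r + 0 * \<theta> z) = iexp (t * z r)" by simp
        then show ?thesis
          unfolding iexp_plus iexp_minus by (simp add: scaleR_conv_of_real algebra_simps)
      qed
      show ?thesis
        unfolding pt E_def by (rule integral_add_divide(1)[OF Ei[OF l] Ei[OF l] Ei[OF l]])
    qed
    have c2: "(\<integral>z. (W J A z * (1 + sin (\<theta> z))) *\<^sub>R iexp (t * z r) \<partial>\<kappa>)
        = E \<kappa> t 0 + (E \<kappa> t 1 - E \<kappa> t (-1)) / (2 * \<i>)" if l: "\<kappa> \<in> {\<mu>, \<nu>}" for \<kappa> t
    proof -
      have pt: "(W J A z * (1 + sin (\<theta> z))) *\<^sub>R iexp (t * z r)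
          = W J A z *\<^sub>R iexp (t * z r + 0 * \<theta> z) + (W J A z *\<^sub>R iexp (t * z r + 1 * \<theta> z)
            - W J A z *\<^sub>R iexp (t * z r + (-1) * \<theta> z)) / (2 * \<i>)" for z
      proof -
        have "iexp (t * z r + 0 * \<theta> z) = iexp (t * z r)" by simp
        then show ?thesis
          unfolding iexp_plus iexp_minus by (simp add: scaleR_conv_of_real field_simps)
      qed
      show ?thesis
        unfolding pt E_def by (rule integral_add_divide(2)[OF Ei[OF l] Ei[OF l] Ei[OF l]])
    qed
    have key: "(\<integral>z. W J A z * g (\<theta> z) * indicator (A r) (z r) \<partial>\<mu>)
        = (\<integral>z. W J A z * g (\<theta> z) * indicator (A r) (z r) \<partial>\<nu>)"
      if g: "g \<in> {\<lambda>x. 1, \<lambda>x. 1 + cos x, \<lambda>x. 1 + sin x}" for g :: "real \<Rightarrow> real"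
    proof (rule char_determines_weighted[OF P sets' _ _ _ rm])
      have gm: "g \<in> borel_measurable borel" using g by auto
      have g02: "0 \<le> g x" "g x \<le> 2" for x
      proof -
        have "0 \<le> 1 + cos x" "1 + cos x \<le> 2" "0 \<le> 1 + sin x" "1 + sin x \<le> 2"
          using cos_ge_minus_one[of x] sin_ge_minus_one[of x] cos_le_one[of x] sin_le_one[of x]
          by linarith+
        then show "0 \<le> g x" "g x \<le> 2" using g by auto
      qed
      show "(\<lambda>z. W J A z * g (\<theta> z)) \<in> borel_measurable \<mu>"
        using Wm[OF _ J(1) A] \<theta>m gm by (intro borel_measurable_times measurable_compose[OF _ gm]) auto
      show "0 \<le> W J A z * g (\<theta> z)" "W J A z * g (\<theta> z) \<le> 1 * 2" for z
        using W01[of J A z] g02[of "\<theta> z"] mult_mono[of "W J A z" 1 "g (\<theta> z)" 2] by auto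
      fix t
      have E0: "(\<integral>z. (W J A z * 1) *\<^sub>R iexp (t * z r) \<partial>\<kappa>) = E \<kappa> t 0" for \<kappa>
        by (simp add: E_def)
      show "(\<integral>z. (W J A z * g (\<theta> z)) *\<^sub>R iexp (t * z r) \<partial>\<mu>)
          = (\<integral>z. (W J A z * g (\<theta> z)) *\<^sub>R iexp (t * z r) \<partial>\<nu>)"
        using g
      proof (elim insertE)
        assume "g = (\<lambda>x. 1)" then show ?thesis using E0 Eeq by simp
      next
        assume "g = (\<lambda>x. 1 + cos x)" then show ?thesis using c1 Eeq by simp
      next
        assume "g = (\<lambda>x. 1 + sin x)" then show ?thesis using c2 Eeq by simp
      qed simp
    qed (use A in auto)
    have Wi: "W (insert r J) A z = W J A z * indicator (A r) (z r)" for z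
      using insert.hyps by (simp add: W_def mult.commute)
    \<comment> \<open>Recovers the exponential from the three nonnegative weights: exp(i \<theta>) =
      (1 + cos \<theta>) - 1 + i ((1 + sin \<theta>) - 1).\<close>
    have split: "(\<integral>z. W (insert r J) A z *\<^sub>R iexp (\<theta> z) \<partial>\<kappa>)
        = of_real ((\<integral>z. W J A z * (1 + cos (\<theta> z)) * indicator (A r) (z r) \<partial>\<kappa>)
            - (\<integral>z. W J A z * 1 * indicator (A r) (z r) \<partial>\<kappa>))
          + \<i> * of_real ((\<integral>z. W J A z * (1 + sin (\<theta> z)) * indicator (A r) (z r) \<partial>\<kappa>)
            - (\<integral>z. W J A z * 1 * indicator (A r) (z r) \<partial>\<kappa>))" if l: "\<kappa> \<in> {\<mu>, \<nu>}" for \<kappa>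
    proof -
      interpret prob_space \<kappa> by (rule pr[OF l])
      note [measurable] = Wm[OF l J(1) A] \<theta>m[OF l] rm[OF l] A
      have i: "integrable \<kappa> (\<lambda>z. W J A z * g (\<theta> z) * indicator (A r) (z r))"
        if "g \<in> borel_measurable borel" "\<And>x. \<bar>g x\<bar> \<le> 2" for g :: "real \<Rightarrow> real"
      proof (rule integrable_const_bound[of _ 2])
        show "AE z in \<kappa>. norm (W J A z * g (\<theta> z) * indicator (A r) (z r)) \<le> 2"
        proof (rule AE_I2)
          fix z
          have "\<bar>W J A z\<bar> * \<bar>g (\<theta> z)\<bar> \<le> 1 * 2"
            using W01[of J A z] that(2) by (intro mult_mono) auto
          then show "norm (W J A z * g (\<theta> z) * indicator (A r) (z r)) \<le> 2"
            by (auto simp: abs_mult indicator_def)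
        qed
        show "(\<lambda>z. W J A z * g (\<theta> z) * indicator (A r) (z r)) \<in> borel_measurable \<kappa>"
          using that(1) by measurable
      qed
      have i1: "integrable \<kappa> (\<lambda>z. W J A z * 1 * indicator (A r) (z r))"
        using i[of "\<lambda>x. 1"] by simp
      have i2: "integrable \<kappa> (\<lambda>z. W J A z * (1 + cos (\<theta> z)) * indicator (A r) (z r))"
      proof (rule i)
        show "\<bar>1 + cos x\<bar> \<le> 2" for x :: real
          using cos_ge_minus_one[of x] cos_le_one[of x] by linarith
      qed measurable
      have i3: "integrable \<kappa> (\<lambda>z. W J A z * (1 + sin (\<theta> z)) * indicator (A r) (z r))"
      proof (rule i)
        show "\<bar>1 + sin x\<bar> \<le> 2" for x :: real
          using sin_ge_minus_one[of x] sin_le_one[of x] by linarith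
      qed measurable
      have pt: "W (insert r J) A z *\<^sub>R iexp (\<theta> z)
          = of_real (W J A z * (1 + cos (\<theta> z)) * indicator (A r) (z r) - W J A z * 1 * indicator (A r) (z r))
          + \<i> * of_real (W J A z * (1 + sin (\<theta> z)) * indicator (A r) (z r) - W J A z * 1 * indicator (A r) (z r))"
        for z
        unfolding Wi exp_Euler cos_of_real sin_of_real
        by (simp add: scaleR_conv_of_real algebra_simps)
      show ?thesis
        unfolding pt by (rule integral_complex_parts[OF i2 i1 i3])
    qed
    show ?case
      unfolding \<theta>_def[symmetric]
      using split[of \<mu>] split[of \<nu>] key[of "\<lambda>x. 1"] key[of "\<lambda>x. 1 + cos x"] key[of "\<lambda>x. 1 + sin x"] by simp
  qed
  have "emeasure \<mu> (Pi\<^sub>E I A) = emeasure \<nu> (Pi\<^sub>E I A)" if A: "\<And>i. i \<in> I \<Longrightarrow> A i \<in> sets borel" for A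
  proof -
    define A' where "A' i = (if i \<in> I then A i else UNIV)" for i
    have A': "A' i \<in> sets borel" for i using A by (simp add: A'_def)
    have W: "W I A' z = indicator (Pi\<^sub>E I A) z" if zs: "z \<in> space (PiM I (\<lambda>_. borel))" for z
    proof -
      have "W I A' z = (\<Prod>i\<in>I. indicator (A i) (z i))"
        unfolding W_def by (rule prod.cong) (auto simp: A'_def)
      also have "\<dots> = indicator (Pi\<^sub>E I A) z"
      proof (cases "z \<in> Pi\<^sub>E I A")
        case False
        then obtain i where i: "i \<in> I" "z i \<notin> A i"
          using zs by (auto simp: space_PiM PiE_def)
        then have "(\<Prod>i\<in>I. indicator (A i) (z i) :: real) = 0"
          using I by (intro prod_zero) (auto intro!: bexI[of _ i])
        then show ?thesis using False by simp
      qed (auto simp: PiE_def Pi_def intro!: prod.neutral)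
      finally show ?thesis .
    qed
    have m: "(\<integral>z. W I A' z *\<^sub>R iexp (\<Sum>i\<in>I - I. c i * z i) \<partial>\<kappa>) = of_real (measure \<kappa> (Pi\<^sub>E I A))"
      if "sets \<kappa> = sets (PiM I (\<lambda>_. borel))" "prob_space \<kappa>" for \<kappa> and c :: "'i \<Rightarrow> real"
    proof -
      interpret prob_space \<kappa> by fact
      have sp: "space \<kappa> = space (PiM I (\<lambda>_. borel))" using that(1) by (rule sets_eq_imp_space_eq)
      have "Pi\<^sub>E I A \<in> sets \<kappa>" unfolding that(1) using I A by (intro sets_PiM_I_finite) auto
      then have "(\<integral>z. indicator (Pi\<^sub>E I A) z \<partial>\<kappa>) = measure \<kappa> (Pi\<^sub>E I A)"
        using sets.sets_into_space by (simp add: Int_absorb2)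
      moreover have "(\<integral>z. W I A' z *\<^sub>R iexp (\<Sum>i\<in>I - I. c i * z i) \<partial>\<kappa>)
          = (\<integral>z. of_real (indicator (Pi\<^sub>E I A) z) \<partial>\<kappa>)"
        by (rule Bochner_Integration.integral_cong) (simp_all add: W sp scaleR_conv_of_real)
      ultimately show ?thesis by simp
    qed
    have "measure \<mu> (Pi\<^sub>E I A) = measure \<nu> (Pi\<^sub>E I A)"
      using claim[OF I order_refl, of A' "\<lambda>_. 0", OF A'] unfolding m[OF sets(1) P(1)] m[OF sets(2) P(2)] by simp
    then show ?thesis
      using P by (simp add: finite_measure.emeasure_eq_measure prob_space.finite_measure)
  qed
  then show ?thesis
    using I sets P
    by (intro measure_eqI_PiM_finite[of I \<mu> "\<lambda>_. borel" \<nu> "\<lambda>_. space (PiM I (\<lambda>_. borel))"])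
      (auto simp: space_PiM prod_algebraI_finite prob_space.finite_measure finite_measure.emeasure_finite)
qed

section \<open>Normal characteristic functions\<close>

lemma (in prob_space) normal_iexp:
  assumes L: "distributed M lborel L (normal_density m \<sigma>)" and \<sigma>: "0 < \<sigma>"
  shows "(\<integral>w. iexp (L w) \<partial>M) = exp (\<i> * of_real m - of_real (\<sigma>\<^sup>2 / 2))"
proof -
  let ?Z = "\<lambda>w. (L w - m) / \<sigma>"
  have Z: "distributed M lborel ?Z std_normal_density"
    using L normal_standard_normal_convert[OF \<sigma>] by simp
  then have [measurable]: "?Z \<in> borel_measurable M" by (auto simp: distributed_def)
  have "distr M borel ?Z = distr M lborel ?Z" by (rule distr_cong) auto
  also have "\<dots> = std_normal_distribution" using Z by (simp add: distributed_def)
  finally have D: "distr M borel ?Z = std_normal_distribution" .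
  have "(\<integral>w. iexp (\<sigma> * ?Z w) \<partial>M) = char (distr M borel ?Z) \<sigma>"
    unfolding char_def by (rule integral_distr[symmetric]) auto
  also have "\<dots> = of_real (exp (- (\<sigma>\<^sup>2) / 2))"
    unfolding D char_std_normal_distribution ..
  finally have c: "(\<integral>w. iexp (\<sigma> * ?Z w) \<partial>M) = of_real (exp (- (\<sigma>\<^sup>2) / 2))" .
  have "iexp (L w) = iexp m * iexp (\<sigma> * ?Z w)" for w
    using \<sigma> by (simp add: exp_add[symmetric] ring_distribs[symmetric] of_real_add[symmetric]
        del: of_real_add of_real_diff of_real_divide)
  then have "(\<integral>w. iexp (L w) \<partial>M) = iexp m * (\<integral>w. iexp (\<sigma> * ?Z w) \<partial>M)"
    by simp
  also have "\<dots> = exp (\<i> * of_real m - of_real (\<sigma>\<^sup>2 / 2))"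
    unfolding c by (simp add: exp_of_real[symmetric] exp_add[symmetric])
  finally show ?thesis .
qed

lemma measurable_nested_component:
  assumes "a \<in> A" "b \<in> B"
  shows "(\<lambda>f. f a b :: real) \<in> borel_measurable (PiM A (\<lambda>_. PiM B (\<lambda>_. borel)))"
proof -
  have "(\<lambda>f. f a) \<in> measurable (PiM A (\<lambda>_. PiM B (\<lambda>_. borel :: real measure))) (PiM B (\<lambda>_. borel))"
    by (rule measurable_component_singleton[OF assms(1)])
  from measurable_compose[OF this measurable_component_singleton[OF assms(2)]] show ?thesis .
qed

section \<open>Normal samples\<close>

definition quad :: "nat \<Rightarrow> (nat \<Rightarrow> nat \<Rightarrow> real) \<Rightarrow> (nat \<Rightarrow> real) \<Rightarrow> real" where
  "quad p S c = (\<Sum>r<p. \<Sum>s<p. c r * S r s * c s)"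

text \<open>The first d + 1 observations of d consecutive coordinates, bordered by a column of ones:
  the determinant vanishes exactly when these points are affinely dependent.\<close>

definition affine_mat :: "nat \<Rightarrow> nat \<Rightarrow> (nat \<Rightarrow> nat \<Rightarrow> real) \<Rightarrow> real mat" where
  "affine_mat o' d f = mat (Suc d) (Suc d) (\<lambda>(j, c). if c = 0 then 1 else f j (o' + c - 1))"

lemma affine_mat_carrier [simp]: "affine_mat o' d f \<in> carrier_mat (Suc d) (Suc d)"
  by (simp add: affine_mat_def)

lemma mat_delete_affine:
  "mat_delete (affine_mat o' (Suc d) f) (Suc d) (Suc d) = affine_mat o' d f"
  by (rule eq_matI) (auto simp: mat_delete_def affine_mat_def)

text \<open>The cofactors along the last row do not see the last observation; they are functions of
  the earlier ones and so independent of it.\<close>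

lemma cofactor_affine_cong:
  assumes "c < Suc (Suc d)"
    "\<And>j r. j \<le> d \<Longrightarrow> o' \<le> r \<Longrightarrow> r \<le> o' + d \<Longrightarrow> f j r = g j r"
  shows "cofactor (affine_mat o' (Suc d) f) (Suc d) c = cofactor (affine_mat o' (Suc d) g) (Suc d) c"
proof -
  have "mat_delete (affine_mat o' (Suc d) f) (Suc d) c = mat_delete (affine_mat o' (Suc d) g) (Suc d) c"
    by (rule eq_matI) (use assms in \<open>auto simp: mat_delete_def affine_mat_def\<close>)
  then show ?thesis by (simp add: cofactor_def)
qed

lemma det_affine_Suc:
  "det (affine_mat o' (Suc d) f) = cofactor (affine_mat o' (Suc d) f) (Suc d) 0
    + (\<Sum>a<Suc d. f (Suc d) (o' + a) * cofactor (affine_mat o' (Suc d) f) (Suc d) (Suc a))"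
proof -
  have "det (affine_mat o' (Suc d) f) = (\<Sum>c<Suc (Suc d). affine_mat o' (Suc d) f $$ (Suc d, c)
      * cofactor (affine_mat o' (Suc d) f) (Suc d) c)"
    by (rule laplace_expansion_row) auto
  also have "\<dots> = affine_mat o' (Suc d) f $$ (Suc d, 0) * cofactor (affine_mat o' (Suc d) f) (Suc d) 0
      + (\<Sum>a<Suc d. affine_mat o' (Suc d) f $$ (Suc d, Suc a)
          * cofactor (affine_mat o' (Suc d) f) (Suc d) (Suc a))"
    by (rule sum.lessThan_Suc_shift)
  also have "\<dots> = cofactor (affine_mat o' (Suc d) f) (Suc d) 0
      + (\<Sum>a<Suc d. f (Suc d) (o' + a) * cofactor (affine_mat o' (Suc d) f) (Suc d) (Suc a))"
    by (intro arg_cong2[where f = "(+)"] sum.cong) (auto simp: affine_mat_def)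
  finally show ?thesis .
qed

text \<open>A vector annihilated by the Gram matrix is constant along the observations, hence gives an
  affine dependence between any $p_i + 1$ of them.\<close>

lemma gram_nonsingular:
  assumes "pp i < n"
    and "det (affine_mat (blk_off pp i) (pp i) (\<lambda>j r. z (j, r))) \<noteq> 0"
  shows "det (to_mat (pp i) (gram pp n i z)) \<noteq> 0"
proof
  let ?d = "pp i" and ?o = "blk_off pp i"
  let ?Y = "centred pp n i z"
  assume "det (to_mat ?d (gram pp n i z)) = 0"
  then obtain v where v: "v \<in> carrier_vec ?d" "v \<noteq> 0\<^sub>v ?d" "to_mat ?d (gram pp n i z) *\<^sub>v v = 0\<^sub>v ?d"
    using det_0_iff_vec_prod_zero[OF to_mat_carrier, of ?d "gram pp n i z"] by auto
  define X where "X = fcut ?d ?d (\<lambda>r s. if s = 0 then v $ r else 0)"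
  have d: "0 < ?d" using v by (cases ?d) auto
  have "gram pp n i z * X = 0"
  proof (rule fmat_eqI)
    fix r s
    have e: "ent (gram pp n i z * X) r s = (\<Sum>c<?d. ent (gram pp n i z) r c * ent X c s)"
      by (rule ent_mult_left[OF fits_gram])
    show "ent (gram pp n i z * X) r s = ent 0 r s"
    proof (cases "r < ?d \<and> s = 0")
      case True
      have "(\<Sum>c<?d. ent (gram pp n i z) r c * ent X c s) = (to_mat ?d (gram pp n i z) *\<^sub>v v) $ r"
        using True d v(1)
        by (auto simp: to_mat_def X_def ent_fcut scalar_prod_def atLeast0LessThan intro!: sum.cong)
      then show ?thesis using e v(3) True by (simp add: ent_ring)
    next
      case False
      then have "ent (gram pp n i z) r c * ent X c s = 0" for c
        using fits_gram[of pp i n z] by (auto simp: fits_def X_def ent_fcut not_less)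
      then have "(\<Sum>c<?d. ent (gram pp n i z) r c * ent X c s) = 0"
        by (intro sum.neutral ballI)
      then show ?thesis using e by (simp add: ent_ring)
    qed
  qed
  then have "tr (tp X * (gram pp n i z * X)) = 0" by simp
  then have "fro2 (tp ?Y * X) = 0" by (simp add: fro2_def gram_def mult.assoc)
  then have YX: "tp ?Y * X = 0" by (rule fro2_eq_zero)
  define avg where "avg a = (\<Sum>m<n. z (m, ?o + a)) / real n" for a
  define \<kappa> where "\<kappa> = (\<Sum>a<?d. avg a * v $ a)"
  have const: "(\<Sum>a<?d. z (l, ?o + a) * v $ a) = \<kappa>" if l: "l < n" for l
  proof -
    have "ent (tp ?Y * X) l 0 = (\<Sum>a<?d. ent ?Y a l * ent X a 0)"
      using ent_mult_right[of ?d X "tp ?Y" l 0] by (simp add: X_def ent_tp)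
    also have "\<dots> = (\<Sum>a<?d. z (l, ?o + a) * v $ a - avg a * v $ a)"
      using l d by (intro sum.cong refl) (simp add: ent_centred X_def ent_fcut avg_def left_diff_distrib)
    also have "\<dots> = (\<Sum>a<?d. z (l, ?o + a) * v $ a) - \<kappa>"
      by (simp add: sum_subtractf \<kappa>_def)
    finally show ?thesis by (simp add: YX ent_ring)
  qed
  let ?A = "affine_mat ?o ?d (\<lambda>j r. z (j, r))"
  define u where "u = vec (Suc ?d) (\<lambda>c. if c = 0 then - \<kappa> else v $ (c - 1))"
  have "?A *\<^sub>v u = 0\<^sub>v (Suc ?d)"
  proof (rule eq_vecI)
    fix j assume j: "j < dim_vec (0\<^sub>v (Suc ?d))"
    have "(?A *\<^sub>v u) $ j = (\<Sum>c<Suc ?d. (if c = 0 then 1 else z (j, ?o + c - 1)) * (if c = 0 then - \<kappa> else v $ (c - 1)))"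
      using j by (auto simp: affine_mat_def u_def scalar_prod_def atLeast0LessThan intro!: sum.cong)
    also have "\<dots> = - \<kappa> + (\<Sum>a<?d. z (j, ?o + a) * v $ a)"
      by (subst sum.lessThan_Suc_shift) simp
    also have "\<dots> = 0" using const[of j] j assms(1) by simp
    finally show "(?A *\<^sub>v u) $ j = 0\<^sub>v (Suc ?d) $ j" using j by simp
  qed (simp add: affine_mat_def)
  moreover have "u \<noteq> 0\<^sub>v (Suc ?d)"
  proof
    assume u: "u = 0\<^sub>v (Suc ?d)"
    have "v $ a = 0" if "a < ?d" for a
      using arg_cong[OF u, of "\<lambda>u. u $ Suc a"] that by (simp add: u_def)
    then have "v = 0\<^sub>v ?d" using v(1) by (intro eq_vecI) auto
    with v(2) show False by simp
  qed
  moreover have "u \<in> carrier_vec (Suc ?d)" by (simp add: u_def)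
  ultimately have "det ?A = 0"
    using det_0_iff_vec_prod_zero[OF affine_mat_carrier] by blast
  with assms(2) show False by simp
qed

locale normal_sample = prob_space M for M :: "'a measure" +
  fixes n k :: nat and pp :: "nat \<Rightarrow> nat" and x :: "nat \<Rightarrow> 'a \<Rightarrow> nat \<Rightarrow> real"
    and \<mu> :: "nat \<Rightarrow> real" and \<Sigma> :: "nat \<Rightarrow> nat \<Rightarrow> real"
  assumes indep: "indep_vars (\<lambda>_. PiM {..<blk_off pp k} (\<lambda>_. borel))
      (\<lambda>j w. restrict (x j w) {..<blk_off pp k}) {..<n}"
    and normal: "\<And>j. j < n \<Longrightarrow> mvn M (blk_off pp k) (x j) \<mu> \<Sigma>"
    and posdef: "\<And>c. (\<exists>r < blk_off pp k. c r \<noteq> 0) \<Longrightarrow>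
        0 < (\<Sum>r<blk_off pp k. \<Sum>s<blk_off pp k. c r * \<Sigma> r s * c s)"
    and null: "\<And>r s. r < blk_off pp k \<Longrightarrow> s < blk_off pp k \<Longrightarrow> blk_of pp r \<noteq> blk_of pp s \<Longrightarrow> \<Sigma> r s = 0"
begin

abbreviation "p \<equiv> blk_off pp k"

lemma linear_combination:
  fixes c :: "nat \<Rightarrow> real"
  assumes j: "j < n"
  shows "(\<lambda>w. \<Sum>r<p. c r * x j w r) \<in> borel_measurable M"
    "(\<integral>w. iexp (\<Sum>r<p. c r * x j w r) \<partial>M)
      = exp (\<i> * of_real (\<Sum>r<p. c r * \<mu> r) - of_real (quad p \<Sigma> c / 2))"
    "\<exists>r<p. c r \<noteq> 0 \<Longrightarrow> AE w in M. (\<Sum>r<p. c r * x j w r) \<noteq> a"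
proof -
  let ?L = "\<lambda>w. \<Sum>r<p. c r * x j w r" and ?m = "\<Sum>r<p. c r * \<mu> r" and ?v = "quad p \<Sigma> c"
  have mvn: "if ?v = 0 then ?L \<in> borel_measurable M \<and> (AE w in M. ?L w = ?m)
      else distributed M lborel ?L (normal_density ?m (sqrt ?v))"
    using normal[OF j] unfolding mvn_def Let_def quad_def by blast
  have v: "?v \<noteq> 0 \<Longrightarrow> 0 < ?v"
  proof -
    assume "?v \<noteq> 0"
    moreover have "?v = 0" if "\<not> (\<exists>r<p. c r \<noteq> 0)" using that by (simp add: quad_def)
    ultimately have "\<exists>r<p. c r \<noteq> 0" by blast
    then show "0 < ?v" unfolding quad_def by (rule posdef)
  qed
  show L: "?L \<in> borel_measurable M"
  proof (cases "?v = 0")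
    case False
    then have "distributed M lborel ?L (normal_density ?m (sqrt ?v))" using mvn by simp
    then show ?thesis by (auto simp: distributed_def)
  qed (use mvn in simp)
  show "(\<integral>w. iexp (?L w) \<partial>M) = exp (\<i> * of_real ?m - of_real (?v / 2))"
  proof (cases "?v = 0")
    case True
    then have "AE w in M. ?L w = ?m" using mvn by simp
    then have "(\<integral>w. iexp (?L w) \<partial>M) = (\<integral>w. iexp ?m \<partial>M)"
    proof (intro integral_cong_AE)
      show "(\<lambda>w. iexp (?L w)) \<in> borel_measurable M"
        by (rule measurable_compose[OF L, of "\<lambda>x. iexp x"]) measurable
      assume "AE w in M. ?L w = ?m"
      then show "AE w in M. iexp (?L w) = iexp ?m"
        by eventually_elim (simp only:)
    qed measurable
    then show ?thesis using True by (simp add: prob_space)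
  next
    case False
    have D: "distributed M lborel ?L (normal_density ?m (sqrt ?v))" using mvn False by simp
    have "0 < sqrt ?v" "(sqrt ?v)\<^sup>2 = ?v" using v[OF False] by auto
    then show ?thesis using normal_iexp[OF D] by (simp only:)
  qed
  assume "\<exists>r<p. c r \<noteq> 0"
  then have "0 < ?v" unfolding quad_def by (rule posdef)
  then have D: "distributed M lborel ?L (normal_density ?m (sqrt ?v))" using mvn by simp
  have "AE y in lborel. y \<noteq> a"
    by (rule AE_lborel_singleton)
  then have "AE y in density lborel (normal_density ?m (sqrt ?v)). y \<noteq> a"
    by (subst AE_density) (auto elim: eventually_mono)
  moreover have "distr M lborel ?L = density lborel (normal_density ?m (sqrt ?v))"
    using D by (simp add: distributed_def)
  ultimately have "AE y in distr M lborel ?L. y \<noteq> a"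
    by (simp only:)
  then show "AE w in M. ?L w \<noteq> a"
    using L by (subst (asm) AE_distr_iff) auto
qed

lemma coordinate_measurable:
  assumes "j < n" "r < p"
  shows "(\<lambda>w. x j w r) \<in> borel_measurable M"
proof -
  have "(\<lambda>w. \<Sum>s<p. (if r = s then 1 else 0) * x j w s) \<in> borel_measurable M"
    by (rule linear_combination(1)[OF assms(1)])
  then show ?thesis using assms(2) by (simp add: sum_delta_mult)
qed

lemma joint_iexp:
  fixes c :: "nat \<Rightarrow> nat \<Rightarrow> real"
  shows "(\<integral>w. iexp (\<Sum>j<n. \<Sum>r<p. c j r * x j w r) \<partial>M)
    = exp (\<i> * of_real (\<Sum>j<n. \<Sum>r<p. c j r * \<mu> r) - of_real ((\<Sum>j<n. quad p \<Sigma> (c j)) / 2))"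
proof -
  let ?L = "\<lambda>j w. \<Sum>r<p. c j r * x j w r"
  have "indep_vars (\<lambda>_. borel) (\<lambda>j w. (\<lambda>f. \<Sum>r<p. c j r * f r) (restrict (x j w) {..<p})) {..<n}"
    by (rule indep_vars_compose2[OF indep]) measurable
  then have ind: "indep_vars (\<lambda>_. borel) ?L {..<n}" by simp
  have char1: "char (distr M borel f) 1 = (\<integral>w. iexp (f w) \<partial>M)" if "f \<in> borel_measurable M" for f :: "'a \<Rightarrow> real"
    unfolding char_def using integral_distr[OF that, of "\<lambda>x. iexp (1 * x)"] by simp
  have m: "(\<lambda>w. \<Sum>j<n. ?L j w) \<in> borel_measurable M"
    by (intro borel_measurable_sum linear_combination(1)) auto
  have "(\<integral>w. iexp (\<Sum>j<n. ?L j w) \<partial>M) = char (distr M borel (\<lambda>w. \<Sum>j<n. ?L j w)) 1"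
    by (rule char1[OF m, symmetric])
  also have "\<dots> = (\<Prod>j<n. char (distr M borel (?L j)) 1)"
    by (rule char_distr_sum[OF ind])
  also have "\<dots> = (\<Prod>j<n. exp (\<i> * of_real (\<Sum>r<p. c j r * \<mu> r) - of_real (quad p \<Sigma> (c j) / 2)))"
    by (intro prod.cong refl) (simp only: char1 linear_combination lessThan_iff)
  also have "\<dots> = exp (\<Sum>j<n. \<i> * of_real (\<Sum>r<p. c j r * \<mu> r) - of_real (quad p \<Sigma> (c j) / 2))"
    by (simp add: exp_sum)
  also have "(\<Sum>j<n. \<i> * of_real (\<Sum>r<p. c j r * \<mu> r) - of_real (quad p \<Sigma> (c j) / 2))
      = \<i> * of_real (\<Sum>j<n. \<Sum>r<p. c j r * \<mu> r) - of_real ((\<Sum>j<n. quad p \<Sigma> (c j)) / 2)"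
    by (simp add: sum_subtractf sum_distrib_left sum_divide_distrib)
  finally show ?thesis .
qed

section \<open>The joint law of the sample and its rotation invariance\<close>

definition index :: "(nat \<times> nat) set" where "index = {..<n} \<times> {..<p}"

definition sample :: "'a \<Rightarrow> nat \<times> nat \<Rightarrow> real" where
  "sample w = (\<lambda>(j, r)\<in>index. x j w r)"

text \<open>Rotations act on arrays and need not lift to maps of the original sample space, so the
  model is set up on the space of arrays.\<close>

definition law :: "(nat \<times> nat \<Rightarrow> real) measure" where
  "law = distr M (PiM index (\<lambda>_. borel)) sample"

lemma sample_measurable: "sample \<in> measurable M (PiM index (\<lambda>_. borel))"
  unfolding sample_def by (rule measurable_restrict) (auto simp: index_def coordinate_measurable)

lemma sets_law: "sets law = sets (PiM index (\<lambda>_. borel))"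
  by (simp add: law_def)

lemma prob_space_law: "prob_space law"
  unfolding law_def by (rule prob_space_distr[OF sample_measurable])

lemma law_component: "i \<in> index \<Longrightarrow> (\<lambda>z. z i) \<in> borel_measurable law"
  by (simp add: measurable_cong_sets[OF sets_law refl])

text \<open>It suffices to compare characteristic functions of linear combinations, which depend on
  the coefficients through a mean and a quadratic form. The mean is kept because the columns of
  \<open>R\<close> sum to 1, the quadratic form because \<open>R\<close> is orthogonal and different
  blocks are uncorrelated.\<close>

lemma law_rotate:
  assumes j: "j < k" and R: "rotation n R"
  shows "rotate_data pp k n j R \<in> measurable law law" "distr law law (rotate_data pp k n j R) = law"
proof -
  let ?\<rho> = "rotate_data pp k n j R"
  have "?\<rho> \<in> measurable (PiM index (\<lambda>_. borel)) (PiM index (\<lambda>_. borel))"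
    unfolding rotate_data_def[abs_def] index_def[symmetric]
  proof (rule measurable_restrict)
    fix i assume "i \<in> index"
    then obtain l r where i: "i = (l, r)" "l < n" "r < p" by (auto simp: index_def)
    have [measurable]: "(\<lambda>z. z (m, r)) \<in> borel_measurable (PiM index (\<lambda>_. borel))" if "m < n" for m
      using that i by (intro measurable_component_singleton) (simp add: index_def)
    show "(\<lambda>z. case i of (l, r) \<Rightarrow> if blk_of pp r = j then \<Sum>m<n. z (m, r) * ent R m l else z (l, r))
        \<in> borel_measurable (PiM index (\<lambda>_. borel))"
      using i by (cases "blk_of pp r = j") (auto intro!: borel_measurable_sum borel_measurable_times)
  qed
  then show m: "?\<rho> \<in> measurable law law"
    by (simp add: measurable_cong_sets[OF sets_law sets_law])
  have m\<rho>: "?\<rho> \<in> measurable law (PiM index (\<lambda>_. borel))"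
    using m by (simp add: measurable_cong_sets[OF refl sets_law])
  have fin: "finite index" by (simp add: index_def)
  have "distr law (PiM index (\<lambda>_. borel)) ?\<rho> = law"
  proof (rule cramer_wold[OF fin])
    show "prob_space (distr law (PiM index (\<lambda>_. borel)) ?\<rho>)"
      by (rule prob_space.prob_space_distr[OF prob_space_law m\<rho>])
    fix c :: "nat \<times> nat \<Rightarrow> real"
    have sm: "(\<lambda>z. \<Sum>i\<in>index. c i * z i) \<in> borel_measurable (PiM index (\<lambda>_. borel))" for c :: "nat \<times> nat \<Rightarrow> real"
      by measurable
    have im: "(\<lambda>z. iexp (\<Sum>i\<in>index. c i * z i)) \<in> borel_measurable (PiM index (\<lambda>_. borel))" for c :: "nat \<times> nat \<Rightarrow> real"
      using sm by measurable
    \<comment> \<open>The adjoint of the rotation, moved from the data to the coefficients.\<close>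
    define c' where "c' m r = (if blk_of pp r = j then \<Sum>l<n. c (l, r) * ent R m l else c (m, r))" for m r
    have ex: "(\<integral>z. iexp (\<Sum>i\<in>index. e i * z i) \<partial>law)
        = exp (\<i> * of_real (\<Sum>l<n. \<Sum>r<p. e (l, r) * \<mu> r) - of_real ((\<Sum>l<n. quad p \<Sigma> (\<lambda>r. e (l, r))) / 2))"
      for e :: "nat \<times> nat \<Rightarrow> real"
    proof -
      have "(\<integral>z. iexp (\<Sum>i\<in>index. e i * z i) \<partial>law) = (\<integral>w. iexp (\<Sum>i\<in>index. e i * sample w i) \<partial>M)"
        unfolding law_def by (rule integral_distr[OF sample_measurable im])
      also have "\<dots> = (\<integral>w. iexp (\<Sum>l<n. \<Sum>r<p. e (l, r) * x l w r) \<partial>M)"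
      proof -
        have "(\<Sum>i\<in>index. e i * sample w i) = (\<Sum>l<n. \<Sum>r<p. e (l, r) * x l w r)" for w
          unfolding index_def sum.cartesian_product by (rule sum.cong) (auto simp: sample_def index_def)
        then show ?thesis by simp
      qed
      finally show ?thesis using joint_iexp[of "\<lambda>l r. e (l, r)"] by simp
    qed
    have rot: "(\<Sum>i\<in>index. c i * ?\<rho> z i) = (\<Sum>i\<in>index. (case i of (m, r) \<Rightarrow> c' m r) * z i)" for z
    proof -
      have "(\<Sum>i\<in>index. c i * ?\<rho> z i) = (\<Sum>r<p. \<Sum>l<n. c (l, r) *
          (if blk_of pp r = j then \<Sum>m<n. z (m, r) * ent R m l else z (l, r)))"
      proof -
        have "(\<Sum>i\<in>index. c i * ?\<rho> z i) = (\<Sum>l<n. \<Sum>r<p. c (l, r) *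
          (if blk_of pp r = j then \<Sum>m<n. z (m, r) * ent R m l else z (l, r)))"
          unfolding index_def sum.cartesian_product
          by (rule sum.cong) (auto simp: rotate_data_def)
        then show ?thesis by (simp only: sum.swap[of _ "{..<p}" "{..<n}"])
      qed
      also have "\<dots> = (\<Sum>r<p. \<Sum>m<n. c' m r * z (m, r))"
      proof (rule sum.cong[OF refl])
        fix r
        show "(\<Sum>l<n. c (l, r) * (if blk_of pp r = j then \<Sum>m<n. z (m, r) * ent R m l else z (l, r)))
            = (\<Sum>m<n. c' m r * z (m, r))"
        proof (cases "blk_of pp r = j")
          case True
          have "(\<Sum>l<n. c (l, r) * (\<Sum>m<n. z (m, r) * ent R m l))
              = (\<Sum>l<n. \<Sum>m<n. c (l, r) * ent R m l * z (m, r))"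
            by (simp add: sum_distrib_left mult_ac)
          also have "\<dots> = (\<Sum>m<n. \<Sum>l<n. c (l, r) * ent R m l * z (m, r))"
            by (rule sum.swap)
          finally show ?thesis using True by (simp add: c'_def sum_distrib_right)
        qed (simp add: c'_def)
      qed
      also have "\<dots> = (\<Sum>m<n. \<Sum>r<p. c' m r * z (m, r))"
        by (rule sum.swap)
      also have "\<dots> = (\<Sum>i\<in>index. (case i of (m, r) \<Rightarrow> c' m r) * z i)"
        unfolding index_def sum.cartesian_product by (rule sum.cong) auto
      finally show ?thesis .
    qed
    have R': "fits n R" "tp R * R = idm n" "\<And>l. l < n \<Longrightarrow> (\<Sum>m<n. ent R m l) = 1"
      using R by (auto simp: rotation_def)
    have RR: "(\<Sum>m<n. ent R m l * ent R m l') = (if l = l' then 1 else 0)" if "l < n" "l' < n" for l l'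
      using arg_cong[OF R'(2), of "\<lambda>A. ent A l l'"] R'(1) that
      by (simp add: ent_mult_right[of n] ent_tp idm_def ent_fcut)
    have mean: "(\<Sum>m<n. \<Sum>r<p. c' m r * \<mu> r) = (\<Sum>l<n. \<Sum>r<p. c (l, r) * \<mu> r)"
    proof -
      have "(\<Sum>m<n. c' m r) = (\<Sum>l<n. c (l, r))" for r
      proof (cases "blk_of pp r = j")
        case True
        have "(\<Sum>m<n. \<Sum>l<n. c (l, r) * ent R m l) = (\<Sum>l<n. \<Sum>m<n. c (l, r) * ent R m l)"
          by (rule sum.swap)
        also have "\<dots> = (\<Sum>l<n. c (l, r))"
          by (intro sum.cong refl) (simp add: sum_distrib_left[symmetric] R'(3))
        finally show ?thesis using True by (simp add: c'_def)
      qed (simp add: c'_def)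
      then have "(\<Sum>r<p. \<Sum>m<n. c' m r * \<mu> r) = (\<Sum>r<p. \<Sum>l<n. c (l, r) * \<mu> r)"
        by (simp add: sum_distrib_right[symmetric])
      then show ?thesis by (simp only: sum.swap[of _ "{..<p}" "{..<n}"])
    qed
    have quad: "(\<Sum>m<n. quad p \<Sigma> (c' m)) = (\<Sum>l<n. quad p \<Sigma> (\<lambda>r. c (l, r)))"
    proof -
      have gen: "(\<Sum>m<n. quad p \<Sigma> (e m)) = (\<Sum>r<p. \<Sum>s<p. \<Sigma> r s * (\<Sum>m<n. e m r * e m s))"
        for e :: "nat \<Rightarrow> nat \<Rightarrow> real"
      proof -
        have "(\<Sum>m<n. quad p \<Sigma> (e m)) = (\<Sum>r<p. \<Sum>m<n. \<Sum>s<p. e m r * \<Sigma> r s * e m s)"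
          unfolding quad_def by (rule sum.swap)
        also have "\<dots> = (\<Sum>r<p. \<Sum>s<p. \<Sum>m<n. e m r * \<Sigma> r s * e m s)"
          by (intro sum.cong refl sum.swap)
        finally show ?thesis by (simp add: sum_distrib_left mult_ac)
      qed
      have "\<Sigma> r s * (\<Sum>m<n. c' m r * c' m s) = \<Sigma> r s * (\<Sum>m<n. c (m, r) * c (m, s))"
        if rs: "r < p" "s < p" for r s
      proof (cases "blk_of pp r = blk_of pp s")
        \<comment> \<open>Rotating one block alone would change a covariance between two blocks;
          here the null hypothesis enters.\<close>
        case False
        then show ?thesis using null[OF rs] by simp
      next
        case eq: True
        show ?thesis
        proof (cases "blk_of pp r = j")
          case True
          have "(\<Sum>m<n. c' m r * c' m s)
              = (\<Sum>m<n. \<Sum>l<n. \<Sum>l'<n. c (l, r) * c (l', s) * (ent R m l * ent R m l'))"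
            using True eq by (simp add: c'_def sum_product mult_ac)
          also have "\<dots> = (\<Sum>l<n. \<Sum>m<n. \<Sum>l'<n. c (l, r) * c (l', s) * (ent R m l * ent R m l'))"
            by (rule sum.swap)
          also have "\<dots> = (\<Sum>l<n. \<Sum>l'<n. \<Sum>m<n. c (l, r) * c (l', s) * (ent R m l * ent R m l'))"
            by (intro sum.cong refl sum.swap)
          also have "\<dots> = (\<Sum>l<n. \<Sum>l'<n. if l = l' then c (l, r) * c (l, s) else 0)"
            by (intro sum.cong refl) (simp add: sum_distrib_left[symmetric] RR)
          finally show ?thesis by simp
        qed (use eq in \<open>simp add: c'_def\<close>)
      qed
      then show ?thesis unfolding gen by (intro sum.cong refl) auto
    qed
    have "(\<integral>z. iexp (\<Sum>i\<in>index. c i * z i) \<partial>distr law (PiM index (\<lambda>_. borel)) ?\<rho>)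
        = (\<integral>z. iexp (\<Sum>i\<in>index. c i * ?\<rho> z i) \<partial>law)"
      by (rule integral_distr[OF m\<rho> im])
    also have "\<dots> = (\<integral>z. iexp (\<Sum>i\<in>index. (case i of (m, r) \<Rightarrow> c' m r) * z i) \<partial>law)"
      by (simp only: rot)
    also have "\<dots> = (\<integral>z. iexp (\<Sum>i\<in>index. c i * z i) \<partial>law)"
      unfolding ex by (simp add: mean quad)
    finally show "(\<integral>z. iexp (\<Sum>i\<in>index. c i * z i) \<partial>distr law (PiM index (\<lambda>_. borel)) ?\<rho>)
        = (\<integral>z. iexp (\<Sum>i\<in>index. c i * z i) \<partial>law)" .
  qed (simp_all add: prob_space_law sets_law)
  moreover have "distr law law ?\<rho> = distr law (PiM index (\<lambda>_. borel)) ?\<rho>"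
    by (rule distr_cong) (simp_all add: sets_law)
  ultimately show "distr law law ?\<rho> = law" by simp
qed

text \<open>Expanded along its last row, the determinant is an affine function of the last observation whose
  top coefficient is the determinant for the earlier, independent observations.\<close>

lemma AE_affine_nonsingular:
  assumes i: "i < k" and n: "pp i < n"
  shows "d \<le> pp i \<Longrightarrow> AE w in M. det (affine_mat (blk_off pp i) d (\<lambda>j r. x j w r)) \<noteq> 0"
proof (induction d)
  case 0
  have "det (affine_mat (blk_off pp i) 0 f) = 1" for f
    by (subst det_single) (auto simp: affine_mat_def)
  then show ?case by simp
next
  case (Suc d)
  let ?o = "blk_off pp i"
  let ?S = "PiM {..d} (\<lambda>_. PiM {..<p} (\<lambda>_. borel :: real measure))"
  let ?T = "PiM {Suc d} (\<lambda>_. PiM {..<p} (\<lambda>_. borel :: real measure))"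
  let ?U = "\<lambda>w. restrict (\<lambda>j. restrict (x j w) {..<p}) {..d}"
  let ?V = "\<lambda>w. restrict (\<lambda>j. restrict (x j w) {..<p}) {Suc d}"
  define K where "K c f = cofactor (affine_mat ?o (Suc d) f) (Suc d) c" for c and f :: "nat \<Rightarrow> nat \<Rightarrow> real"
  have op: "?o + a < p" if "a \<le> d" for a
    using blk_off_add_less[OF i, of a pp] that Suc.prems by simp
  have dn: "Suc d < n" using Suc.prems n by simp
  have KU: "K c (?U w) = K c (\<lambda>j r. x j w r)" if "c < Suc (Suc d)" for c w
    unfolding K_def
  proof (intro cofactor_affine_cong that)
    fix j r assume "j \<le> d" "?o \<le> r" "r \<le> ?o + d"
    moreover from this have "r < p" using op[of "r - ?o"] by simp
    ultimately show "?U w j r = x j w r" by simp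
  qed
  have "indep_var ?S ?U ?T ?V"
    by (rule indep_var_restrict[OF indep]) (use dn in auto)
  then have U: "?U \<in> measurable M ?S" and V: "?V \<in> measurable M ?T"
    and D: "distr M ?S ?U \<Otimes>\<^sub>M distr M ?T ?V = distr M (?S \<Otimes>\<^sub>M ?T) (\<lambda>w. (?U w, ?V w))"
    by (auto simp: indep_var_distribution_eq)
  interpret U: prob_space "distr M ?S ?U" by (rule prob_space_distr[OF U])
  interpret V: prob_space "distr M ?T ?V" by (rule prob_space_distr[OF V])
  interpret UV: pair_prob_space "distr M ?S ?U" "distr M ?T ?V" ..
  let ?g = "\<lambda>q. K 0 (fst q) + (\<Sum>a<Suc d. snd q (Suc d) (?o + a) * K (Suc a) (fst q))"
  have Km: "K c \<in> borel_measurable ?S" if c: "c < Suc (Suc d)" for c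
    unfolding K_def cofactor_def
  proof (intro borel_measurable_times borel_measurable_const borel_measurable_det)
    show "mat_delete (affine_mat ?o (Suc d) f) (Suc d) c \<in> carrier_mat (Suc d) (Suc d)" for f
      using mat_delete_carrier[OF affine_mat_carrier, of ?o "Suc d" f "Suc d" c] by simp
    fix a b assume ab: "a < Suc d" "b < Suc d"
    have em: "(\<lambda>f. f j r) \<in> borel_measurable ?S" if "j \<le> d" "r < p" for j r
      using that by (intro measurable_nested_component) auto
    define q where "q = (if b < c then b else Suc b)"
    have entry: "mat_delete (affine_mat ?o (Suc d) f) (Suc d) c $$ (a, b)
        = (if q = 0 then 1 else f a (?o + q - 1))" for f
      using ab by (simp add: mat_delete_def affine_mat_def q_def)
    show "(\<lambda>f. mat_delete (affine_mat ?o (Suc d) f) (Suc d) c $$ (a, b)) \<in> borel_measurable ?S"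
    proof (cases "q = 0")
      case False
      then have "?o + q - 1 < p" using op[of "q - 1"] ab by (auto simp: q_def split: if_splits)
      then show ?thesis unfolding entry using False ab by (simp add: em)
    qed (simp add: entry)
  qed
  have gm: "?g \<in> borel_measurable (?S \<Otimes>\<^sub>M ?T)"
  proof (intro borel_measurable_add borel_measurable_sum borel_measurable_times)
    show "(\<lambda>q. K 0 (fst q)) \<in> borel_measurable (?S \<Otimes>\<^sub>M ?T)"
      by (rule measurable_compose[OF measurable_fst Km]) simp
    fix a assume a: "a \<in> {..<Suc d}"
    show "(\<lambda>q. K (Suc a) (fst q)) \<in> borel_measurable (?S \<Otimes>\<^sub>M ?T)"
      using a by (intro measurable_compose[OF measurable_fst Km]) simp
    have "(\<lambda>v. v (Suc d) (?o + a)) \<in> borel_measurable ?T"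
      using a op[of a] by (intro measurable_nested_component) auto
    then show "(\<lambda>q. snd q (Suc d) (?o + a)) \<in> borel_measurable (?S \<Otimes>\<^sub>M ?T)"
      by (rule measurable_compose[OF measurable_snd])
  qed
  have KSm: "(\<lambda>q. K (Suc d) (fst q)) \<in> borel_measurable (?S \<Otimes>\<^sub>M ?T)"
    by (rule measurable_compose[OF measurable_fst Km]) simp
  have set: "{q \<in> space (?S \<Otimes>\<^sub>M ?T). K (Suc d) (fst q) \<noteq> 0 \<longrightarrow> ?g q \<noteq> 0} \<in> sets (?S \<Otimes>\<^sub>M ?T)"
    using gm KSm by measurable
  \<comment> \<open>With the earlier observations frozen at \<open>u\<close> and a nonzero top
    coefficient, \<open>?g\<close> is a constant plus a nontrivial linear combination of the new
    observation. Such a combination has no atoms, so the value 0 has probability 0.\<close>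
  have AE_V: "AE v in distr M ?T ?V. K (Suc d) u \<noteq> 0 \<longrightarrow> ?g (u, v) \<noteq> 0" if u: "u \<in> space ?S" for u
  proof (cases "K (Suc d) u = 0")
    case False
    define e where "e r = (if ?o \<le> r \<and> r < ?o + Suc d then K (Suc (r - ?o)) u else 0)" for r
    have "\<exists>r<p. e r \<noteq> 0"
      using False op[of d] by (intro exI[of _ "?o + d"]) (simp add: e_def)
    then have "AE w in M. (\<Sum>r<p. e r * x (Suc d) w r) \<noteq> - K 0 u"
      by (rule linear_combination(3)[OF dn])
    moreover have "(\<Sum>a<Suc d. x (Suc d) w (?o + a) * K (Suc a) u) = (\<Sum>r<p. e r * x (Suc d) w r)" for w
    proof -
      have "(\<Sum>r<p. e r * x (Suc d) w r) = (\<Sum>r\<in>(\<lambda>a. ?o + a) ` {..<Suc d}. e r * x (Suc d) w r)"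
      proof (rule sum.mono_neutral_right)
        show "(\<lambda>a. ?o + a) ` {..<Suc d} \<subseteq> {..<p}" using op by auto
        show "\<forall>r\<in>{..<p} - (\<lambda>a. ?o + a) ` {..<Suc d}. e r * x (Suc d) w r = 0"
        proof
          fix r assume r: "r \<in> {..<p} - (\<lambda>a. ?o + a) ` {..<Suc d}"
          have "\<not> (?o \<le> r \<and> r < ?o + Suc d)"
          proof
            assume "?o \<le> r \<and> r < ?o + Suc d"
            then have "r = ?o + (r - ?o)" "r - ?o \<in> {..<Suc d}" by auto
            then show False using r by blast
          qed
          then show "e r * x (Suc d) w r = 0" unfolding e_def by (simp only: if_False mult_zero_left)
        qed
      qed simp
      also have "\<dots> = (\<Sum>a<Suc d. e (?o + a) * x (Suc d) w (?o + a))"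
        by (subst sum.reindex) (auto simp: inj_on_def)
      also have "\<dots> = (\<Sum>a<Suc d. x (Suc d) w (?o + a) * K (Suc a) u)"
        by (intro sum.cong refl) (simp add: e_def)
      finally show ?thesis by simp
    qed
    ultimately have "AE w in M. K 0 u + (\<Sum>a<Suc d. x (Suc d) w (?o + a) * K (Suc a) u) \<noteq> 0"
      by (auto elim!: eventually_mono)
    then have AEw: "AE w in M. ?g (u, ?V w) \<noteq> 0"
    proof eventually_elim
      case (elim w)
      have "(\<Sum>a<Suc d. ?V w (Suc d) (?o + a) * K (Suc a) u) = (\<Sum>a<Suc d. x (Suc d) w (?o + a) * K (Suc a) u)"
        using op by (intro sum.cong refl) auto
      then show ?case using elim by simp
    qed
    have "(\<lambda>v. ?g (u, v)) \<in> borel_measurable ?T"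
      by (rule measurable_compose[OF _ gm]) (use u in measurable)
    then have "{v \<in> space ?T. ?g (u, v) \<noteq> 0} \<in> sets ?T" by measurable
    then have "AE v in distr M ?T ?V. ?g (u, v) \<noteq> 0"
      using AEw by (subst AE_distr_iff[OF V]) auto
    then show ?thesis by (auto elim: eventually_mono)
  qed simp
  \<comment> \<open>Fubini, applicable because the joint law of earlier and new observations is the
    product \<open>D\<close>.\<close>
  have "AE q in distr M ?S ?U \<Otimes>\<^sub>M distr M ?T ?V. K (Suc d) (fst q) \<noteq> 0 \<longrightarrow> ?g q \<noteq> 0"
  proof (rule UV.AE_pair_measure)
    show "{q \<in> space (distr M ?S ?U \<Otimes>\<^sub>M distr M ?T ?V). K (Suc d) (fst q) \<noteq> 0 \<longrightarrow> ?g q \<noteq> 0}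
        \<in> sets (distr M ?S ?U \<Otimes>\<^sub>M distr M ?T ?V)"
      using set by (simp add: space_pair_measure cong: sets_pair_measure_cong)
    show "AE u in distr M ?S ?U. AE v in distr M ?T ?V.
        K (Suc d) (fst (u, v)) \<noteq> 0 \<longrightarrow> ?g (u, v) \<noteq> 0"
    proof (rule AE_I2)
      fix u assume "u \<in> space (distr M ?S ?U)"
      then have "u \<in> space ?S" by (simp only: space_distr)
      from AE_V[OF this] show "AE v in distr M ?T ?V. K (Suc d) (fst (u, v)) \<noteq> 0 \<longrightarrow> ?g (u, v) \<noteq> 0"
        by (simp only: fst_conv)
    qed
  qed
  then have "AE q in distr M (?S \<Otimes>\<^sub>M ?T) (\<lambda>w. (?U w, ?V w)). K (Suc d) (fst q) \<noteq> 0 \<longrightarrow> ?g q \<noteq> 0"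
    unfolding D .
  then have "AE w in M. K (Suc d) (?U w) \<noteq> 0 \<longrightarrow> ?g (?U w, ?V w) \<noteq> 0"
    by (subst (asm) AE_distr_iff[OF measurable_Pair[OF U V] set]) simp
  moreover have "AE w in M. det (affine_mat ?o d (\<lambda>j r. x j w r)) \<noteq> 0"
    using Suc by simp
  ultimately show ?case
  proof eventually_elim
    case (elim w)
    have "K (Suc d) (?U w) = det (affine_mat ?o d (\<lambda>j r. x j w r))"
      unfolding KU[OF lessI] by (simp add: K_def cofactor_def mat_delete_affine)
    then have g: "?g (?U w, ?V w) \<noteq> 0" using elim by simp
    have "(\<Sum>a<Suc d. ?V w (Suc d) (?o + a) * K (Suc a) (?U w))
        = (\<Sum>a<Suc d. x (Suc d) w (?o + a) * K (Suc a) (\<lambda>j r. x j w r))"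
      using op by (intro sum.cong refl) (auto simp: KU)
    then have "?g (?U w, ?V w) = det (affine_mat ?o (Suc d) (\<lambda>j r. x j w r))"
      unfolding det_affine_Suc K_def[symmetric] using KU[of 0 w] by simp
    then show ?case using g by simp
  qed
qed

end

section \<open>From the normal sample to the model of random projections\<close>

context normal_sample
begin

lemma affine_mat_sample:
  assumes "i < k" "pp i < n"
  shows "affine_mat (blk_off pp i) (pp i) (\<lambda>j r. sample w (j, r))
    = affine_mat (blk_off pp i) (pp i) (\<lambda>j r. x j w r)"
proof (rule eq_matI)
  fix j c assume "j < dim_row (affine_mat (blk_off pp i) (pp i) (\<lambda>j r. x j w r))"
    "c < dim_col (affine_mat (blk_off pp i) (pp i) (\<lambda>j r. x j w r))"
  then have jc: "j < Suc (pp i)" "c < Suc (pp i)" by (simp_all add: affine_mat_def)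
  have "blk_off pp i + c - 1 < p" if "c \<noteq> 0"
    using blk_off_add_less[OF assms(1), of "c - 1" pp] jc that by simp
  then show "affine_mat (blk_off pp i) (pp i) (\<lambda>j r. sample w (j, r)) $$ (j, c)
      = affine_mat (blk_off pp i) (pp i) (\<lambda>j r. x j w r) $$ (j, c)"
    using jc assms(2) by (simp add: affine_mat_def sample_def index_def)
qed (simp_all add: affine_mat_def)

lemma AE_gram_nonsingular:
  assumes "i < k" "pp i < n"
  shows "AE z in law. det (to_mat (pp i) (gram pp n i z)) \<noteq> 0"
proof -
  have "mfun (PiM index (\<lambda>_. borel)) (\<lambda>z. gram pp n i z)"
    by (rule mfun_bproj(2)[OF _ assms(1), where Z = "\<lambda>z. z"])
      (auto intro!: measurable_component_singleton simp: index_def)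
  then have [measurable]: "(\<lambda>z. det (to_mat (pp i) (gram pp n i z))) \<in> borel_measurable (PiM index (\<lambda>_. borel))"
    by (rule mfun_det)
  have "AE w in M. det (to_mat (pp i) (gram pp n i (sample w))) \<noteq> 0"
    using AE_affine_nonsingular[OF assms order_refl]
  proof eventually_elim
    case (elim w)
    have "det (affine_mat (blk_off pp i) (pp i) (\<lambda>j r. sample w (j, r))) \<noteq> 0"
      unfolding affine_mat_sample[OF assms] by (rule elim)
    with assms(2) show ?case by (rule gram_nonsingular)
  qed
  then show ?thesis
    unfolding law_def by (subst AE_distr_iff[OF sample_measurable]) auto
qed

lemma block_model_law:
  assumes n: "2 \<le> n" and pn: "\<And>i. i < k \<Longrightarrow> pp i < n"
  shows "block_model law n k (bproj k pp n) pp"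
proof -
  have "rot_model law n k (bproj k pp n)"
    unfolding rot_model_def rot_model_axioms_def
  proof (intro conjI allI impI)
    show "prob_space law" by (rule prob_space_law)
    show "1 \<le> n" using n by simp
    fix i a b
    have "mfun law (\<lambda>z. bproj k pp n z i)"
      by (rule mfun_bproj(1)[where Z = "\<lambda>z. z"]) (auto intro!: law_component simp: index_def)
    then show "(\<lambda>z. ent (bproj k pp n z i) a b) \<in> borel_measurable law" by (rule mfun_ent)
  next
    fix j R assume "j < k" "rotation n R"
    then show "\<exists>\<rho>\<in>measurable law law. distr law law \<rho> = law
        \<and> (\<forall>z\<in>space law. bproj k pp n (\<rho> z) = act j R (bproj k pp n z))"
      using law_rotate[of j R] bproj_rotate[of n R j k pp]
      by (intro bexI[of _ "rotate_data pp k n j R"]) auto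
  qed (rule valid_bproj)
  moreover have "AE z in law. tr (bproj k pp n z i) = real (pp i)" if "i < k" for i
    using AE_gram_nonsingular[OF that pn[OF that]] by eventually_elim (rule tr_bproj[OF that])
  ultimately show ?thesis
    unfolding block_model_def block_model_axioms_def using n pn by (auto intro: less_imp_le)
qed

lemma schott_stat_measurable: "(\<lambda>w. schott_stat k pp n (\<lambda>j. x j w)) \<in> borel_measurable M"
proof -
  have "mfun M (\<lambda>w. bproj k pp n (\<lambda>(j, r). x j w r) i)" for i
    by (rule mfun_bproj(1)) (simp add: coordinate_measurable)
  then have "(\<lambda>w. tr ((\<Sum>i<k. bproj k pp n (\<lambda>(j, r). x j w r) i) * (\<Sum>i<k. bproj k pp n (\<lambda>(j, r). x j w r) i)))
      \<in> borel_measurable M"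
    by (intro mfun_tr mfun_mult mfun_sum)
  then show ?thesis unfolding schott_stat_eq by measurable
qed

text \<open>The diagonal terms tr(P_i P_i) = p_i add up to p and cancel the subtracted p/2. They
  have this value only where the Gram matrices are invertible, so the two variables agree almost
  surely, which is enough for their laws.\<close>

lemma schott_stat_distr:
  assumes n: "2 \<le> n" and pn: "\<And>i. i < k \<Longrightarrow> pp i < n"
  shows "distr M borel (\<lambda>w. (schott_stat k pp n (\<lambda>j. x j w)
      - (1/2) * (\<Sum>i<k. \<Sum>j\<in>{..<k} - {i}. real (pp i) * real (pp j) / (real n - 1))) / \<sigma>)
    = distr law borel (\<lambda>z. block_model.T n k pp (bproj k pp n z) / \<sigma>)"
proof -
  interpret L: block_model law n k "bproj k pp n" pp
    using n pn by (rule block_model_law)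
  let ?a = "(1/2) * (\<Sum>i<k. \<Sum>j\<in>{..<k} - {i}. real (pp i) * real (pp j) / (real n - 1))"
  have Tm: "(\<lambda>z. L.T (bproj k pp n z)) \<in> borel_measurable (PiM index (\<lambda>_. borel))"
    using L.tame_fun_measurable[OF L.T_tame_fun] by (simp add: measurable_cong_sets[OF sets_law refl])
  have AE_law: "AE z in law. \<forall>i<k. tr (bproj k pp n z i) = real (pp i)"
    using L.AE_P by eventually_elim simp
  have "AE w in M. \<forall>i<k. tr (bproj k pp n (sample w) i) = real (pp i)"
    by (rule AE_distrD[OF sample_measurable AE_law[unfolded law_def]])
  then have "AE w in M. (schott_stat k pp n (\<lambda>j. x j w) - ?a) / \<sigma> = L.T (bproj k pp n (sample w)) / \<sigma>"
  proof eventually_elim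
    case (elim w)
    let ?P = "bproj k pp n (sample w)"
    have P: "bproj k pp n (\<lambda>(j, r). x j w r) = ?P"
      by (rule bproj_cong) (simp add: sample_def index_def)
    have idem: "?P i * ?P i = ?P i" for i by (rule validD(4)[OF valid_bproj])
    have "tr ((\<Sum>i<k. ?P i) * (\<Sum>i<k. ?P i)) = (\<Sum>i<k. \<Sum>j<k. tr (?P i * ?P j))"
      by (simp add: sum_product tr_sum)
    also have "\<dots> = (\<Sum>i<k. real (pp i) + (\<Sum>j\<in>{..<k} - {i}. tr (?P i * ?P j)))"
    proof (rule sum.cong[OF refl])
      fix i assume "i \<in> {..<k}"
      then show "(\<Sum>j<k. tr (?P i * ?P j)) = real (pp i) + (\<Sum>j\<in>{..<k} - {i}. tr (?P i * ?P j))"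
        using elim by (subst sum.remove[of _ i]) (auto simp: idem)
    qed
    also have "\<dots> = real p + (\<Sum>i<k. \<Sum>j\<in>{..<k} - {i}. tr (?P i * ?P j))"
      by (simp add: sum.distrib blk_off_def)
    finally have "schott_stat k pp n (\<lambda>j. x j w) = (\<Sum>i<k. \<Sum>j\<in>{..<k} - {i}. tr (?P i * ?P j)) / 2"
      unfolding schott_stat_eq P by linarith
    then have "schott_stat k pp n (\<lambda>j. x j w) - ?a = L.T ?P"
      by (simp add: L.T_def mean2_of_def sum_subtractf diff_divide_distrib)
    then show ?case by simp
  qed
  then have "distr M borel (\<lambda>w. (schott_stat k pp n (\<lambda>j. x j w) - ?a) / \<sigma>)
      = distr M borel (\<lambda>w. L.T (bproj k pp n (sample w)) / \<sigma>)"
    using schott_stat_measurable measurable_compose[OF sample_measurable Tm]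
    by (intro distr_cong_AE) auto
  also have "\<dots> = distr law borel (\<lambda>z. L.T (bproj k pp n z) / \<sigma>)"
    unfolding law_def using Tm by (subst distr_distr[OF _ sample_measurable]) (auto simp: comp_def)
  finally show ?thesis .
qed

end

theorem theorem1:
  fixes M :: "nat \<Rightarrow> 'a measure"
    and k :: nat
    and pp :: "nat \<Rightarrow> nat \<Rightarrow> nat"
    and y :: "nat \<Rightarrow> real"
    and x :: "nat \<Rightarrow> nat \<Rightarrow> 'a \<Rightarrow> nat \<Rightarrow> real"
    and \<mu> :: "nat \<Rightarrow> nat \<Rightarrow> real"
    and \<Sigma> :: "nat \<Rightarrow> nat \<Rightarrow> nat \<Rightarrow> real"
  assumes k2: "k \<ge> 2"
    and pos: "\<And>n i. i < k \<Longrightarrow> pp n i > 0"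
    and prob: "\<And>n. prob_space (M n)"
    and indep: "\<And>n. prob_space.indep_vars (M n) (\<lambda>_. PiM {..<blk_off (pp n) k} (\<lambda>_. borel))
                   (\<lambda>j w. restrict (x n j w) {..<blk_off (pp n) k}) {..<n}"
    and normal: "\<And>n j. j < n \<Longrightarrow> mvn (M n) (blk_off (pp n) k) (x n j) (\<mu> n) (\<Sigma> n)"
    and sym: "\<And>n r s. r < blk_off (pp n) k \<Longrightarrow> s < blk_off (pp n) k \<Longrightarrow> \<Sigma> n r s = \<Sigma> n s r"
    and posdef: "\<And>n c. (\<exists>r < blk_off (pp n) k. c r \<noteq> 0) \<Longrightarrow>
                   (\<Sum>r<blk_off (pp n) k. \<Sum>s<blk_off (pp n) k. c r * \<Sigma> n r s * c s) > 0"
    and null: "\<And>n r s. r < blk_off (pp n) k \<Longrightarrow> s < blk_off (pp n) k \<Longrightarrow>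
                   blk_of (pp n) r \<noteq> blk_of (pp n) s \<Longrightarrow> \<Sigma> n r s = 0"
    and y: "\<And>i. i < k \<Longrightarrow> 0 < y i \<and> y i < 1"
    and lim: "\<And>i. i < k \<Longrightarrow> (\<lambda>n. real (pp n i) / real n) \<longlonglongrightarrow> y i"
  shows "weak_conv_m
           (\<lambda>n. distr (M n) borel
              (\<lambda>w. (schott_stat k (pp n) n (\<lambda>j. x n j w)
                     - (1/2) * (\<Sum>i<k. \<Sum>j\<in>{..<k} - {i}. real (pp n i) * real (pp n j) / (real n - 1)))
                    / sqrt (\<Sum>i<k. \<Sum>j\<in>{..<k} - {i}.
                        real (pp n i) * real (pp n j) * (real n - 1 - real (pp n i))
                          * (real n - 1 - real (pp n j)) / (real n - 1) ^ 4)))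
           std_normal_distribution"
proof -
  have ns: "normal_sample (M n) n k (pp n) (x n) (\<mu> n) (\<Sigma> n)" for n
    unfolding normal_sample_def normal_sample_axioms_def
    using prob indep normal posdef null by auto
  define law where "law n = normal_sample.law (M n) n k (pp n) (x n)" for n
  let ?f = "\<lambda>n w. (schott_stat k (pp n) n (\<lambda>j. x n j w)
      - (1/2) * (\<Sum>i<k. \<Sum>j\<in>{..<k} - {i}. real (pp n i) * real (pp n j) / (real n - 1))) / sqrt (b_of n k (pp n))"
  \<comment> \<open>Here y_i < 1 is used: p_i < n provides the p_i + 1 observations that the full
    rank argument for the centred data requires, and 2 \<le> n makes N positive.\<close>
  have large: "eventually (\<lambda>n. 2 \<le> n \<and> (\<forall>i<k. pp n i < n)) sequentially"
  proof -
    have "eventually (\<lambda>n. pp n i < n) sequentially" if "i < k" for i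
    proof -
      have "eventually (\<lambda>n. real (pp n i) / real n < 1) sequentially"
        using order_tendstoD(2)[OF lim[OF that], of 1] y[OF that] by simp
      then show ?thesis
        using eventually_gt_at_top[of 0] by eventually_elim (simp add: divide_less_eq)
    qed
    then have "eventually (\<lambda>n. \<forall>i\<in>{..<k}. pp n i < n) sequentially"
      by (intro eventually_ball_finite) auto
    then show ?thesis using eventually_ge_at_top[of 2] by eventually_elim auto
  qed
  have model: "eventually (\<lambda>n. block_model (law n) n k (bproj k (pp n) n) (pp n)) sequentially"
    using large by eventually_elim (auto simp: law_def intro!: normal_sample.block_model_law[OF ns])
  have eq: "eventually (\<lambda>n. distr (law n) borel (\<lambda>z. block_model.T n k (pp n) (bproj k (pp n) n z) / sqrt (b_of n k (pp n)))
      = distr (M n) borel (?f n)) sequentially"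
    using large
    by eventually_elim (simp only: law_def, rule normal_sample.schott_stat_distr[OF ns, symmetric], auto)
  have "weak_conv_m (\<lambda>n. distr (M n) borel (?f n)) std_normal_distribution"
  proof (rule levy_continuity)
    fix n
    interpret normal_sample "M n" n k "pp n" "x n" "\<mu> n" "\<Sigma> n" by (rule ns)
    have "?f n \<in> borel_measurable (M n)"
      using schott_stat_measurable by measurable
    then show "real_distribution (distr (M n) borel (?f n))"
      by (rule real_distribution_distr)
  next
    show "real_distribution std_normal_distribution" by (rule real_dist_normal_dist)
    fix t
    have "(\<lambda>n. char (distr (law n) borel (\<lambda>z. block_model.T n k (pp n) (bproj k (pp n) n z) / sqrt (b_of n k (pp n)))) t)
        \<longlonglongrightarrow> of_real (exp (- (t\<^sup>2 / 2)))"
      by (rule block_model_char_limit[OF model k2 y lim])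
    moreover have "eventually (\<lambda>n. char (distr (law n) borel (\<lambda>z. block_model.T n k (pp n) (bproj k (pp n) n z) / sqrt (b_of n k (pp n)))) t
        = char (distr (M n) borel (?f n)) t) sequentially"
      using eq by eventually_elim simp
    ultimately show "(\<lambda>n. char (distr (M n) borel (?f n)) t) \<longlonglongrightarrow> char std_normal_distribution t"
      unfolding char_std_normal_distribution by (auto intro: Lim_transform_eventually)
  qed
  then show ?thesis unfolding b_of_def .
qed

end
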